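(* Fix $a>0$ and let $b\to+\infty$ through real values. Let $\mathcal{A}=\{\xi=x+iy\in\mathbb{C}:\ x<1 \text{ or } x-1-\tfrac12\log(x^2+y^2)<0\}$ and $\mathcal{B}=\{\xi=x+iy\in\mathbb{C}:\ x>1 \text{ and } x-1-\tfrac12\log(x^2+y^2)>0\}$. (a) For $\xi\in\mathcal{A}$, writing $w=\xi/(1-\xi)$, $$ {}_1F_1(a;b;b\xi)=(1-\xi)^{-a}\Big\{1-\frac{a(a+1)}{2}w^2\,b^{-1}+\Big[\frac{a(a+1)(a+2)(a+3)}{8}w^4+\frac{2a(a+1)(a+2)}{3}w^3+\frac{a(a+1)}{2}w^2\Big]b^{-2}+O(b^{-3})\Big\}, $$ uniformly for $\xi$ in compact subsets of $\mathcal{A}$, where $(1-\xi)^{-a}$ is the principal branch (i.e. $\arg(1-\xi)=0$ for real $\xi<1$). (b) For $\xi\in\mathcal{B}$, $$ {}_1F_1(a;b;b\xi)=e^{b(\xi-1-\log\xi)}\,b^{a-\frac12}\,\frac{\sqrt{2\pi}}{\Gamma(a)}\,\xi(\xi-1)^{a-1}\Big[1+\frac{1}{12b}\Big(1+\frac{12a(a-1)}{\xi-1}+\frac{6(a-1)(a-2)}{(\xi-1)^2}\Big)+O(b^{-2})\Big], $$ uniformly for $\xi$ in compact subsets of $\mathcal{B}$, where $\log\xi$ and $(\xi-1)^{a-1}$ are principal branches (i.e. $\arg\xi=\arg(\xi-1)=0$ for real $\xi>1$).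
   Context: ${}_1F_1(a;b;z)=\sum_{k=0}^\infty \frac{(a)_k}{(b)_k}\frac{z^k}{k!}$ is Kummer's confluent hypergeometric function, with $(x)_k=\Gamma(x+k)/\Gamma(x)$. *)

theory Defs
  imports "HOL-Analysis.Analysis"
begin

definition hyp1F1 :: "complex \<Rightarrow> complex \<Rightarrow> complex \<Rightarrow> complex" where
  "hyp1F1 a b z = (\<Sum>k. pochhammer a k / pochhammer b k * z ^ k / fact k)"

definition regionA :: "complex set" where
  "regionA = {\<xi>. Re \<xi> < 1 \<or> Re \<xi> - 1 - ln ((Re \<xi>)\<^sup>2 + (Im \<xi>)\<^sup>2) / 2 < 0}"

definition regionB :: "complex set" where
  "regionB = {\<xi>. Re \<xi> > 1 \<and> Re \<xi> - 1 - ln ((Re \<xi>)\<^sup>2 + (Im \<xi>)\<^sup>2) / 2 > 0}"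

end

theory Submission
  imports Defs "HOL-Real_Asymp.Real_Asymp" "HOL-Probability.Sinc_Integral"
    "HOL-Complex_Analysis.Complex_Analysis"
begin

text \<open>
  Inside region A, termwise integration of the binomial series shows that the quotient of
  \<open>\<integral> e\<^bsup>bu\<^esup> u\<^bsup>-b\<^esup> (1 - \<xi>/u)\<^bsup>-a\<^esup> du\<close> by the same integral without the last factor equals
  \<open>\<^sub>1F\<^sub>1(a;b;b\<xi>)\<close> for \<open>|\<xi>| < 1\<close>, because integration by parts gives the moments of \<open>1/u\<close> as
  \<open>b\<^sup>k/(b)\<^sub>k\<close>. Any contour works that runs upwards through the saddle point \<open>u = 1\<close> and along which
  \<open>|e\<^bsup>u-1\<^esup>/u|\<close> has its maximum there. For \<open>\<xi>\<close> in region A the line \<open>Re u = 1\<close>, bulged to the right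
  where necessary, is such a contour with \<open>\<xi>\<close> on its left, and the identity extends to
  that \<open>\<xi>\<close> by analytic continuation. Taylor expansion in \<open>1/u - 1\<close> then gives the series, its
  moments being rational functions of \<open>b\<close>; neither the Gamma function nor Stirling's formula is needed.

  Inside region B, Euler's integral becomes \<open>\<integral> e\<^bsup>-bv\<^esup> v\<^bsup>b-a-1\<^esup> (\<xi> - v)\<^bsup>a-1\<^esup> dv\<close> from \<open>0\<close> to \<open>\<xi>\<close>.
  The path is moved to the real axis up to a point slightly left of \<open>Re \<xi>\<close>, followed by a vertical
  segment on which, by the definition of region B, the integrand is exponentially small. On the real axis
  the saddle point is \<open>v = 1\<close>, and the weight is that of a Gamma distribution with explicit moments.
  The correction \<open>1/(12b)\<close> comes from Stirling's formula for the remaining factor \<open>\<Gamma>(b)\<close>.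
\<close>

section \<open>Uniformity on compact sets and the binomial series\<close>

text \<open>For \<open>\<xi>\<close> with \<open>Re \<xi> \<ge> 1\<close> the function x - 1 -
  log|\<open>\<xi>\<close>| is ln |e^(u-1)/u| at u = \<open>\<xi>\<close>, so its sign compares
  \<open>\<xi>\<close> with the saddle at 1. A negative sign leaves room to carry a contour to the
  right of \<open>\<xi>\<close> while staying below saddle level. A positive sign says that the
  reciprocal weight |e^(-v) v| is smaller at \<open>\<xi>\<close> than at 1, so the end of Euler's
  path is negligible. Both halves count powers on the scale b^(-1/2) around the saddle. A remainder
  of order six in region A has size b^(-7/2), to be divided by a normalising integral of size
  b^(-1/2); this quotient fixes the number of Taylor terms, and of the normalising integral only a
  lower bound enters. In region B the fourth moment is already O(b^(-2)). The contours, the cut-off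
  point and all constants depend on the position of \<open>\<xi>\<close>, so the estimates are
  proved on a neighbourhood of each point, and compactness supplies the common constant.\<close>

lemma compact_uniform:
  fixes K :: "'a::topological_space set" and Q :: "real \<Rightarrow> real \<Rightarrow> 'a \<Rightarrow> bool"
  assumes "compact K"
    and loc: "\<And>x. x \<in> K \<Longrightarrow> \<exists>U C B. open U \<and> x \<in> U \<and> (\<forall>b\<ge>B. \<forall>y\<in>U. Q C b y)"
    and mono: "\<And>C C' b x. Q C b x \<Longrightarrow> C \<le> C' \<Longrightarrow> b \<ge> 1 \<Longrightarrow> Q C' b x"
  shows "\<exists>C B. \<forall>b\<ge>B. \<forall>x\<in>K. Q C b x"
proof -
  obtain U C B where U: "\<And>x. x \<in> K \<Longrightarrow> open (U x)" "\<And>x. x \<in> K \<Longrightarrow> x \<in> U x"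
    and Q: "\<And>x b y. x \<in> K \<Longrightarrow> b \<ge> B x \<Longrightarrow> y \<in> U x \<Longrightarrow> Q (C x) b y"
    using loc by metis
  obtain D where D: "D \<subseteq> K" "finite D" "K \<subseteq> (\<Union>x\<in>D. U x)"
    using compactE_image[OF \<open>compact K\<close>, of K U] U by blast
  \<comment> \<open>The inserted 0 and 1 keep the maxima meaningful when \<open>D\<close> is empty.
    The 1 also puts \<open>b\<close> in the range where \<open>mono\<close> may raise each local
    constant to the common maximum.\<close>
  have "Q (Max (insert 0 (C ` D))) b x" if b: "b \<ge> Max (insert 1 (B ` D))" and x: "x \<in> K" for b x
  proof -
    obtain d where d: "d \<in> D" "x \<in> U d" using D x by blast
    have "B d \<le> b" "1 \<le> b" using b d D by auto
    moreover have "C d \<le> Max (insert 0 (C ` D))" using d D by auto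
    ultimately show ?thesis using Q d D mono by blast
  qed
  thus ?thesis by blast
qed

text \<open>Binomial coefficients of (1 - z)^(-s). The exponent is a parameter because s = a serves
  region A and s = 1 - a region B, where the values may be negative.\<close>

definition nb_coeff :: "real \<Rightarrow> nat \<Rightarrow> real" where
  "nb_coeff s j = pochhammer s j / fact j"

lemma nb_coeff_pos: "s > 0 \<Longrightarrow> nb_coeff s j > 0"
  by (simp add: nb_coeff_def pochhammer_pos)

lemma binomial_sums:
  fixes s :: real and z :: complex
  assumes "norm z < 1"
  shows "(\<lambda>j. of_real (nb_coeff s j) * z ^ j) sums ((1 - z) powr (- of_real s))"
proof -
  have "((- of_real s) gchoose j) * (- z) ^ j = of_real (nb_coeff s j) * z ^ j" for j
  proof -
    have "((-1)::complex) ^ j * (-1) ^ j = 1" by (simp flip: power_mult_distrib)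
    thus ?thesis unfolding gbinomial_pochhammer power_minus[of z]
      by (simp add: nb_coeff_def pochhammer_of_real mult_ac)
  qed
  thus ?thesis using gen_binomial_complex[of "-z" "- of_real s"] assms by simp
qed

text \<open>Once z^n is divided out, the tail is again a power series converging in the unit disc,
  so its absolute sum at 1/2 bounds it on the whole disc of radius 1/2.\<close>

lemma binomial_remainder:
  fixes s :: real
  shows "\<exists>C\<ge>0. \<forall>z::complex. norm z \<le> 1/2 \<longrightarrow>
    norm ((1 - z) powr (- of_real s) - (\<Sum>j<n. of_real (nb_coeff s j) * z ^ j)) \<le> C * norm z ^ n"
proof -
  define c where "c = nb_coeff s"
  have sums: "(\<lambda>j. of_real (c j) * z ^ j) sums ((1 - z) powr (- of_real s))" if "norm z < 1" for z :: complex
    using binomial_sums[OF that, of s] by (simp add: c_def)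
  \<comment> \<open>Any point strictly between 1/2 and 1 would do: convergence there forces absolute
    convergence at 1/2.\<close>
  have "summable (\<lambda>j. of_real (c j) * of_real (3/4) ^ j :: complex)"
    using sums[of "of_real (3/4)"] by (auto simp: sums_iff simp del: of_real_divide)
  hence "summable (\<lambda>j. norm (of_real (c j) * of_real (1/2) ^ j :: complex))"
    by (rule powser_insidea) (simp del: of_real_divide)
  hence "summable (\<lambda>j. \<bar>c j\<bar> * (1/2) ^ j)"
    by (simp add: norm_mult norm_power norm_divide)
  hence "summable (\<lambda>j. \<bar>c (j + n)\<bar> * (1/2) ^ (j + n))"
    by (subst summable_iff_shift)
  hence sm: "summable (\<lambda>j. \<bar>c (j + n)\<bar> * (1/2) ^ j)"
    using summable_mult[of "\<lambda>j. \<bar>c (j + n)\<bar> * (1/2) ^ (j + n)" "2 ^ n"]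
    by (simp add: power_add power_divide field_simps)
  define C where "C = (\<Sum>j. \<bar>c (j + n)\<bar> * (1/2) ^ j)"
  have "norm ((1 - z) powr (- of_real s) - (\<Sum>j<n. of_real (c j) * z ^ j)) \<le> C * norm z ^ n"
    if z: "norm z \<le> 1/2" for z :: complex
  proof -
    have "(\<lambda>j. of_real (c (j + n)) * z ^ (j + n)) sums ((1 - z) powr (- of_real s) - (\<Sum>j<n. of_real (c j) * z ^ j))"
      using z by (intro sums_split_initial_segment sums) auto
    moreover have le: "norm (of_real (c (j + n)) * z ^ (j + n)) \<le> norm z ^ n * (\<bar>c (j + n)\<bar> * (1/2) ^ j)" for j
    proof -
      have "norm z ^ j \<le> (1/2) ^ j" using z by (intro power_mono) auto
      hence "(\<bar>c (j + n)\<bar> * norm z ^ n) * norm z ^ j \<le> (\<bar>c (j + n)\<bar> * norm z ^ n) * (1/2) ^ j"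
        by (intro mult_left_mono) auto
      thus ?thesis by (simp add: norm_mult norm_power power_add mult_ac)
    qed
    moreover have sm': "summable (\<lambda>j. norm z ^ n * (\<bar>c (j + n)\<bar> * (1/2) ^ j))"
      using sm by (rule summable_mult)
    ultimately have "norm ((1 - z) powr (- of_real s) - (\<Sum>j<n. of_real (c j) * z ^ j)) \<le>
          (\<Sum>j. norm z ^ n * (\<bar>c (j + n)\<bar> * (1/2) ^ j))"
      by (metis (no_types, lifting) sums_unique norm_suminf_le)
    also have "\<dots> = C * norm z ^ n" using sm by (simp add: suminf_mult C_def)
    finally show ?thesis .
  qed
  moreover have "C \<ge> 0" unfolding C_def using sm by (intro suminf_nonneg) auto
  ultimately show ?thesis unfolding c_def by blast
qed

lemma integrable_one_plus_square_powr:
  fixes c :: real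
  assumes "c \<ge> 1"
  shows "integrable lborel (\<lambda>t::real. (1 + t^2) powr (-c))"
proof (rule Bochner_Integration.integrable_bound)
  show "integrable lborel (\<lambda>t::real. inverse (1 + t^2))"
    using integrable_inverse_1_plus_square by (simp add: set_integrable_def)
  have "(1 + t^2) powr (-c) \<le> inverse (1 + t^2)" for t :: real
  proof -
    have "(1 + t^2) powr (-c) \<le> (1 + t^2) powr (-1)"
      using assms by (intro powr_mono) auto
    moreover have "1 + t^2 > 0" by (simp add: add_pos_nonneg)
    ultimately show ?thesis by (simp add: powr_minus)
  qed
  thus "AE t in lborel. norm ((1 + t^2) powr (-c)) \<le> norm (inverse (1 + t^2))" by simp
qed measurable

text \<open>1 + x/n is the convex combination of 1 and 1 + x/m with weight m/n on the latter, so
  concavity of ln gives the claim. It trades an exponent that grows with b for a fixed one when a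
  majorant independent of b is wanted.\<close>

lemma one_plus_powr_antimono:
  fixes x n m :: real
  assumes "x \<ge> 0" "0 < m" "m \<le> n"
  shows "(1 + x / n) powr (- n) \<le> (1 + x / m) powr (- m)"
proof -
  have "(1 - m / n) * ln 1 + (m / n) * ln (1 + x / m) \<le> ln ((1 - m / n) * 1 + (m / n) * (1 + x / m))"
    using concave_onD[OF ln_concave, of "m / n" 1 "1 + x / m"] assms
    by (simp add: add_pos_nonneg)
  also have "(1 - m / n) * 1 + (m / n) * (1 + x / m) = 1 + x / n"
    using assms by (simp add: field_simps)
  finally have "m * ln (1 + x / m) \<le> n * ln (1 + x / n)"
    using assms by (simp add: field_simps)
  moreover have "1 + x / n > 0" "1 + x / m > 0" using assms by (auto intro: add_pos_nonneg)
  ultimately show ?thesis by (simp add: powr_def)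
qed

section \<open>Stirling's formula with the first correction\<close>

text \<open>Error of Stirling's series for ln Gamma after the term 1/(12x), with the constant ln(2
  pi)/2 deliberately left in: that constant is the limit to be determined.\<close>

definition stirling_err :: "real \<Rightarrow> real" where
  "stirling_err x = ln_Gamma x - (x - 1/2) * ln x + x - 1 / (12 * x)"

text \<open>The recurrence Gamma(x+1) = x Gamma(x) makes the difference elementary. The comparison
  term is itself a difference, so that the bounds telescope over unit steps.\<close>

lemma stirling_err_step:
  "\<exists>C X. C > 0 \<and> X > 0 \<and> (\<forall>x\<ge>X. \<bar>stirling_err (x + 1) - stirling_err x\<bar> \<le> C * (1 / x^2 - 1 / (x + 1)^2))"
proof -
  let ?g = "\<lambda>x::real. ln x - (x + 1/2) * ln (x + 1) + (x - 1/2) * ln x + 1 - 1 / (12 * (x + 1)) + 1 / (12 * x)"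
  have "?g \<in> O(\<lambda>x. 1 / x^2 - 1 / (x + 1)^2)"
    by real_asymp
  then obtain C where C: "C > 0" "eventually (\<lambda>x. norm (?g x) \<le> C * norm (1 / x^2 - 1 / (x + 1)^2)) at_top"
    by (elim landau_o.bigE)
  then obtain X where X: "\<And>x. x \<ge> X \<Longrightarrow> norm (?g x) \<le> C * norm (1 / x^2 - 1 / (x + 1)^2)"
    by (auto simp: eventually_at_top_linorder)
  have "\<bar>stirling_err (x + 1) - stirling_err x\<bar> \<le> C * (1 / x^2 - 1 / (x + 1)^2)" if x: "x \<ge> max X 1" for x
  proof -
    have "ln_Gamma (x + 1) = ln (x * Gamma x)"
      using x Gamma_plus1[of x] Gamma_real_pos[of x] by (force simp: ln_Gamma_real_pos)
    also have "\<dots> = ln x + ln_Gamma x"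
      using x Gamma_real_pos[of x, THEN less_imp_neq] by (auto simp: ln_mult ln_Gamma_real_pos)
    finally have "stirling_err (x + 1) - stirling_err x = ?g x"
      by (simp add: stirling_err_def algebra_simps)
    moreover have "1 / (x + 1)^2 \<le> 1 / x^2"
      using x by (intro divide_left_mono power_mono) auto
    ultimately show ?thesis using X[of x] x by simp
  qed
  thus ?thesis using C(1) by (intro exI[of _ C] exI[of _ "max X 1"]) auto
qed

text \<open>Gauss's product for 1/Gamma compares ln Gamma at x + n + 1 and at n + 1. Hence the limit
  along x + n does not depend on x, and one constant serves all real x.\<close>

lemma stirling_err_shift:
  assumes "x > 0"
  shows "(\<lambda>n. stirling_err (x + real n + 1) - stirling_err (real n + 1)) \<longlonglongrightarrow> 0"
proof -
  have "(\<lambda>n. ln (rGamma_series x n * Gamma x)) \<longlonglongrightarrow> ln (rGamma x * Gamma x)"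
    using assms by (intro tendsto_intros) (auto simp: rGamma_inverse_Gamma Gamma_eq_zero_iff)
  also have "rGamma x * Gamma x = 1"
    using Gamma_real_pos[OF assms] unfolding rGamma_inverse_Gamma by (intro left_inverse) linarith
  finally have "(\<lambda>n. ln (rGamma_series x n * Gamma x)) \<longlonglongrightarrow> 0"
    by simp
  moreover have "eventually (\<lambda>n. ln (rGamma_series x n * Gamma x) =
                 ln_Gamma (x + real n + 1) - ln_Gamma (real n + 1) - x * ln (real n)) sequentially"
    using eventually_gt_at_top[of 0]
  proof eventually_elim
    case (elim n)
    have "pochhammer x (n + 1) * Gamma x = Gamma (x + real (n + 1))"
    proof -
      have "x \<notin> \<int>\<^sub>\<le>\<^sub>0" using assms by auto
      from pochhammer_Gamma[OF this, of "n+1"] show ?thesis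
        using Gamma_real_pos[OF assms] by (simp add: field_simps)
    qed
    moreover have "fact n = Gamma (real n + 1)" by (simp add: Gamma_fact add.commute)
    ultimately have "rGamma_series x n * Gamma x = Gamma (x + real n + 1) / (Gamma (real n + 1) * exp (x * ln (real n)))"
      by (simp add: rGamma_series_def add_ac)
    moreover have "Gamma (x + real n + 1) \<noteq> 0" "Gamma (real n + 1) \<noteq> 0"
      using assms by (auto intro!: less_imp_neq[symmetric] Gamma_real_pos)
    ultimately show ?case using assms elim
      by (simp add: ln_div ln_mult ln_Gamma_real_pos)
  qed
  ultimately have *: "(\<lambda>n. ln_Gamma (x + real n + 1) - ln_Gamma (real n + 1) - x * ln (real n)) \<longlonglongrightarrow> 0"
    by (simp add: tendsto_cong)
  have "(\<lambda>n. x * ln (real n) - (x + real n + 1 - 1/2) * ln (x + real n + 1) + (x + real n + 1)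
             - 1 / (12 * (x + real n + 1)) + (real n + 1 - 1/2) * ln (real n + 1) - (real n + 1) + 1 / (12 * (real n + 1))) \<longlonglongrightarrow> 0"
    using assms by real_asymp
  from tendsto_add[OF * this] show ?thesis
    by (simp add: stirling_err_def algebra_simps)
qed

text \<open>Telescoping keeps all values at x + n within C/x^2 of the value at x, which makes the
  values at integers a Cauchy sequence. Letting n tend to infinity with x fixed turns the same bound
  into the claim.\<close>

lemma stirling_err_bound:
  "\<exists>c C X. X > 0 \<and> (\<forall>x\<ge>X. \<bar>stirling_err x - c\<bar> \<le> C / x^2)"
proof -
  obtain C X where C: "C > 0" "X > 0"
    and step: "\<And>x. x \<ge> X \<Longrightarrow> \<bar>stirling_err (x + 1) - stirling_err x\<bar> \<le> C * (1 / x^2 - 1 / (x + 1)^2)"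
    using stirling_err_step by blast
  have tele: "\<bar>stirling_err (x + real n) - stirling_err x\<bar> \<le> C * (1 / x^2 - 1 / (x + real n)^2)" if "x \<ge> X" for x n
  proof (induction n)
    case (Suc n)
    have "\<bar>stirling_err (x + real n + 1) - stirling_err (x + real n)\<bar> \<le> C * (1 / (x + real n)^2 - 1 / (x + real n + 1)^2)"
      using that by (intro step) auto
    with Suc show ?case by (simp add: algebra_simps abs_le_iff)
  qed auto
  have tele': "\<bar>stirling_err (x + real n) - stirling_err x\<bar> \<le> C / x^2" if "x \<ge> X" for x n
  proof -
    have "C * (1 / x^2 - 1 / (x + real n)^2) \<le> C / x^2"
      using C by (simp add: algebra_simps)
    thus ?thesis using tele[OF that, of n] by linarith
  qed
  have "Cauchy (\<lambda>n. stirling_err (real n + 1))"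
  proof (rule metric_CauchyI)
    fix e :: real assume e: "e > 0"
    have "(\<lambda>m. C / (real m + 1)^2) \<longlonglongrightarrow> 0" by real_asymp
    hence "eventually (\<lambda>m. C / (real m + 1)^2 < e / 2) sequentially"
      using e by (intro order_tendstoD) auto
    moreover have "eventually (\<lambda>m. real m \<ge> X) sequentially" by real_asymp
    ultimately have "eventually (\<lambda>m. C / (real m + 1)^2 < e / 2 \<and> real m \<ge> X) sequentially"
      by eventually_elim auto
    then obtain M where M: "C / (real M + 1)^2 < e / 2" "real M \<ge> X"
      by (auto simp: eventually_sequentially)
    have close: "\<bar>stirling_err (real n + 1) - stirling_err (real M + 1)\<bar> < e / 2" if "n \<ge> M" for n
      using order.strict_trans1[OF tele'[of "real M + 1" "n - M"] M(1)] that M(2) by (simp add: of_nat_diff add_ac)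
    show "\<exists>M. \<forall>m\<ge>M. \<forall>n\<ge>M. dist (stirling_err (real m + 1)) (stirling_err (real n + 1)) < e"
    proof (intro exI[of _ M] allI impI)
      fix m n assume "m \<ge> M" "n \<ge> M"
      from close[OF this(1)] close[OF this(2)] show "dist (stirling_err (real m + 1)) (stirling_err (real n + 1)) < e"
        unfolding dist_real_def by linarith
    qed
  qed
  then obtain c where c: "(\<lambda>n. stirling_err (real n + 1)) \<longlonglongrightarrow> c"
    by (auto simp: Cauchy_convergent_iff convergent_def)
  have "\<bar>stirling_err x - c\<bar> \<le> C / x^2" if x: "x \<ge> X" for x
  proof -
    have "(\<lambda>n. stirling_err (x + real n + 1)) \<longlonglongrightarrow> 0 + c"
      using tendsto_add[OF stirling_err_shift c, of x] x C by simp
    hence "(\<lambda>n. \<bar>stirling_err x - stirling_err (x + real n + 1)\<bar>) \<longlonglongrightarrow> \<bar>stirling_err x - c\<bar>"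
      by (auto intro!: tendsto_intros)
    thus ?thesis
      by (rule tendsto_upperbound)
        (use tele'[OF x, of "Suc _"] in \<open>auto intro!: always_eventually simp: abs_minus_commute add_ac\<close>)
  qed
  thus ?thesis using C by blast
qed

text \<open>Legendre's duplication formula links the errors at x, x + 1/2 and 2x. In the limit their
  combination is c + c - c, while the elementary terms tend to (ln 2 + ln pi)/2.\<close>

lemma stirling_err_bound':
  "\<exists>C X. X > 0 \<and> (\<forall>x\<ge>X. \<bar>stirling_err x - ln (2 * pi) / 2\<bar> \<le> C / x^2)"
proof -
  obtain c C X where X: "X > 0" and bd: "\<And>x. x \<ge> X \<Longrightarrow> \<bar>stirling_err x - c\<bar> \<le> C / x^2"
    using stirling_err_bound by blast
  have "((\<lambda>x. stirling_err x - c) \<longlongrightarrow> 0) at_top"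
  proof (rule Lim_null_comparison)
    show "eventually (\<lambda>x. norm (stirling_err x - c) \<le> C / x^2) at_top"
      using eventually_ge_at_top[of X] by eventually_elim (use bd in auto)
    show "((\<lambda>x. C / x^2) \<longlongrightarrow> 0) at_top" by real_asymp
  qed
  hence lim: "(stirling_err \<longlongrightarrow> c) at_top" by (rule LIM_zero_cancel)
  have "((\<lambda>x. stirling_err x + stirling_err (x + 1/2) - stirling_err (2 * x)) \<longlongrightarrow> c + c - c) at_top"
  proof (intro tendsto_diff tendsto_add)
    show "((\<lambda>x. stirling_err (x + 1/2)) \<longlongrightarrow> c) at_top"
      by (rule filterlim_compose[OF lim]) real_asymp
    show "((\<lambda>x. stirling_err (2 * x)) \<longlongrightarrow> c) at_top"
      by (rule filterlim_compose[OF lim]) real_asymp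
  qed (fact lim)
  moreover have "eventually (\<lambda>x. stirling_err x + stirling_err (x + 1/2) - stirling_err (2 * x) =
     (1 - 2 * x) * ln 2 + ln pi / 2 - (x - 1/2) * ln x + x - 1 / (12 * x) - (x + 1/2 - 1/2) * ln (x + 1/2) + (x + 1/2)
     - 1 / (12 * (x + 1/2)) + (2 * x - 1/2) * ln (2 * x) - 2 * x + 1 / (12 * (2 * x))) at_top"
    using eventually_gt_at_top[of 0]
  proof eventually_elim
    case (elim x)
    have eq: "complex_of_real x + 1 / 2 = complex_of_real (x + 1/2)" "2 * complex_of_real x = complex_of_real (2 * x)"
      "(1 - complex_of_real (2 * x)) * complex_of_real (ln 2) = complex_of_real ((1 - 2 * x) * ln 2)" by simp_all
    have ni: "complex_of_real x \<notin> \<int>\<^sub>\<le>\<^sub>0" "complex_of_real (x + 1/2) \<notin> \<int>\<^sub>\<le>\<^sub>0"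
      using elim unfolding of_real_in_nonpos_Ints_iff by (auto dest: nonpos_Ints_nonpos)
    have "complex_of_real (Gamma x * Gamma (x + 1/2)) = of_real (exp ((1 - 2 * x) * ln 2) * sqrt pi * Gamma (2 * x))"
      using Gamma_legendre_duplication[of "of_real x", unfolded eq, OF ni]
      unfolding Gamma_complex_of_real exp_of_real of_real_mult[symmetric] .
    hence "ln (Gamma x * Gamma (x + 1/2)) = ln (exp ((1 - 2 * x) * ln 2) * sqrt pi * Gamma (2 * x))"
      by (simp only: of_real_eq_iff)
    moreover have "Gamma x \<noteq> 0" "Gamma (x + 1/2) \<noteq> 0" "Gamma (2 * x) \<noteq> 0"
      using elim by (auto intro!: less_imp_neq[symmetric] Gamma_real_pos)
    ultimately have "ln_Gamma x + ln_Gamma (x + 1/2) = (1 - 2 * x) * ln 2 + ln pi / 2 + ln_Gamma (2 * x)"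
      using elim by (simp add: ln_mult ln_Gamma_real_pos ln_sqrt)
    thus ?case by (simp add: stirling_err_def)
  qed
  moreover have "((\<lambda>x. (1 - 2 * x) * ln 2 + ln pi / 2 - (x - 1/2) * ln x + x - 1 / (12 * x) - (x + 1/2 - 1/2) * ln (x + 1/2) + (x + 1/2)
     - 1 / (12 * (x + 1/2)) + (2 * x - 1/2) * ln (2 * x) - 2 * x + 1 / (12 * (2 * x))) \<longlongrightarrow> ln 2 / 2 + ln pi / 2) at_top"
    by real_asymp
  ultimately have "c + c - c = ln 2 / 2 + ln pi / 2"
    by (intro tendsto_unique[OF trivial_limit_at_top_linorder]) (simp_all only: tendsto_cong)
  hence "c = ln 2 / 2 + ln pi / 2" by simp
  also have "\<dots> = ln (2 * pi) / 2" by (simp add: ln_mult)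
  finally show ?thesis using X bd by blast
qed

lemma Gamma_asymp:
  "\<exists>C B. \<forall>b\<ge>B. B > 0 \<and> (\<exists>e. \<bar>e\<bar> \<le> C / b^2 \<and>
     Gamma b = sqrt (2 * pi) * b powr (b - 1/2) * exp (-b) * (1 + 1 / (12 * b) + e))"
proof -
  obtain C X where X: "X > 0" and bd: "\<And>x. x \<ge> X \<Longrightarrow> \<bar>stirling_err x - ln (2 * pi) / 2\<bar> \<le> C / x^2"
    using stirling_err_bound' by blast
  have C0: "C \<ge> 0"
  proof -
    have "0 \<le> C / X^2" using bd[of X] by linarith
    thus ?thesis using X by (simp add: zero_le_divide_iff)
  qed
  have "\<exists>e. \<bar>e\<bar> \<le> (C + 2 * (1 + C)^2) / b^2 \<and>
     Gamma b = sqrt (2 * pi) * b powr (b - 1/2) * exp (-b) * (1 + 1 / (12 * b) + e)"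
    \<comment> \<open>The threshold 2 + 2C makes (1 + C)/b at most 1/2, hence |z| at most 1/2
      below.\<close>
    if b: "b \<ge> max X (2 + 2 * C)" for b
  proof -
    have b0: "b > 0" "b \<ge> 2" using b X C0 by auto
    define d where "d = stirling_err b - ln (2 * pi) / 2"
    define z where "z = 1 / (12 * b) + d"
    have d: "\<bar>d\<bar> \<le> C / b^2" unfolding d_def using bd b by simp
    have "C / b^2 \<le> C / b" using b0 C0 by (intro divide_left_mono) (auto simp: power2_eq_square)
    moreover have "1 / (12 * b) \<le> 1 / b" using b0 by (simp add: field_simps)
    ultimately have z1: "\<bar>z\<bar> \<le> (1 + C) / b" using d b0 unfolding z_def by (simp add: add_divide_distrib abs_le_iff)
    also have "\<dots> \<le> 1/2" using b b0 by (simp add: field_simps)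
    finally have z2: "\<bar>z\<bar> \<le> 1/2" .
    \<comment> \<open>Inverting exp(-z) >= 1 - z gives the upper bound 1/(1 - z) for exp z. Together
      with exp z >= 1 + z this leaves a quadratic error with an explicit constant.\<close>
    have "(1 - z) * exp z \<le> 1"
      using mult_right_mono[OF exp_ge_add_one_self[of "-z"], of "exp z"] by (simp add: exp_minus_inverse mult.commute)
    hence "exp z \<le> 1 / (1 - z)" using z2 by (simp add: field_simps)
    also have "\<dots> \<le> 1 + z + 2 * z^2"
    proof -
      have "0 \<le> z^2 * (1 - 2 * z)" using z2 by (intro mult_nonneg_nonneg) auto
      thus ?thesis using z2 by (simp add: field_simps power2_eq_square)
    qed
    finally have "\<bar>exp z - 1 - z\<bar> \<le> 2 * z^2"
      using exp_ge_add_one_self[of z] by (simp add: abs_le_iff algebra_simps)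
    also have "z^2 \<le> ((1 + C) / b)^2" using z1 by (metis abs_ge_zero power2_abs power_mono)
    finally have e: "\<bar>exp z - 1 - z\<bar> \<le> 2 * (1 + C)^2 / b^2" by (simp add: power_divide)
    have "ln_Gamma b = ln (2 * pi) / 2 + (b - 1/2) * ln b - b + z"
      unfolding z_def d_def stirling_err_def by simp
    hence "Gamma b = exp (ln (2 * pi) / 2) * exp ((b - 1/2) * ln b) * exp (-b) * exp z"
      using b0 by (simp add: Gamma_real_pos_exp exp_add[symmetric])
    also have "exp (ln (2 * pi) / 2) = sqrt (2 * pi)"
      by (subst ln_sqrt[symmetric]) auto
    also have "exp ((b - 1/2) * ln b) = b powr (b - 1/2)" using b0 by (simp add: powr_def)
    finally have "Gamma b = sqrt (2 * pi) * b powr (b - 1/2) * exp (-b) * (1 + 1 / (12 * b) + (d + (exp z - 1 - z)))"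
      by (simp add: z_def)
    moreover have "\<bar>d + (exp z - 1 - z)\<bar> \<le> (C + 2 * (1 + C)^2) / b^2"
      using d e by (simp add: add_divide_distrib abs_le_iff)
    ultimately show ?thesis by blast
  qed
  thus ?thesis using X
    by (intro exI[of _ "C + 2 * (1 + C)^2"] exI[of _ "max X (2 + 2 * C)"]) auto
qed

section \<open>Integrals along contours through the saddle point\<close>

lemma Ln_Complex_1: "Ln (Complex 1 t) = Complex (ln (1 + t\<^sup>2) / 2) (arctan t)"
proof -
  have pos: "1 + t\<^sup>2 > 0" by (simp add: add_pos_nonneg)
  have "exp (ln (1 + t\<^sup>2) / 2) = sqrt (1 + t\<^sup>2)"
    using pos by (subst ln_sqrt[symmetric]) auto
  hence "exp (Complex (ln (1 + t\<^sup>2) / 2) (arctan t)) = Complex 1 t"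
    using pos by (simp add: exp_eq_polar complex_eq_iff cos_arctan sin_arctan)
  moreover have "Ln (exp (Complex (ln (1 + t\<^sup>2) / 2) (arctan t))) = Complex (ln (1 + t\<^sup>2) / 2) (arctan t)"
    using arctan_lbound[of t] arctan_ubound[of t] pi_gt_zero by (intro Ln_exp) auto
  ultimately show ?thesis by simp
qed

text \<open>The contour is a graph over the imaginary part: \<open>\<rho> t\<close> is the real part
  at height \<open>t\<close>. Flatness for |t| < r gives exact formulas near the saddle.
  \<open>descent\<close> bounds |e^(u-1)/u| by (1 + t^2)^(-\<open>\<theta>\<close>/2), so that
  \<open>\<theta>\<close> measures both the strictness of the maximum and the decay at infinity; the
  straight line has \<open>\<theta>\<close> = 1, and a bulge costs a smaller value.\<close>

locale contour =
  fixes \<rho> \<rho>' :: "real \<Rightarrow> real" and M \<theta> r :: real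
  assumes rho_deriv: "\<And>t. (\<rho> has_real_derivative \<rho>' t) (at t)"
    and cont_rho': "continuous_on UNIV \<rho>'"
    and rho_ge1: "\<And>t. \<rho> t \<ge> 1"
    and rho'_bound: "\<And>t. \<bar>\<rho>' t\<bar> \<le> M"
    and r_pos: "r > 0"
    and rho_eq: "\<And>t. \<bar>t\<bar> < r \<Longrightarrow> \<rho> t = 1"
    and rho'_eq: "\<And>t. \<bar>t\<bar> < r \<Longrightarrow> \<rho>' t = 0"
    and theta_pos: "\<theta> > 0"
    and descent: "\<And>t. \<rho> t - 1 - ln ((\<rho> t)\<^sup>2 + t\<^sup>2) / 2 \<le> - \<theta> / 2 * ln (1 + t\<^sup>2)"
begin

definition \<gamma> :: "real \<Rightarrow> complex" where "\<gamma> t = Complex (\<rho> t) t"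
definition \<gamma>' :: "real \<Rightarrow> complex" where "\<gamma>' t = Complex (\<rho>' t) 1"
text \<open>Normalised to the value 1 at the saddle; the factor e^(-b) cancels from the quotient of
  integrals.\<close>

definition E :: "real \<Rightarrow> real \<Rightarrow> complex" where "E b t = exp (of_real b * (\<gamma> t - 1 - Ln (\<gamma> t)))"
definition W :: "real \<Rightarrow> real \<Rightarrow> complex" where "W b t = E b t * \<gamma>' t"

lemma M_nonneg: "M \<ge> 0"
  using rho'_bound[of 0] by linarith

lemma Re_gamma: "Re (\<gamma> t) \<ge> 1" and Im_gamma [simp]: "Im (\<gamma> t) = t"
  by (simp_all add: \<gamma>_def rho_ge1)

lemma gamma_nz [simp]: "\<gamma> t \<noteq> 0"
  using Re_gamma[of t] by force

lemma gamma_not_nonpos [simp]: "\<gamma> t \<notin> \<real>\<^sub>\<le>\<^sub>0"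
  using Re_gamma[of t] by (auto simp: complex_nonpos_Reals_iff)

lemma norm_gamma: "norm (\<gamma> t) \<ge> 1"
  using complex_Re_le_cmod[of "\<gamma> t"] Re_gamma[of t] by linarith

lemma gamma_near: "\<bar>t\<bar> < r \<Longrightarrow> \<gamma> t = Complex 1 t"
  by (simp add: \<gamma>_def rho_eq)

lemma gamma_0 [simp]: "\<gamma> 0 = 1"
  using gamma_near[of 0] r_pos by (simp add: complex_eq_iff)

lemma gamma_deriv: "(\<gamma> has_vector_derivative \<gamma>' t) (at t)"
  unfolding \<gamma>_def \<gamma>'_def using rho_deriv[of t]
  by (auto simp: has_vector_derivative_complex_iff has_real_derivative_iff_has_vector_derivative intro!: derivative_eq_intros)

lemma cont_gamma: "continuous_on UNIV \<gamma>"
  using gamma_deriv by (meson continuous_at_imp_continuous_on has_vector_derivative_continuous)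

lemma cont_gamma': "continuous_on UNIV \<gamma>'"
  unfolding \<gamma>'_def Complex_eq by (intro continuous_intros cont_rho')

lemma cont_E: "continuous_on UNIV (E b)"
  unfolding E_def by (intro continuous_intros cont_gamma) auto

lemma cont_W: "continuous_on UNIV (W b)"
  unfolding W_def[abs_def] by (intro continuous_intros cont_E cont_gamma')

lemma norm_E: 
  assumes "b \<ge> 0"
  shows "norm (E b t) \<le> (1 + t\<^sup>2) powr (- (\<theta> * b / 2))"
proof -
  have "(\<rho> t)\<^sup>2 + t\<^sup>2 > 0" using rho_ge1[of t] by (intro add_pos_nonneg) auto
  hence "Re (\<gamma> t - 1 - Ln (\<gamma> t)) = \<rho> t - 1 - ln ((\<rho> t)\<^sup>2 + t\<^sup>2) / 2"
    using gamma_nz[of t] by (simp add: \<gamma>_def complex_norm ln_sqrt)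
  also have "\<dots> \<le> - \<theta> / 2 * ln (1 + t\<^sup>2)" by (rule descent)
  finally have "b * Re (\<gamma> t - 1 - Ln (\<gamma> t)) \<le> b * (- \<theta> / 2 * ln (1 + t\<^sup>2))"
    using assms by (rule mult_left_mono)
  moreover have "1 + t\<^sup>2 \<noteq> 0" by (metis add_pos_nonneg less_irrefl zero_le_power2 zero_less_one)
  ultimately show ?thesis by (simp add: E_def powr_def mult_ac)
qed

lemma norm_gamma': "norm (\<gamma>' t) \<le> 1 + M"
  using cmod_le[of "\<gamma>' t"] rho'_bound[of t] by (simp add: \<gamma>'_def)

lemma norm_W:
  assumes "b \<ge> 0"
  shows "norm (W b t) \<le> (1 + M) * (1 + t\<^sup>2) powr (- (\<theta> * b / 2))"
  using mult_mono[OF norm_gamma' norm_E[OF assms], of t t] M_nonneg by (simp add: W_def norm_mult mult_ac)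

text \<open>With n = \<open>\<theta>\<close> b/2 and x = n t^2,
  \<open>one_plus_powr_antimono\<close> lowers the exponent n to 4, which is where b >=
  8/\<open>\<theta>\<close> comes from. The bound depends on b only through b t^2, and the power 4
  leaves room for a factor t^6.\<close>

lemma norm_W_scaled:
  assumes "b \<ge> 8 / \<theta>"
  shows "norm (W b t) \<le> (1 + M) * (1 + \<theta> / 8 * b * t\<^sup>2) powr (-4)"
proof -
  have b: "b > 0" using assms theta_pos by (smt (verit) divide_pos_pos)
  have n: "4 \<le> \<theta> * b / 2" using assms theta_pos by (simp add: field_simps)
  have "(1 + t\<^sup>2) powr (- (\<theta> * b / 2)) \<le> (1 + \<theta> / 8 * b * t\<^sup>2) powr (-4)"
    using one_plus_powr_antimono[of "\<theta> * b / 2 * t\<^sup>2" 4 "\<theta> * b / 2"] b n theta_pos by simp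
  hence "(1 + M) * (1 + t\<^sup>2) powr (- (\<theta> * b / 2)) \<le> (1 + M) * (1 + \<theta> / 8 * b * t\<^sup>2) powr (-4)"
    using M_nonneg by (intro mult_left_mono) auto
  thus ?thesis using norm_W[of b t] b by simp
qed

lemma W_mult_measurable [measurable]:
  "continuous_on UNIV f \<Longrightarrow> (\<lambda>t. W b t * f t) \<in> borel_measurable lborel"
  unfolding measurable_lborel2 by (intro borel_measurable_continuous_onI continuous_intros cont_W)

lemma integrable_W_mult:
  assumes b: "b \<ge> 8 / \<theta>" and f: "continuous_on UNIV f" "\<And>t. norm (f t) \<le> K"
  shows "integrable lborel (\<lambda>t. W b t * f t)"
proof (rule Bochner_Integration.integrable_bound)
  have b0: "b > 0" using b theta_pos by (smt (verit) divide_pos_pos)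
  have n: "1 \<le> \<theta> * b / 2" using b theta_pos by (simp add: field_simps)
  show "integrable lborel (\<lambda>t. (1 + M) * K * (1 + t\<^sup>2) powr (- (\<theta> * b / 2)))"
    by (intro integrable_mult_right integrable_one_plus_square_powr n)
  show "AE t in lborel. norm (W b t * f t) \<le> norm ((1 + M) * K * (1 + t\<^sup>2) powr (- (\<theta> * b / 2)))"
  proof (rule AE_I2)
    fix t
    have "norm (W b t * f t) \<le> ((1 + M) * (1 + t\<^sup>2) powr (- (\<theta> * b / 2))) * K"
      unfolding norm_mult using norm_W[of b t] f(2)[of t] b0 M_nonneg by (intro mult_mono) auto
    also have "\<dots> \<le> norm ((1 + M) * K * (1 + t\<^sup>2) powr (- (\<theta> * b / 2)))"
      by (simp add: mult_ac)
    finally show "norm (W b t * f t) \<le> norm ((1 + M) * K * (1 + t\<^sup>2) powr (- (\<theta> * b / 2)))" .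
  qed
qed (use f in measurable)

lemma integrable_W: "b \<ge> 8 / \<theta> \<Longrightarrow> integrable lborel (W b)"
  using integrable_W_mult[of b "\<lambda>_. 1" 1] by simp

section \<open>Moments of 1/u along the contour\<close>

definition mom :: "real \<Rightarrow> nat \<Rightarrow> complex" where
  "mom b k = (LINT t|lborel. W b t * inverse (\<gamma> t) ^ k)"

lemma norm_inv_gamma: "norm (inverse (\<gamma> t)) \<le> 1"
  using norm_gamma[of t] by (simp add: norm_inverse inverse_le_1_iff)

lemma norm_inv_gamma_pow: "norm (inverse (\<gamma> t) ^ k) \<le> 1"
  unfolding norm_power by (intro power_le_one norm_inv_gamma) auto

lemma integrable_mom: "b \<ge> 8 / \<theta> \<Longrightarrow> integrable lborel (\<lambda>t. W b t * inverse (\<gamma> t) ^ k)"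
  by (intro integrable_W_mult[of _ _ 1] norm_inv_gamma_pow continuous_intros cont_gamma) auto

text \<open>In terms of u, the derivative of e^(b(u-1)) u^(-b-k) is that function times b - (b+k)/u,
  and the boundary terms vanish by the decay of \<open>E\<close>.\<close>

lemma mom_rec:
  assumes b: "b \<ge> 8 / \<theta>"
  shows "of_real (b + k) * mom b (Suc k) = of_real b * mom b k"
proof -
  have b0: "b > 0" using b theta_pos by (smt (verit) divide_pos_pos)
  define F where "F = (\<lambda>t. E b t * inverse (\<gamma> t) ^ k)"
  define f where "f = (\<lambda>t. of_real b * (W b t * inverse (\<gamma> t) ^ k) - of_real (b + k) * (W b t * inverse (\<gamma> t) ^ Suc k))"
  have F_alt: "F = (\<lambda>z. exp (of_real b * (z - 1 - Ln z)) * inverse z ^ k) \<circ> \<gamma>"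
    by (simp add: F_def E_def fun_eq_iff)
  have deriv: "(F has_vector_derivative f t) (at t)" for t
  proof -
    have "((\<lambda>z. exp (of_real b * (z - 1 - Ln z)) * inverse z ^ k) has_field_derivative
            (of_real b * inverse (\<gamma> t) ^ k - of_real (b + k) * inverse (\<gamma> t) ^ Suc k) * E b t) (at (\<gamma> t))"
      apply (rule derivative_eq_intros refl | simp)+
      \<comment> \<open>The power rule produces the exponent k - 1, truncated at k = 0.\<close>
      apply (cases k)
      apply (auto simp: E_def field_simps)
      done
    from field_vector_diff_chain_at[OF gamma_deriv this] show ?thesis
      unfolding F_alt by (simp add: f_def W_def algebra_simps)
  qed
  have "(LBINT t=-\<infinity>..\<infinity>. f t) = 0 - 0"
  proof (rule interval_integral_FTC_integrable)
    show "(F has_vector_derivative f x) (at x)" for x by (rule deriv)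
    show "isCont f x" for x
    proof -
      have "continuous_on UNIV f" unfolding f_def
        by (intro continuous_intros cont_W cont_gamma) auto
      thus ?thesis by (simp add: continuous_on_eq_continuous_at)
    qed
    show "set_integrable lborel (einterval (-\<infinity>) \<infinity>) f"
      unfolding f_def using b by (auto simp: set_integrable_def simp del: power_Suc intro!: integrable_mom Bochner_Integration.integrable_diff integrable_mult_right)
    have bd: "norm (F t) \<le> (1 + t\<^sup>2) powr (-(\<theta> * b / 2))" for t
      using mult_mono[OF norm_E[of b t] norm_inv_gamma_pow[of t k]] b0 by (simp add: F_def norm_mult)
    have "((\<lambda>t. (1 + t\<^sup>2) powr (-(\<theta> * b / 2))) \<longlongrightarrow> 0) at_top" "((\<lambda>t. (1 + t\<^sup>2) powr (-(\<theta> * b / 2))) \<longlongrightarrow> 0) at_bot"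
      using b0 theta_pos by real_asymp+
    hence "(F \<longlongrightarrow> 0) at_top" "(F \<longlongrightarrow> 0) at_bot"
      by (auto intro!: Lim_null_comparison[of F] always_eventually bd)
    thus "((F \<circ> real_of_ereal) \<longlongrightarrow> 0) (at_right (-\<infinity>))" "((F \<circ> real_of_ereal) \<longlongrightarrow> 0) (at_left \<infinity>)"
      by (simp_all add: ereal_tendsto_simps)
  qed auto
  hence "(LINT t|lborel. f t) = 0"
    by (simp add: interval_lebesgue_integral_def set_lebesgue_integral_def)
  also have "(LINT t|lborel. f t) = of_real b * mom b k - of_real (b + k) * mom b (Suc k)"
    unfolding f_def mom_def using b
    by (subst Bochner_Integration.integral_diff) (auto intro!: integrable_mom integrable_mult_right simp del: power_Suc)
  finally show ?thesis by simp
qed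

lemma mom_eq:
  assumes b: "b \<ge> 8 / \<theta>"
  shows "mom b k = of_real (b ^ k / pochhammer b k) * mom b 0"
proof (induction k)
  case (Suc k)
  have b0: "b > 0" using b theta_pos by (smt (verit) divide_pos_pos)
  have "b + real k > 0" using b0 by simp
  hence nz: "complex_of_real (b + real k) \<noteq> 0" by (metis of_real_eq_0_iff order_less_irrefl)
  have "mom b (Suc k) = of_real b * mom b k / of_real (b + k)"
    using mom_rec[OF b, of k] nz by (simp add: field_simps del: of_real_add)
  thus ?case by (simp add: Suc pochhammer_Suc)
qed auto

text \<open>Laplace's method at leading order, in the variable s = sqrt(b) t. Leading order
  suffices: the zeroth moment divides out of all main terms, so that its size matters only for the
  remainder.\<close>

lemma Laplace_limit: "((\<lambda>b. of_real (sqrt b) * mom b 0) \<longlongrightarrow> \<i> * of_real (sqrt (2 * pi))) at_top"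
proof -
  define f where "f = (\<lambda>s::real. \<i> * of_real (exp (- s\<^sup>2 / 2)))"
  have "((\<lambda>b. LINT s|lborel. W b (s / sqrt b)) \<longlongrightarrow> (LINT s|lborel. f s)) at_top"
  proof (rule integral_dominated_convergence_at_top)
    show "f \<in> borel_measurable lborel" by (simp add: f_def)
    show "(\<lambda>s. W b (s / sqrt b)) \<in> borel_measurable lborel" for b
      unfolding divide_inverse
      by (simp, intro borel_measurable_continuous_onI continuous_on_compose2[OF cont_W] continuous_intros) auto
    \<comment> \<open>Majorant in s that does not depend on b: after the scaling, the exponent 4 is
      weakened to 1, which is still integrable.\<close>
    define w where "w = (\<lambda>s. (1 + M) * inverse (1 + (sqrt (\<theta> / 8) * s)\<^sup>2))"
    have "integrable lborel (\<lambda>s. inverse (1 + (0 + sqrt (\<theta> / 8) * s)\<^sup>2))"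
      using integrable_inverse_1_plus_square theta_pos
      by (intro lborel_integrable_real_affine[where f="\<lambda>s. inverse (1 + s^2)"]) (simp_all add: set_integrable_def)
    thus "integrable lborel w" unfolding w_def by simp
    have "eventually (\<lambda>b. b \<ge> max 1 (8 / \<theta>)) at_top" by (rule eventually_ge_at_top)
    thus "\<forall>\<^sub>F b in at_top. AE s in lborel. norm (W b (s / sqrt b)) \<le> w s"
    proof eventually_elim
      case (elim b)
      have "norm (W b (s / sqrt b)) \<le> w s" for s
      proof -
        have "norm (W b (s / sqrt b)) \<le> (1 + M) * (1 + \<theta> / 8 * s\<^sup>2) powr (-4)"
          using norm_W_scaled[of b "s / sqrt b"] elim by (simp add: power_divide)
        also have "(1 + \<theta> / 8 * s\<^sup>2) powr (-4) \<le> (1 + \<theta> / 8 * s\<^sup>2) powr (-1)"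
          using theta_pos by (intro powr_mono) auto
        also have "1 + \<theta> / 8 * s\<^sup>2 > 0" using theta_pos by (intro add_pos_nonneg) auto
        hence "(1 + \<theta> / 8 * s\<^sup>2) powr (-1) = inverse (1 + (sqrt (\<theta> / 8) * s)\<^sup>2)"
          using theta_pos by (simp add: powr_minus power_mult_distrib)
        finally show ?thesis using M_nonneg by (simp add: w_def)
      qed
      thus ?case by auto
    qed
    show "AE s in lborel. ((\<lambda>b. W b (s / sqrt b)) \<longlongrightarrow> f s) at_top"
    proof (rule AE_I2)
      fix s :: real
      \<comment> \<open>Modulus and phase separate on the line Re u = 1. The modulus gives the
        Gaussian; the phase is of order b (s/sqrt b)^3 and dies out.\<close>
      have "((\<lambda>b. - b * (ln (1 + (s / sqrt b)\<^sup>2) / 2)) \<longlongrightarrow> - s\<^sup>2 / 2) at_top"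
        by (cases s "0::real" rule: linorder_cases; real_asymp)
      moreover have "((\<lambda>b. b * (s / sqrt b - arctan (s / sqrt b))) \<longlongrightarrow> 0) at_top"
        by (cases s "0::real" rule: linorder_cases; real_asymp)
      ultimately have "((\<lambda>b. exp (Complex (- b * (ln (1 + (s / sqrt b)\<^sup>2) / 2)) (b * (s / sqrt b - arctan (s / sqrt b)))) * \<i>)
          \<longlongrightarrow> exp (Complex (- s\<^sup>2 / 2) 0) * \<i>) at_top"
        by (intro tendsto_intros)
      also have "exp (Complex (- s\<^sup>2 / 2) 0) * \<i> = f s"
        by (simp add: f_def exp_of_real[symmetric] Complex_eq)
      also have "((\<lambda>b. exp (Complex (- b * (ln (1 + (s / sqrt b)\<^sup>2) / 2)) (b * (s / sqrt b - arctan (s / sqrt b)))) * \<i>) \<longlongrightarrow> f s) at_top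
          \<longleftrightarrow> ((\<lambda>b. W b (s / sqrt b)) \<longlongrightarrow> f s) at_top"
      proof (rule tendsto_cong)
        \<comment> \<open>For fixed s the parameter s/sqrt b eventually lies in the flat part of the
          contour, where the formula on the line is exact.\<close>
        have "((\<lambda>b. s / sqrt b) \<longlongrightarrow> 0) at_top" by real_asymp
        hence "eventually (\<lambda>b. dist (s / sqrt b) 0 < r) at_top" using r_pos by (rule tendstoD)
        thus "\<forall>\<^sub>F b in at_top. exp (Complex (- b * (ln (1 + (s / sqrt b)\<^sup>2) / 2)) (b * (s / sqrt b - arctan (s / sqrt b)))) * \<i> = W b (s / sqrt b)"
        proof eventually_elim
          case (elim b)
          hence "\<bar>s / sqrt b\<bar> < r" by (simp add: dist_real_def)
          hence *: "\<gamma> (s / sqrt b) = Complex 1 (s / sqrt b)" "\<gamma>' (s / sqrt b) = \<i>"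
            by (simp_all only: gamma_near \<gamma>'_def rho'_eq) (simp_all add: complex_eq_iff)
          have "of_real b * (Complex 1 (s / sqrt b) - 1 - Ln (Complex 1 (s / sqrt b))) =
               Complex (- b * (ln (1 + (s / sqrt b)\<^sup>2) / 2)) (b * (s / sqrt b - arctan (s / sqrt b)))"
            unfolding Ln_Complex_1 by (simp add: complex_eq_iff)
          thus ?case unfolding W_def E_def * by simp
        qed
      qed
      finally show "((\<lambda>b. W b (s / sqrt b)) \<longlongrightarrow> f s) at_top" .
    qed
  qed
  also have "(LINT s|lborel. f s) = \<i> * of_real (sqrt (2 * pi))"
  proof -
    have "(LINT s|lborel. exp (- s\<^sup>2 / 2)) = sqrt (2 * pi)"
      using integral_std_normal_moment_even[of 0] by (simp add: std_normal_density_def)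
    thus ?thesis unfolding f_def by (simp del: of_real_mult flip: of_real_mult)
  qed
  also have "((\<lambda>b. LINT s|lborel. W b (s / sqrt b)) \<longlongrightarrow> \<i> * of_real (sqrt (2 * pi))) at_top \<longleftrightarrow> ?thesis"
  proof (rule tendsto_cong)
    show "\<forall>\<^sub>F b in at_top. (LINT s|lborel. W b (s / sqrt b)) = of_real (sqrt b) * mom b 0"
      using eventually_gt_at_top[of 0]
    proof eventually_elim
      case (elim b)
      have "mom b 0 = \<bar>1 / sqrt b\<bar> *\<^sub>R (LINT s|lborel. W b (0 + 1 / sqrt b * s))"
        unfolding mom_def using elim by (subst lborel_integral_real_affine[of "1 / sqrt b" _ 0]) auto
      thus ?case using elim by (simp add: scaleR_conv_of_real field_simps)
    qed
  qed
  finally show ?thesis .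
qed

lemma mom_0_lower:
  obtains c B where "c > 0" "B > 0" "\<And>b. b \<ge> B \<Longrightarrow> norm (mom b 0) \<ge> c * b powr (-1/2)"
proof -
  have "((\<lambda>b. norm (of_real (sqrt b) * mom b 0)) \<longlongrightarrow> norm (\<i> * of_real (sqrt (2 * pi)) :: complex)) at_top"
    by (intro tendsto_intros Laplace_limit)
  \<comment> \<open>Any positive constant below sqrt(2 pi) would serve; the value 1 makes c =
    1.\<close>
  moreover have "norm (\<i> * of_real (sqrt (2 * pi)) :: complex) > 1"
    using pi_ge_two by (simp add: norm_mult real_less_rsqrt)
  ultimately have "eventually (\<lambda>b. norm (of_real (sqrt b) * mom b 0) > 1) at_top"
    by (rule order_tendstoD)
  then obtain B where B: "\<And>b. b \<ge> B \<Longrightarrow> norm (of_real (sqrt b) * mom b 0) > 1"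
    by (auto simp: eventually_at_top_linorder)
  have "norm (mom b 0) \<ge> 1 * b powr (-1/2)" if "b \<ge> max B 1" for b
    using B[of b] that by (simp add: norm_mult powr_minus powr_half_sqrt field_simps)
  thus thesis by (intro that[of 1 "max B 1"]) auto
qed

text \<open>The factors come from the bound on |\<open>\<gamma>'\<close>|, from the integral of 1/(1
  + t^2), and from rescaling t^6 dt by sqrt(\<open>\<theta>\<close> b/8), of which only the part
  without b is kept.\<close>

definition rem_const :: real where "rem_const = (1 + M) * pi * (\<theta> / 8) powr (-7/2)"

lemma rem_const_nonneg: "rem_const \<ge> 0"
  using M_nonneg by (simp add: rem_const_def)

text \<open>On the scale b^(-1/2) a sixth power of t contributes b^(-3) and the integration another
  b^(-1/2). Division by the zeroth moment removes the latter and leaves the O(b^(-3)) of the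
  expansion.\<close>

lemma remainder_bound:
  assumes b: "b \<ge> 8 / \<theta>" and f: "continuous_on UNIV f" "\<And>t. norm (f t) \<le> K * t ^ 6"
  shows "norm (LINT t|lborel. W b t * f t) \<le> rem_const * K * b powr (-7/2)"
proof -
  define \<kappa> where "\<kappa> = \<theta> / 8"
  have kappa: "\<kappa> > 0" using theta_pos by (simp add: \<kappa>_def)
  show ?thesis
  proof -
    have b0: "b > 0" using b theta_pos by (smt (verit) divide_pos_pos)
    have K: "K \<ge> 0" using order.trans[OF norm_ge_zero f(2)[of 1]] by simp
    define A where "A = (1 + M) * K * (\<kappa> * b) powr (-3)"
    define g where "g = (\<lambda>t. A * inverse (1 + (sqrt (\<kappa> * b) * t)\<^sup>2))"
    have le: "norm (W b t * f t) \<le> g t" for t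
    proof -
      \<comment> \<open>In this variable t^6 is y^3 up to the factor (\<open>\<kappa>\<close>
        b)^(-3), and (1 + y)^(-4) y^3 is at most 1/(1 + y).\<close>
      define y where "y = \<kappa> * b * t\<^sup>2"
      have y: "y \<ge> 0" using kappa b0 by (simp add: y_def)
      have "y ^ 3 \<le> (1 + y) ^ 3" using y by (intro power_mono) auto
      hence "t ^ 6 * (\<kappa> * b) ^ 3 \<le> (1 + y) ^ 3" by (simp add: y_def power_mult_distrib mult_ac flip: power_mult)
      hence t6: "t ^ 6 \<le> (\<kappa> * b) powr (-3) * (1 + y) ^ 3"
        using kappa b0 by (simp add: powr_minus field_simps)
      have "norm (W b t * f t) \<le> ((1 + M) * (1 + y) powr (-4)) * (K * t ^ 6)"
        unfolding norm_mult using norm_W_scaled[OF b, of t] f(2)[of t] M_nonneg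
        by (intro mult_mono) (auto simp: \<kappa>_def y_def)
      also have "\<dots> \<le> ((1 + M) * (1 + y) powr (-4)) * (K * ((\<kappa> * b) powr (-3) * (1 + y) ^ 3))"
        using M_nonneg K t6 by (intro mult_left_mono) auto
      also have "\<dots> = A * ((1 + y) powr (-4) * (1 + y) ^ 3)" by (simp add: A_def)
      also have "(1 + y) powr (-4) * (1 + y) ^ 3 = inverse (1 + y)"
      proof -
        have "z powr (-4) * z ^ 3 = inverse z" if "z > 0" for z :: real
          using that by (simp add: powr_minus field_simps eval_nat_numeral)
        from this[of "1 + y"] show ?thesis using y by linarith
      qed
      also have "y = (sqrt (\<kappa> * b) * t)\<^sup>2" using kappa b0 by (simp add: y_def power_mult_distrib)
      finally show ?thesis by (simp add: g_def)
    qed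
    have int: "has_bochner_integral lborel (\<lambda>t::real. inverse (1 + t\<^sup>2)) pi"
      using integrable_inverse_1_plus_square LBINT_inverse_1_plus_square
      by (simp add: has_bochner_integral_iff set_integrable_def interval_lebesgue_integral_def set_lebesgue_integral_def)
    have int': "integrable lborel g"
      unfolding g_def using lborel_integrable_real_affine[of "\<lambda>t::real. inverse (1 + t\<^sup>2)" "sqrt (\<kappa> * b)" 0] int kappa b0
      by (intro integrable_mult_right) (auto simp: has_bochner_integral_iff)
    have "norm (LINT t|lborel. W b t * f t) \<le> (LINT t|lborel. g t)"
      by (rule Bochner_Integration.integral_norm_bound_integral[OF _ int']) (use le f order.trans[OF le abs_ge_self] in \<open>auto intro!: Bochner_Integration.integrable_bound[OF int']\<close>)
    also have "\<dots> = A * (pi / sqrt (\<kappa> * b))"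
    proof -
      have "pi = sqrt (\<kappa> * b) * (LINT t|lborel. inverse (1 + (sqrt (\<kappa> * b) * t)\<^sup>2))"
        using lborel_integral_real_affine[of "sqrt (\<kappa> * b)" "\<lambda>t::real. inverse (1 + t\<^sup>2)" 0] int kappa b0
        by (simp add: has_bochner_integral_iff)
      hence "(LINT t|lborel. inverse (1 + (sqrt (\<kappa> * b) * t)\<^sup>2)) = pi / sqrt (\<kappa> * b)"
        using kappa b0 by (simp add: field_simps)
      thus ?thesis by (simp add: g_def)
    qed
    also have "\<dots> = (1 + M) * K * pi * ((\<kappa> * b) powr (-3) * (\<kappa> * b) powr (-1/2))"
      using kappa b0 by (simp add: A_def powr_minus powr_half_sqrt field_simps)
    also have "(\<kappa> * b) powr (-3) * (\<kappa> * b) powr (-1/2) = (\<kappa> * b) powr (-7/2)"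
      by (simp flip: powr_add)
    also have "\<dots> = \<kappa> powr (-7/2) * b powr (-7/2)" using kappa b0 by (simp add: powr_mult)
    finally show ?thesis by (simp add: rem_const_def \<kappa>_def mult_ac)
  qed
qed

end

text \<open>
  The power \<open>(1 - \<xi>/u)\<^bsup>-a\<^esup>\<close>, cut so that for \<open>u\<close> to the right of \<open>\<xi>\<close> at the same height it is
  holomorphic in both variables: with the principal branch the cut from \<open>0\<close> to \<open>\<xi>\<close> could meet the contour.
\<close>
definition branch_power :: "real \<Rightarrow> complex \<Rightarrow> complex \<Rightarrow> complex" where
  "branch_power a u \<xi> = exp (- of_real a * (Ln (u - \<xi>) - Ln u))"

lemma norm_branch_power:
  assumes "u \<noteq> 0" "u \<noteq> \<xi>"
  shows "norm (branch_power a u \<xi>) = (norm u / norm (u - \<xi>)) powr a"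
  using assms by (simp add: branch_power_def powr_def ln_div algebra_simps)

lemma norm_branch_power_le:
  assumes "u \<noteq> 0" "norm (u - \<xi>) \<ge> e" "e > 0" "a > 0"
  shows "norm (branch_power a u \<xi>) \<le> (1 + norm \<xi> / e) powr a"
proof -
  have nz: "norm (u - \<xi>) > 0" using assms by linarith
  have "norm u \<le> norm (u - \<xi>) + norm \<xi>" using norm_triangle_ineq[of "u - \<xi>" \<xi>] by simp
  hence "norm u / norm (u - \<xi>) \<le> 1 + norm \<xi> / norm (u - \<xi>)" using nz by (simp add: field_simps)
  also have "norm \<xi> / norm (u - \<xi>) \<le> norm \<xi> / e" using assms nz by (intro divide_left_mono) auto
  finally show ?thesis using assms nz by (subst norm_branch_power) (auto intro!: powr_mono2)
qed

text \<open>Both u and 1 - \<open>\<xi>\<close>/u have positive real part, so their principal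
  arguments lie in (-pi/2, pi/2) and the logarithms add without a jump. This ties the adapted branch
  to the binomial series.\<close>

lemma branch_power_disc:
  assumes "Re u \<ge> 1" "norm \<xi> < 1"
  shows "branch_power a u \<xi> = (1 - \<xi> * inverse u) powr (- of_real a)"
proof -
  have "norm u \<ge> 1" using assms complex_Re_le_cmod[of u] by linarith
  hence u: "u \<noteq> 0" "norm (inverse u) \<le> 1" by (auto simp: norm_inverse inverse_le_1_iff)
  have "norm (\<xi> * inverse u) \<le> norm \<xi> * 1" unfolding norm_mult by (intro mult_left_mono u) auto
  hence "norm (\<xi> * inverse u) < 1" using assms by simp
  hence re: "Re (1 - \<xi> * inverse u) > 0" using complex_Re_le_cmod[of "\<xi> * inverse u"] by simp
  hence nz: "1 - \<xi> * inverse u \<noteq> 0" by force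
  have "Ln (u * (1 - \<xi> * inverse u)) = Ln u + Ln (1 - \<xi> * inverse u)"
  proof (rule Ln_times_simple)
    have "\<bar>Im (Ln u)\<bar> < pi/2" "\<bar>Im (Ln (1 - \<xi> * inverse u))\<bar> < pi/2"
      using assms re unfolding Re_Ln_pos_lt[OF u(1)] Re_Ln_pos_lt[OF nz] by linarith+
    thus "- pi < Im (Ln u) + Im (Ln (1 - \<xi> * inverse u))" "Im (Ln u) + Im (Ln (1 - \<xi> * inverse u)) \<le> pi" by linarith+
  qed (use u nz in auto)
  moreover have "u * (1 - \<xi> * inverse u) = u - \<xi>" using u by (simp add: field_simps)
  ultimately show ?thesis using nz by (simp add: branch_power_def powr_def)
qed

text \<open>For a <= b every factor (a+i)/(b+i) is at most 1, so the exponential series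
  dominates.\<close>

lemma hyp1F1_term_bound:
  fixes z :: complex
  assumes "a > 0" "a \<le> b"
  shows "norm (pochhammer (of_real a) k / pochhammer (of_real b) k * z ^ k / fact k) \<le> norm z ^ k / fact k"
proof -
  have "pochhammer a k \<le> pochhammer b k"
    unfolding pochhammer_prod using assms by (intro prod_mono) auto
  hence "norm (pochhammer (of_real a) k / pochhammer (of_real b) k :: complex) \<le> 1"
    using assms pochhammer_pos[of a k] pochhammer_pos[of b k]
    by (simp add: pochhammer_of_real norm_divide)
  hence "norm (pochhammer (of_real a) k / pochhammer (of_real b) k :: complex) * (norm z ^ k / fact k) \<le> 1 * (norm z ^ k / fact k)"
    by (intro mult_right_mono) auto
  thus ?thesis by (simp add: norm_mult norm_divide norm_power)
qed

lemma hyp1F1_sums: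
  assumes "a > 0" "a \<le> b"
  shows "(\<lambda>k. pochhammer (of_real a) k / pochhammer (of_real b) k * z ^ k / fact k) sums hyp1F1 (of_real a) (of_real b) z"
  unfolding hyp1F1_def
proof (rule summable_sums, rule summable_comparison_test'[where N = 0])
  show "summable (\<lambda>k. norm z ^ k / fact k)"
    using summable_exp[of "norm z"] by (simp add: divide_inverse mult.commute)
qed (use hyp1F1_term_bound[OF assms] in auto)

lemma hyp1F1_holomorphic:
  assumes "a > 0" "a \<le> b"
  shows "hyp1F1 (of_real a) (of_real b) holomorphic_on A"
proof -
  have "hyp1F1 (of_real a) (of_real b) holomorphic_on ball 0 r" for r
    using hyp1F1_sums[OF assms]
    by (intro power_series_holomorphic[where a = "\<lambda>k. pochhammer (of_real a) k / pochhammer (of_real b) k / fact k"]) simp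
  hence "hyp1F1 (of_real a) (of_real b) field_differentiable at z" for z
    by (rule holomorphic_on_imp_differentiable_at[where s = "ball 0 (norm z + 1)"]) auto
  thus ?thesis by (simp add: field_differentiable_at_within holomorphic_onI)
qed

section \<open>Integral representation to the left of the contour\<close>

context contour
begin

text \<open>For \<open>\<xi>\<close> in this set, \<open>\<gamma> t - \<xi>\<close> can be real only
  at t = Im \<open>\<xi>\<close>, where it is positive. The cut of Ln(u - \<open>\<xi>\<close>) is
  therefore never met.\<close>

definition left_region :: "complex set" where "left_region = {\<xi>. Re \<xi> < \<rho> (Im \<xi>)}"

lemma cont_rho: "continuous_on A \<rho>"
  using rho_deriv by (meson DERIV_isCont continuous_at_imp_continuous_on)

lemma open_left_region: "open left_region"
  unfolding left_region_def
  by (intro open_Collect_less continuous_intros continuous_on_compose2[OF cont_rho[of UNIV]]) auto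

text \<open>Each point is joined by a horizontal segment to the half-plane Re < 1, which all these
  pieces share.\<close>

lemma connected_left_region: "connected left_region"
proof -
  let ?H = "{\<xi>::complex. Re \<xi> < 1}"
  let ?S = "\<lambda>\<xi>. ?H \<union> closed_segment (Complex 0 (Im \<xi>)) \<xi>"
  have "left_region = (\<Union>\<xi>\<in>left_region. ?S \<xi>)"
  proof (intro equalityI subsetI)
    fix z assume "z \<in> (\<Union>\<xi>\<in>left_region. ?S \<xi>)"
    then obtain \<xi> where xi: "\<xi> \<in> left_region" "z \<in> ?S \<xi>" by blast
    show "z \<in> left_region"
    proof (cases "Re z < 1")
      case True
      thus ?thesis using rho_ge1[of "Im z"] by (simp add: left_region_def)
    next
      case False
      with xi obtain u where u: "0 \<le> u" "u \<le> 1" "z = (1 - u) *\<^sub>R Complex 0 (Im \<xi>) + u *\<^sub>R \<xi>"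
        by (auto simp: in_segment)
      hence eq: "Im z = Im \<xi>" "Re z = u * Re \<xi>" unfolding u(3) by (simp_all add: algebra_simps)
      have "Re \<xi> > 0" using False eq u by (smt (verit) mult_nonneg_nonpos)
      hence "Re z \<le> Re \<xi>" using u eq by (simp add: mult_left_le_one_le)
      thus ?thesis using xi eq by (simp add: left_region_def)
    qed
  qed auto
  also have "connected \<dots>"
  proof (rule connected_Union)
    fix S assume "S \<in> ?S ` left_region"
    then obtain \<xi> where "S = ?S \<xi>" by blast
    moreover have "connected (?S \<xi>)"
    proof (rule connected_Un)
      show "connected ?H" by (intro convex_connected convex_halfspace_Re_lt)
      show "?H \<inter> closed_segment (Complex 0 (Im \<xi>)) \<xi> \<noteq> {}"
        using ends_in_segment(1)[of "Complex 0 (Im \<xi>)" \<xi>] by force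
    qed auto
    ultimately show "connected S" by simp
  next
    have "0 \<in> \<Inter> (?S ` left_region)" by simp
    thus "\<Inter> (?S ` left_region) \<noteq> {}" by blast
  qed
  finally show ?thesis .
qed

lemma gamma_notin_left: "\<gamma> t \<notin> left_region"
  by (simp add: left_region_def \<gamma>_def)

lemma gamma_diff_not_nonpos: "\<xi> \<in> left_region \<Longrightarrow> \<gamma> t - \<xi> \<notin> \<real>\<^sub>\<le>\<^sub>0"
  by (auto simp: left_region_def \<gamma>_def complex_nonpos_Reals_iff)

text \<open>A ball inside the region misses the contour; halving its radius leaves a gap that is
  uniform in t although the contour is unbounded.\<close>

lemma left_region_nbhd:
  assumes "\<xi>0 \<in> left_region"
  obtains e where "e > 0" "cball \<xi>0 e \<subseteq> left_region" "\<And>\<xi> t. \<xi> \<in> cball \<xi>0 e \<Longrightarrow> norm (\<gamma> t - \<xi>) \<ge> e"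
proof -
  obtain d where d: "d > 0" "cball \<xi>0 d \<subseteq> left_region"
    using open_left_region assms open_contains_cball by blast
  show ?thesis
  proof (rule that[of "d / 2"])
    fix \<xi> t assume "\<xi> \<in> cball \<xi>0 (d / 2)"
    moreover have "dist \<xi>0 (\<gamma> t) > d" using d gamma_notin_left[of t] by (force simp: not_le[symmetric])
    ultimately show "norm (\<gamma> t - \<xi>) \<ge> d / 2"
      using dist_triangle[of \<xi>0 "\<gamma> t" \<xi>] by (simp add: dist_norm norm_minus_commute)
  qed (use d in auto)
qed

lemma cont_branch_power: "\<xi> \<in> left_region \<Longrightarrow> continuous_on UNIV (\<lambda>t. branch_power a (\<gamma> t) \<xi>)"
  unfolding branch_power_def by (intro continuous_intros cont_gamma) (auto simp: gamma_diff_not_nonpos)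

text \<open>Differentiation under the integral sign. On a small ball the
  \<open>\<xi>\<close>-derivative of the power is bounded uniformly in t, so its difference
  quotients are too, and a multiple of |W| dominates along every sequence tending to
  \<open>\<xi>0\<close>.\<close>

lemma integral_branch_power_holomorphic:
  assumes b: "b \<ge> 8 / \<theta>" and a: "a > 0"
  shows "(\<lambda>\<xi>. LINT t|lborel. W b t * branch_power a (\<gamma> t) \<xi>) holomorphic_on left_region"
proof (rule holomorphic_onI, rule field_differentiable_at_within)
  fix \<xi>0 assume "\<xi>0 \<in> left_region"
  then obtain e where e: "e > 0" "cball \<xi>0 e \<subseteq> left_region" "\<And>\<xi> t. \<xi> \<in> cball \<xi>0 e \<Longrightarrow> norm (\<gamma> t - \<xi>) \<ge> e"
    using left_region_nbhd by blast
  let ?I = "\<lambda>\<xi>. LINT t|lborel. W b t * branch_power a (\<gamma> t) \<xi>"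
  define G' where "G' = (\<lambda>t \<xi>. branch_power a (\<gamma> t) \<xi> * (of_real a / (\<gamma> t - \<xi>)))"
  define KG where "KG = (1 + (norm \<xi>0 + e) / e) powr a"
  define K where "K = KG * (a / e)"
  have K0: "K \<ge> 0" "KG \<ge> 0" using a e by (auto simp: K_def KG_def)
  have GK: "norm (branch_power a (\<gamma> t) \<xi>) \<le> KG" if "\<xi> \<in> cball \<xi>0 e" for t \<xi>
  proof -
    have "norm \<xi> \<le> norm \<xi>0 + e" using that norm_triangle_ineq2[of \<xi> \<xi>0]
      by (simp add: dist_norm norm_minus_commute)
    hence "(1 + norm \<xi> / e) powr a \<le> KG" unfolding KG_def
      using e a by (intro powr_mono2) (auto intro!: divide_right_mono add_nonneg_nonneg)
    thus ?thesis using norm_branch_power_le[OF gamma_nz e(3)[OF that] e(1) a, of t] by linarith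
  qed
  have deriv: "(branch_power a (\<gamma> t) has_field_derivative G' t \<xi>) (at \<xi>)" if "\<xi> \<in> left_region" for t \<xi>
    unfolding branch_power_def[abs_def] G'_def using gamma_diff_not_nonpos[OF that, of t]
    by (auto intro!: derivative_eq_intros simp: field_simps)
  have G'K: "norm (G' t \<xi>) \<le> K" if "\<xi> \<in> cball \<xi>0 e" for t \<xi>
    unfolding G'_def K_def norm_mult norm_divide
    using GK[OF that] e(3)[OF that, of t] e(1) a K0 by (intro mult_mono frac_le) auto
  have lip: "norm (branch_power a (\<gamma> t) \<xi> - branch_power a (\<gamma> t) \<xi>0) \<le> K * norm (\<xi> - \<xi>0)" if "\<xi> \<in> cball \<xi>0 e" for t \<xi>
    using that e G'K
    by (intro field_differentiable_bound[OF convex_cball[of \<xi>0 e], where f' = "G' t"])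
       (auto intro!: has_field_derivative_at_within deriv)
  have intG: "integrable lborel (\<lambda>t. W b t * branch_power a (\<gamma> t) \<xi>)" if "\<xi> \<in> cball \<xi>0 e" for \<xi>
    using that e by (intro integrable_W_mult[of _ _ KG] b cont_branch_power GK) auto
  have "((\<lambda>\<xi>. (?I \<xi> - ?I \<xi>0) / (\<xi> - \<xi>0)) \<longlongrightarrow> (LINT t|lborel. W b t * G' t \<xi>0)) (at \<xi>0 within cball \<xi>0 e)"
    unfolding tendsto_at_iff_sequentially comp_def
  proof (intro allI impI)
    fix X :: "nat \<Rightarrow> complex" assume X: "\<forall>i. X i \<in> cball \<xi>0 e - {\<xi>0}" "X \<longlonglongrightarrow> \<xi>0"
    let ?q = "\<lambda>i t. W b t * ((branch_power a (\<gamma> t) (X i) - branch_power a (\<gamma> t) \<xi>0) / (X i - \<xi>0))"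
    have "(\<lambda>i. LINT t|lborel. ?q i t) \<longlonglongrightarrow> (LINT t|lborel. W b t * G' t \<xi>0)"
    proof (rule integral_dominated_convergence[where w = "\<lambda>t. norm (W b t) * K"])
      have x0: "\<xi>0 \<in> left_region" using e by auto
      show "(\<lambda>t. W b t * G' t \<xi>0) \<in> borel_measurable lborel"
        unfolding G'_def
        by (intro W_mult_measurable continuous_intros cont_branch_power cont_gamma x0) (use x0 gamma_notin_left in auto)
      show "?q i \<in> borel_measurable lborel" for i
        by (intro W_mult_measurable continuous_intros cont_branch_power x0) (use X e in auto)
      show "integrable lborel (\<lambda>t. norm (W b t) * K)" using integrable_W[OF b] by simp
      show "AE t in lborel. (\<lambda>i. ?q i t) \<longlonglongrightarrow> W b t * G' t \<xi>0"
      proof (intro AE_I2 tendsto_intros)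
        fix t
        have "((\<lambda>\<xi>. (branch_power a (\<gamma> t) \<xi> - branch_power a (\<gamma> t) \<xi>0) / (\<xi> - \<xi>0)) \<longlongrightarrow> G' t \<xi>0) (at \<xi>0 within cball \<xi>0 e)"
          using deriv[OF x0, of t] unfolding has_field_derivative_iff by (rule tendsto_within_subset) auto
        thus "(\<lambda>i. (branch_power a (\<gamma> t) (X i) - branch_power a (\<gamma> t) \<xi>0) / (X i - \<xi>0)) \<longlonglongrightarrow> G' t \<xi>0"
          unfolding tendsto_at_iff_sequentially comp_def using X by blast
      qed
      show "AE t in lborel. norm (?q i t) \<le> norm (W b t) * K" for i
      proof (rule AE_I2)
        fix t
        have "norm (X i - \<xi>0) > 0" using X by auto
        hence "norm ((branch_power a (\<gamma> t) (X i) - branch_power a (\<gamma> t) \<xi>0) / (X i - \<xi>0)) \<le> K"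
          using lip[of "X i" t] X by (simp add: norm_divide field_simps)
        thus "norm (?q i t) \<le> norm (W b t) * K" unfolding norm_mult by (intro mult_left_mono) auto
      qed
    qed
    also have "(\<lambda>i. LINT t|lborel. ?q i t) = (\<lambda>i. (?I (X i) - ?I \<xi>0) / (X i - \<xi>0))"
    proof
      fix i
      have "(?I (X i) - ?I \<xi>0) / (X i - \<xi>0) = (LINT t|lborel. (W b t * branch_power a (\<gamma> t) (X i) - W b t * branch_power a (\<gamma> t) \<xi>0) / (X i - \<xi>0))"
        using intG[of "X i"] intG[of \<xi>0] X e by (subst integral_divide_zero, subst Bochner_Integration.integral_diff) auto
      thus "(LINT t|lborel. ?q i t) = (?I (X i) - ?I \<xi>0) / (X i - \<xi>0)"
        unfolding times_divide_eq_right right_diff_distrib by (rule sym)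
    qed
    finally show "(\<lambda>i. (?I (X i) - ?I \<xi>0) / (X i - \<xi>0)) \<longlonglongrightarrow> (LINT t|lborel. W b t * G' t \<xi>0)" .
  qed
  hence "(?I has_field_derivative (LINT t|lborel. W b t * G' t \<xi>0)) (at \<xi>0 within cball \<xi>0 e)"
    by (simp add: has_field_derivative_iff)
  hence "(?I has_field_derivative (LINT t|lborel. W b t * G' t \<xi>0)) (at \<xi>0)"
    using e by (subst (asm) at_within_interior) auto
  thus "?I field_differentiable at \<xi>0" by (auto simp: field_differentiable_def)
qed

text \<open>Since |1/u| <= 1 on the contour, the absolutely convergent binomial series at
  |\<open>\<xi>\<close>| dominates the interchange of sum and integral. The j-th moment contributes
  b^j/(b)_j and so completes the hypergeometric term.\<close>

lemma hyp1F1_disc: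
  assumes b: "b \<ge> 8 / \<theta>" and xi: "norm \<xi> < 1"
  shows "(LINT t|lborel. W b t * branch_power a (\<gamma> t) \<xi>) = hyp1F1 (of_real a) (of_real b) (of_real b * \<xi>) * mom b 0"
proof -
  define c where "c = (\<lambda>j. of_real (nb_coeff a j) * \<xi> ^ j)"
  let ?f = "\<lambda>j t. c j * (W b t * inverse (\<gamma> t) ^ j)"
  have G: "(\<lambda>j. of_real (nb_coeff a j) * (\<xi> * inverse u) ^ j) sums branch_power a u \<xi>" if "Re u \<ge> 1" for u
  proof -
    have "norm u \<ge> 1" using that complex_Re_le_cmod[of u] by linarith
    hence "norm (inverse u) \<le> 1" by (auto simp: norm_inverse inverse_le_1_iff)
    hence "norm (\<xi> * inverse u) \<le> norm \<xi> * 1" unfolding norm_mult by (intro mult_left_mono) auto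
    thus ?thesis using xi by (subst branch_power_disc[OF that xi]) (auto intro!: binomial_sums simp del: of_real_divide)
  qed
  have sumc: "summable (\<lambda>j. norm (c j))"
  proof -
    obtain x where x: "norm \<xi> < x" "x < 1" using dense[OF xi] by blast
    hence "summable (\<lambda>j. of_real (nb_coeff a j) * (of_real x :: complex) ^ j)"
      using binomial_sums[of "of_real x" a] norm_ge_zero[of \<xi>] by (auto simp: sums_iff simp del: of_real_divide norm_ge_zero)
    thus ?thesis unfolding c_def by (rule powser_insidea) (use x norm_ge_zero[of \<xi>] in \<open>simp del: norm_ge_zero\<close>)
  qed
  have "(\<lambda>j. LINT t|lborel. ?f j t) sums (LINT t|lborel. (\<Sum>j. ?f j t))"
  proof (rule sums_integral)
    show "integrable lborel (?f j)" for j by (intro integrable_mult_right integrable_mom b)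
    have le: "norm (?f j t) \<le> norm (c j) * norm (W b t)" for j t
      unfolding norm_mult[of "c j"] norm_mult[of "W b t"] using norm_inv_gamma_pow[of t j] 
      by (intro mult_left_mono mult_left_le) auto
    show "AE t in lborel. summable (\<lambda>j. norm (?f j t))"
      by (intro AE_I2 summable_comparison_test'[OF summable_mult2[OF sumc]]) (use le in auto)
    show "summable (\<lambda>j. LINT t|lborel. norm (?f j t))"
    proof (rule summable_comparison_test'[OF summable_mult2[OF sumc]])
      fix j
      have "(LINT t|lborel. norm (?f j t)) \<le> (LINT t|lborel. norm (c j) * norm (W b t))"
        using le by (intro integral_mono integrable_norm integrable_mult_right integrable_mom integrable_W b)
      thus "norm (LINT t|lborel. norm (?f j t)) \<le> norm (c j) * (LINT t|lborel. norm (W b t))"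
        by simp
    qed
  qed
  also have "(\<lambda>j. LINT t|lborel. ?f j t) = (\<lambda>j. pochhammer (of_real a) j / pochhammer (of_real b) j * (of_real b * \<xi>) ^ j / fact j * mom b 0)"
  proof
    fix j
    have "(LINT t|lborel. ?f j t) = c j * mom b j" by (simp add: mom_def)
    thus "(LINT t|lborel. ?f j t) = pochhammer (of_real a) j / pochhammer (of_real b) j * (of_real b * \<xi>) ^ j / fact j * mom b 0"
      unfolding mom_eq[OF b, of j] by (simp add: c_def nb_coeff_def pochhammer_of_real[symmetric] power_mult_distrib mult_ac)
  qed
  also have "(LINT t|lborel. (\<Sum>j. ?f j t)) = (LINT t|lborel. W b t * branch_power a (\<gamma> t) \<xi>)"
  proof (intro Bochner_Integration.integral_cong refl)
    fix t
    have "(\<lambda>j. W b t * (of_real (nb_coeff a j) * (\<xi> * inverse (\<gamma> t)) ^ j)) sums (W b t * branch_power a (\<gamma> t) \<xi>)"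
      by (intro sums_mult G Re_gamma)
    also have "(\<lambda>j. W b t * (of_real (nb_coeff a j) * (\<xi> * inverse (\<gamma> t)) ^ j)) = (\<lambda>j. ?f j t)"
      by (simp add: c_def power_mult_distrib fun_eq_iff mult_ac)
    finally show "(\<Sum>j. ?f j t) = W b t * branch_power a (\<gamma> t) \<xi>" by (rule sums_unique[symmetric])
  qed
  finally have sums: "(\<lambda>j. pochhammer (of_real a) j / pochhammer (of_real b) j * (of_real b * \<xi>) ^ j / fact j * mom b 0) sums
     (LINT t|lborel. W b t * branch_power a (\<gamma> t) \<xi>)" .
  show ?thesis
  \<comment> \<open>If the zeroth moment vanishes, both sides are 0; otherwise dividing by it
    recovers the series.\<close>
  proof (cases "mom b 0 = 0")
    case False
    have "(\<lambda>j. pochhammer (of_real a) j / pochhammer (of_real b) j * (of_real b * \<xi>) ^ j / fact j) sums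
       ((LINT t|lborel. W b t * branch_power a (\<gamma> t) \<xi>) / mom b 0)"
      using sums_divide[OF sums, of "mom b 0"] False by simp
    thus ?thesis using False by (simp add: hyp1F1_def sums_iff)
  qed (use sums in \<open>simp add: sums_iff\<close>)
qed

text \<open>Both sides are holomorphic on the connected region left of the contour, which contains
  the unit disc because \<open>\<rho>\<close> is at least 1.\<close>

lemma hyp1F1_contour:
  assumes b: "b \<ge> 8 / \<theta>" "b \<ge> a" and a: "a > 0" and xi: "\<xi> \<in> left_region"
  shows "(LINT t|lborel. W b t * branch_power a (\<gamma> t) \<xi>) = hyp1F1 (of_real a) (of_real b) (of_real b * \<xi>) * mom b 0"
proof (rule analytic_continuation_open[where s = "ball 0 1" and s' = left_region and z = \<xi>])
  show "ball 0 1 \<subseteq> left_region"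
  proof
    fix z :: complex assume "z \<in> ball 0 1"
    thus "z \<in> left_region" using complex_Re_le_cmod[of z] rho_ge1[of "Im z"] by (simp add: left_region_def)
  qed
  show "(\<lambda>\<xi>. LINT t|lborel. W b t * branch_power a (\<gamma> t) \<xi>) holomorphic_on left_region"
    by (rule integral_branch_power_holomorphic[OF b(1) a])
  have "hyp1F1 (of_real a) (of_real b) \<circ> (\<lambda>\<xi>. of_real b * \<xi>) holomorphic_on left_region"
    by (rule holomorphic_on_compose) (auto intro!: holomorphic_intros hyp1F1_holomorphic[OF a b(2)])
  thus "(\<lambda>\<xi>. hyp1F1 (of_real a) (of_real b) (of_real b * \<xi>) * mom b 0) holomorphic_on left_region"
    unfolding comp_def by (intro holomorphic_intros)
qed (use hyp1F1_disc[OF b(1), of _ a] xi open_left_region connected_left_region in auto)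

lemma one_minus_left_region: "\<xi> \<in> left_region \<Longrightarrow> 1 - \<xi> \<notin> \<real>\<^sub>\<le>\<^sub>0"
  using gamma_diff_not_nonpos[of \<xi> 0] by simp

lemma norm_inv_gamma_diff:
  shows "norm (inverse (\<gamma> t) - 1) \<le> 2" and "\<bar>t\<bar> < r \<Longrightarrow> norm (inverse (\<gamma> t) - 1) \<le> \<bar>t\<bar>"
proof -
  show "norm (inverse (\<gamma> t) - 1) \<le> 2"
    using norm_triangle_ineq4[of "inverse (\<gamma> t)" 1] norm_inv_gamma[of t] by simp
  assume "\<bar>t\<bar> < r"
  hence "1 - \<gamma> t = - \<i> * of_real t" by (simp add: gamma_near complex_eq_iff)
  moreover have "inverse (\<gamma> t) - 1 = inverse (\<gamma> t) * (1 - \<gamma> t)" by (simp add: algebra_simps)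
  ultimately show "norm (inverse (\<gamma> t) - 1) \<le> \<bar>t\<bar>"
    using mult_right_mono[OF norm_inv_gamma[of t], of "\<bar>t\<bar>"] by (simp add: norm_mult)
qed

text \<open>The factorisation u - \<open>\<xi>\<close> = (1 - \<open>\<xi>\<close>)(1 - z)u with z =
  w(1/u - 1) splits the power into the prefactor and (1 - z)^(-a). Near t = 0 the logarithms add and
  Taylor's formula applies; elsewhere t^6 is bounded below, so crude bounds on both terms suffice.
  Six terms make the error fit \<open>remainder_bound\<close>.\<close>

lemma branch_power_expansion:
  assumes a: "a > 0" and xi0: "\<xi>0 \<in> left_region"
  obtains e K where "e > 0" "K \<ge> 0" "ball \<xi>0 e \<subseteq> left_region"
    "\<And>\<xi>. \<xi> \<in> ball \<xi>0 e \<Longrightarrow> norm (1 - \<xi>) \<ge> e"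
    "\<And>\<xi> t. \<xi> \<in> ball \<xi>0 e \<Longrightarrow> norm (branch_power a (\<gamma> t) \<xi> - (1 - \<xi>) powr (- of_real a) *
      (\<Sum>j<6. of_real (nb_coeff a j) * (\<xi> / (1 - \<xi>) * (inverse (\<gamma> t) - 1)) ^ j)) \<le> K * t ^ 6"
proof -
  obtain e where e: "e > 0" "cball \<xi>0 e \<subseteq> left_region" "\<And>\<xi> t. \<xi> \<in> cball \<xi>0 e \<Longrightarrow> norm (\<gamma> t - \<xi>) \<ge> e"
    using left_region_nbhd[OF xi0] by blast
  from binomial_remainder[where n = 6 and s = a]
  obtain C where "C \<ge> 0 \<and> (\<forall>z::complex. norm z \<le> 1/2 \<longrightarrow>
    norm ((1 - z) powr (- of_real a) - (\<Sum>j<6. of_real (nb_coeff a j) * z ^ j)) \<le> C * norm z ^ 6)"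
    by (elim exE) (rule that)
  hence C: "C \<ge> 0" "\<And>z::complex. norm z \<le> 1/2 \<Longrightarrow>
    norm ((1 - z) powr (- of_real a) - (\<Sum>j<6. of_real (nb_coeff a j) * z ^ j)) \<le> C * norm z ^ 6"
    by (rule conjunct1, simp only: simp_thms)
  define S where "S = (\<lambda>z::complex. \<Sum>j<6. of_real (nb_coeff a j) * z ^ j)"
  \<comment> \<open>\<open>q\<close> is z on the straight part of the contour, and \<open>h\<close>
    is the sum of the three arguments to be added. Both are functions of a pair, so that a single
    neighbourhood controls \<open>\<xi>\<close> near \<open>\<xi>0\<close> and t near 0
    together.\<close>
  define q where "q = (\<lambda>(\<xi>::complex, t::real). \<xi> / (1 - \<xi>) * (inverse (Complex 1 t) - 1))"
  define h where "h = (\<lambda>(\<xi>::complex, t::real). Im (Ln (1 - \<xi>)) + Im (Ln (1 - q (\<xi>, t))) + Im (Ln (Complex 1 t)))"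
  have nn0: "1 - \<xi>0 \<notin> \<real>\<^sub>\<le>\<^sub>0" by (rule one_minus_left_region[OF xi0])
  hence nz0: "1 - \<xi>0 \<noteq> 0" by force
  have Cplx: "Complex 1 t \<noteq> 0" "Complex 1 t \<notin> \<real>\<^sub>\<le>\<^sub>0" for t
    by (auto simp: complex_eq_iff complex_nonpos_Reals_iff)
  have cq: "isCont q (\<xi>0, 0)"
    unfolding q_def case_prod_unfold Complex_eq using nz0
    by (intro continuous_intros) (auto simp: complex_eq_iff)
  have C10: "Complex 1 0 = 1" by (simp add: complex_eq_iff)
  have q0: "q (\<xi>0, 0) = 0" by (simp add: q_def C10)
  have cq': "isCont (\<lambda>x. Im (Ln (1 - q x))) (\<xi>0, 0)"
    using cq q0 by (intro isCont_Im isCont_Ln' continuous_diff) auto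
  have ch: "isCont h (\<xi>0, 0)"
    unfolding h_def case_prod_unfold Complex_eq using nn0 q0
    by (intro continuous_intros) (use cq' in \<open>auto simp: complex_nonpos_Reals_iff\<close>)
  \<comment> \<open>At the saddle z = 0 and u = 1, so the sum is the argument of 1 -
    \<open>\<xi>0\<close>, strictly inside (-pi, pi) because that number is off the cut. Continuity
    keeps it there, which excludes an extra multiple of 2 pi i.\<close>
  have "\<bar>h (\<xi>0, 0)\<bar> < pi"
  proof -
    have "h (\<xi>0, 0) = Im (Ln (1 - \<xi>0))" by (simp add: h_def q0 C10)
    moreover have "Im (Ln (1 - \<xi>0)) \<noteq> pi" using nn0 nz0 Im_Ln_eq_pi[OF nz0] by (auto simp: complex_nonpos_Reals_iff)
    ultimately show ?thesis using mpi_less_Im_Ln[OF nz0] Im_Ln_le_pi[OF nz0] by linarith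
  qed
  moreover have "(h \<longlongrightarrow> h (\<xi>0, 0)) (nhds (\<xi>0, 0))"
    using ch by (simp add: isCont_def tendsto_at_iff_tendsto_nhds)
  ultimately have "eventually (\<lambda>y. \<bar>h y\<bar> < pi) (nhds (\<xi>0, 0))"
    by (intro order_tendstoD(2)[OF tendsto_rabs])
  moreover have "(q \<longlongrightarrow> q (\<xi>0, 0)) (nhds (\<xi>0, 0))"
    using cq by (simp only: isCont_def tendsto_at_iff_tendsto_nhds)
  hence "((\<lambda>y. norm (q y)) \<longlongrightarrow> 0) (nhds (\<xi>0, 0))" unfolding q0 by (rule tendsto_norm_zero)
  hence "eventually (\<lambda>y. norm (q y) < 1/2) (nhds (\<xi>0, 0))"
    by (rule order_tendstoD) simp
  ultimately have "eventually (\<lambda>y. \<bar>h y\<bar> < pi \<and> norm (q y) < 1/2) (nhds (\<xi>0, 0))" by (rule eventually_conj)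
  then obtain d where d: "d > 0" "\<And>y. dist y (\<xi>0, 0) < d \<Longrightarrow> \<bar>h y\<bar> < pi \<and> norm (q y) < 1/2"
    unfolding eventually_nhds_metric by blast
  define s where "s = min (d / 2) r"
  define e' where "e' = min e (d / 2)"
  have pos: "s > 0" "e' > 0" using d r_pos e by (auto simp: s_def e'_def)
  define R where "R = norm \<xi>0 + e"
  define Q where "Q = e powr (- a)"
  define K1 where "K1 = Q * C * (R / e) ^ 6"
  define K2 where "K2 = (1 + R / e) powr a"
  define K3 where "K3 = Q * (\<Sum>j<6. nb_coeff a j * (R / e * 2) ^ j)"
  have R: "R > 0" using e norm_ge_zero[of \<xi>0] unfolding R_def by linarith
  have nn: "Q \<ge> 0" "K1 \<ge> 0" "K2 \<ge> 0" "K3 \<ge> 0"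
    using e a R C nb_coeff_pos[OF a] by (auto simp: Q_def K1_def K2_def K3_def less_imp_le intro!: mult_nonneg_nonneg sum_nonneg)
  \<comment> \<open>\<open>K1\<close> is the Taylor constant for |t| < s. Beyond that t^6/s^6 >= 1,
    so the bounds \<open>K2\<close> and \<open>K3\<close> of the two terms are scaled by
    1/s^6.\<close>
  define K where "K = K1 + (K2 + K3) / s ^ 6"
  have S_le: "norm (S z) \<le> (\<Sum>j<6. nb_coeff a j * B ^ j)" if "norm z \<le> B" for z B
    unfolding S_def
  proof (rule sum_norm_le)
    fix j :: nat
    have "norm (of_real (nb_coeff a j) * z ^ j) = nb_coeff a j * norm z ^ j"
      using nb_coeff_pos[OF a, of j] by (simp add: norm_mult norm_power norm_divide)
    also have "\<dots> \<le> nb_coeff a j * B ^ j"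
      using nb_coeff_pos[OF a, of j] that by (intro mult_left_mono power_mono) auto
    finally show "norm (of_real (nb_coeff a j) * z ^ j) \<le> nb_coeff a j * B ^ j" .
  qed
  have main: "norm (1 - \<xi>) \<ge> e' \<and> (\<forall>t. norm (branch_power a (\<gamma> t) \<xi> - (1 - \<xi>) powr (- of_real a) * S (\<xi> / (1 - \<xi>) * (inverse (\<gamma> t) - 1))) \<le> K * t ^ 6)"
    if xi: "\<xi> \<in> ball \<xi>0 e'" for \<xi>
  proof (intro conjI allI)
    have xie: "\<xi> \<in> cball \<xi>0 e" "\<xi> \<in> left_region" using xi e by (auto simp: e'_def)
    have n1: "norm (1 - \<xi>) \<ge> e" using e(3)[OF xie(1), of 0] by simp
    thus "norm (1 - \<xi>) \<ge> e'" by (simp add: e'_def)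
    have nz: "1 - \<xi> \<noteq> 0" using n1 e by auto
    have "norm \<xi> \<le> R" using xie norm_triangle_ineq2[of \<xi> \<xi>0] by (simp add: dist_norm norm_minus_commute R_def)
    hence w: "norm (\<xi> / (1 - \<xi>)) \<le> R / e" unfolding norm_divide using n1 e R by (intro frac_le) auto
    have npw: "norm ((1 - \<xi>) powr (- of_real a)) \<le> Q"
    proof -
      have "norm ((1 - \<xi>) powr (- of_real a)) = norm (1 - \<xi>) powr (- a)"
        using nz by (simp add: powr_def)
      also have "\<dots> \<le> Q" unfolding Q_def using n1 e a by (intro powr_mono2') auto
      finally show ?thesis .
    qed
    fix t
    let ?z = "\<xi> / (1 - \<xi>) * (inverse (\<gamma> t) - 1)"
    show "norm (branch_power a (\<gamma> t) \<xi> - (1 - \<xi>) powr (- of_real a) * S ?z) \<le> K * t ^ 6"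
    proof (cases "\<bar>t\<bar> < s")
      case True
      hence t: "\<bar>t\<bar> < r" "\<bar>t\<bar> < d / 2" by (auto simp: s_def)
      have "dist (\<xi>, t) (\<xi>0, 0) \<le> dist \<xi> \<xi>0 + dist t 0"
        unfolding dist_Pair_Pair by (intro sqrt_sum_squares_le_sum) auto
      also have "\<dots> < d" using t xi by (simp add: e'_def dist_commute dist_real_def)
      finally have hq: "\<bar>h (\<xi>, t)\<bar> < pi" "norm (q (\<xi>, t)) < 1/2" using d by auto
      have z: "?z = q (\<xi>, t)" by (simp add: q_def gamma_near[OF t(1)])
      have nzz: "1 - ?z \<noteq> 0" using hq unfolding z by force
      have "(1 - \<xi>) * ?z = \<xi> * (inverse (\<gamma> t) - 1)" using nz by simp
      hence "(1 - \<xi>) * (1 - ?z) = 1 - \<xi> * inverse (\<gamma> t)"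
        by (simp only: right_diff_distrib) (simp add: algebra_simps)
      hence prod: "(1 - \<xi>) * (1 - ?z) * \<gamma> t = \<gamma> t - \<xi>" by (simp only: left_diff_distrib) simp
      have "Ln (\<gamma> t - \<xi>) = Ln (1 - \<xi>) + Ln (1 - ?z) + Ln (\<gamma> t)"
      proof -
        have "exp (Ln (1 - \<xi>) + Ln (1 - ?z) + Ln (\<gamma> t)) = \<gamma> t - \<xi>"
          using nz nzz by (simp add: exp_add prod del: times_divide_eq_left)
        moreover have "\<bar>Im (Ln (1 - \<xi>) + Ln (1 - ?z) + Ln (\<gamma> t))\<bar> < pi"
          using hq(1) unfolding z by (simp add: h_def gamma_near[OF t(1)])
        hence "Ln (exp (Ln (1 - \<xi>) + Ln (1 - ?z) + Ln (\<gamma> t))) = Ln (1 - \<xi>) + Ln (1 - ?z) + Ln (\<gamma> t)"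
          by (intro Ln_exp) linarith+
        ultimately show ?thesis by simp
      qed
      hence "branch_power a (\<gamma> t) \<xi> = (1 - \<xi>) powr (- of_real a) * (1 - ?z) powr (- of_real a)"
        using nz nzz unfolding branch_power_def powr_def by (simp add: exp_add[symmetric] algebra_simps)
      hence "norm (branch_power a (\<gamma> t) \<xi> - (1 - \<xi>) powr (- of_real a) * S ?z) =
           norm ((1 - \<xi>) powr (- of_real a)) * norm ((1 - ?z) powr (- of_real a) - S ?z)"
        by (simp add: right_diff_distrib[symmetric] norm_mult)
      also have "\<dots> \<le> Q * (C * norm ?z ^ 6)"
        using C(2)[of ?z] hq(2) unfolding S_def z by (intro mult_mono npw) (auto simp: nn)
      also have "norm ?z ^ 6 \<le> (R / e * \<bar>t\<bar>) ^ 6"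
        unfolding norm_mult using w norm_inv_gamma_diff(2)[OF t(1)] R e by (intro power_mono mult_mono) auto
      also have "(R / e * \<bar>t\<bar>) ^ 6 = (R / e) ^ 6 * t ^ 6" by (simp add: power_mult_distrib power_divide)
      also have "Q * (C * ((R / e) ^ 6 * t ^ 6)) = K1 * t ^ 6" by (simp add: K1_def)
      also have "\<dots> \<le> K * t ^ 6" unfolding K_def using nn pos by (intro mult_right_mono) auto
      finally show ?thesis using C nn by (simp add: mult_left_mono)
    next
      case False
      have "norm (branch_power a (\<gamma> t) \<xi>) \<le> (1 + norm \<xi> / e) powr a"
        using norm_branch_power_le[OF gamma_nz e(3)[OF xie(1)] e(1) a] .
      also have "\<dots> \<le> K2" unfolding K2_def using \<open>norm \<xi> \<le> R\<close> e a
        by (intro powr_mono2) (auto intro!: divide_right_mono add_nonneg_nonneg)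
      finally have 1: "norm (branch_power a (\<gamma> t) \<xi>) \<le> K2" .
      have "norm ?z \<le> R / e * 2" unfolding norm_mult using w norm_inv_gamma_diff(1)[of t] R e by (intro mult_mono) auto
      hence "norm (S ?z) \<le> (\<Sum>j<6. nb_coeff a j * (R / e * 2) ^ j)" by (rule S_le)
      hence 2: "norm ((1 - \<xi>) powr (- of_real a) * S ?z) \<le> K3"
        unfolding K3_def norm_mult using npw nn by (intro mult_mono) auto
      have "s ^ 6 \<le> \<bar>t\<bar> ^ 6" using False pos by (intro power_mono) auto
      hence t6: "1 \<le> t ^ 6 / s ^ 6" using pos by simp
      have "norm (branch_power a (\<gamma> t) \<xi> - (1 - \<xi>) powr (- of_real a) * S ?z) \<le> (K2 + K3) * 1"
        using 1 2 norm_triangle_ineq4[of "branch_power a (\<gamma> t) \<xi>" "(1 - \<xi>) powr (- of_real a) * S ?z"] by simp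
      also have "\<dots> \<le> (K2 + K3) * (t ^ 6 / s ^ 6)" using t6 nn by (intro mult_left_mono) auto
      also have "\<dots> = (K2 + K3) / s ^ 6 * t ^ 6" by simp
      also have "\<dots> \<le> K * t ^ 6" unfolding K_def using nn by (intro mult_right_mono) auto
      finally show ?thesis .
    qed
  qed
  have "K \<ge> 0" using nn pos by (simp add: K_def)
  moreover have "ball \<xi>0 e' \<subseteq> left_region" using e by (auto simp: e'_def)
  ultimately show thesis
    by (intro that[of e' K]) (use main pos in \<open>auto simp: S_def\<close>)
qed

section \<open>Centred moments and the expansion in region A\<close>

definition central_mom :: "nat \<Rightarrow> real \<Rightarrow> real" where
  "central_mom j b = (\<Sum>k\<le>j. of_nat (j choose k) * (b ^ k / pochhammer b k) * (-1) ^ (j - k))"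

lemma integral_centered:
  assumes b: "b \<ge> 8 / \<theta>"
  shows "integrable lborel (\<lambda>t. W b t * (inverse (\<gamma> t) - 1) ^ j)"
    and "(LINT t|lborel. W b t * (inverse (\<gamma> t) - 1) ^ j) = of_real (central_mom j b) * mom b 0"
proof -
  have eq: "W b t * (inverse (\<gamma> t) - 1) ^ j =
     (\<Sum>k\<le>j. of_nat (j choose k) * (-1) ^ (j - k) * (W b t * inverse (\<gamma> t) ^ k))" for t
    using binomial_ring[of "inverse (\<gamma> t)" "-1" j] by (simp add: sum_distrib_left mult_ac)
  show "integrable lborel (\<lambda>t. W b t * (inverse (\<gamma> t) - 1) ^ j)"
    unfolding eq by (intro Bochner_Integration.integrable_sum integrable_mult_right integrable_mom b)
  have "(LINT t|lborel. W b t * (inverse (\<gamma> t) - 1) ^ j) = (\<Sum>k\<le>j. of_nat (j choose k) * (-1) ^ (j - k) * mom b k)"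
    unfolding eq mom_def
    by (subst Bochner_Integration.integral_sum) (auto intro!: integrable_mult_right integrable_mom b)
  also have "\<dots> = (\<Sum>k\<le>j. of_nat (j choose k) * (-1) ^ (j - k) * (of_real (b ^ k / pochhammer b k) * mom b 0))"
    by (intro sum.cong refl) (subst mom_eq[OF b], simp)
  also have "\<dots> = of_real (central_mom j b) * mom b 0"
    unfolding central_mom_def of_real_sum sum_distrib_right by (intro sum.cong refl) (simp add: mult_ac)
  finally show "(LINT t|lborel. W b t * (inverse (\<gamma> t) - 1) ^ j) = of_real (central_mom j b) * mom b 0" .
qed

text \<open>The j-th centred moment decays at least like b^(-j/2), with the exponent rounded up to
  an integer. Hence j = 2, 3, 4 supply all coefficients through b^(-2), j = 5 goes into the error,
  and from j = 6 on the remainder estimate takes over.\<close>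

lemma central_mom_asymp:
  "eventually (\<lambda>b. central_mom 0 b = 1 \<and> central_mom 1 b = 0) at_top"
  "(\<lambda>b. central_mom 2 b + 1 / b - 1 / b^2) \<in> O(\<lambda>b. 1 / b^3)"
  "(\<lambda>b. central_mom 3 b - 4 / b^2) \<in> O(\<lambda>b. 1 / b^3)"
  "(\<lambda>b. central_mom 4 b - 3 / b^2) \<in> O(\<lambda>b. 1 / b^3)"
  "central_mom 5 \<in> O(\<lambda>b. 1 / b^3)"
proof -
  show "eventually (\<lambda>b. central_mom 0 b = 1 \<and> central_mom 1 b = 0) at_top"
    using eventually_gt_at_top[of 0] by eventually_elim (simp add: central_mom_def)
  have eq: "eventually (\<lambda>b. central_mom 2 b = b / (b + 1) - 1 \<and> central_mom 3 b = 2 - 3 * (b / (b + 1)) + b ^ 2 / ((b + 1) * (b + 2)) \<and>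
     central_mom 4 b = -3 + 6 * (b / (b + 1)) - 4 * (b ^ 2 / ((b + 1) * (b + 2))) + b ^ 3 / ((b + 1) * (b + 2) * (b + 3)) \<and>
     central_mom 5 b = 4 - 10 * (b / (b + 1)) + 10 * (b ^ 2 / ((b + 1) * (b + 2))) - 5 * (b ^ 3 / ((b + 1) * (b + 2) * (b + 3)))
        + b ^ 4 / ((b + 1) * (b + 2) * (b + 3) * (b + 4))) at_top"
    using eventually_gt_at_top[of 0]
  proof eventually_elim
    case (elim b)
    show ?case using elim
      by (simp add: central_mom_def numeral_eq_Suc pochhammer_Suc) (simp add: field_simps)
  qed
  have "(\<lambda>b. b / (b + 1) - 1 + 1 / b - 1 / b^2) \<in> O(\<lambda>b::real. 1 / b^3)" by real_asymp
  thus "(\<lambda>b. central_mom 2 b + 1 / b - 1 / b^2) \<in> O(\<lambda>b. 1 / b^3)"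
    by (rule landau_o.big.in_cong[THEN iffD2, rotated]) (use eq in \<open>auto elim: eventually_mono\<close>)
  have "(\<lambda>b. 2 - 3 * (b / (b + 1)) + b ^ 2 / ((b + 1) * (b + 2)) - 4 / b^2) \<in> O(\<lambda>b::real. 1 / b^3)" by real_asymp
  thus "(\<lambda>b. central_mom 3 b - 4 / b^2) \<in> O(\<lambda>b. 1 / b^3)"
    by (rule landau_o.big.in_cong[THEN iffD2, rotated]) (use eq in \<open>auto elim: eventually_mono\<close>)
  have "(\<lambda>b. -3 + 6 * (b / (b + 1)) - 4 * (b ^ 2 / ((b + 1) * (b + 2))) + b ^ 3 / ((b + 1) * (b + 2) * (b + 3)) - 3 / b^2)
     \<in> O(\<lambda>b::real. 1 / b^3)" by real_asymp
  thus "(\<lambda>b. central_mom 4 b - 3 / b^2) \<in> O(\<lambda>b. 1 / b^3)"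
    by (rule landau_o.big.in_cong[THEN iffD2, rotated]) (use eq in \<open>auto elim: eventually_mono\<close>)
  have "(\<lambda>b. 4 - 10 * (b / (b + 1)) + 10 * (b ^ 2 / ((b + 1) * (b + 2))) - 5 * (b ^ 3 / ((b + 1) * (b + 2) * (b + 3)))
        + b ^ 4 / ((b + 1) * (b + 2) * (b + 3) * (b + 4))) \<in> O(\<lambda>b::real. 1 / b^3)" by real_asymp
  thus "central_mom 5 \<in> O(\<lambda>b. 1 / b^3)"
    by (rule landau_o.big.in_cong[THEN iffD2, rotated]) (use eq in \<open>auto elim: eventually_mono\<close>)
qed

end

text \<open>The error constant is an argument, so that the estimate can be proved near each point
  with its own constant and passed to \<open>compact_uniform\<close>.\<close>

definition expansionA :: "real \<Rightarrow> real \<Rightarrow> real \<Rightarrow> complex \<Rightarrow> bool" where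
  "expansionA a C b \<xi> \<longleftrightarrow> (\<exists>R::complex. norm R \<le> C / b ^ 3 \<and>
        (let w = \<xi> / (1 - \<xi>) in
         hyp1F1 (of_real a) (of_real b) (of_real b * \<xi>) =
           (1 - \<xi>) powr (- of_real a) *
           (1 - of_real (a * (a + 1) / 2) * w ^ 2 / of_real b
              + (of_real (a * (a + 1) * (a + 2) * (a + 3) / 8) * w ^ 4
                 + of_real (2 * a * (a + 1) * (a + 2) / 3) * w ^ 3
                 + of_real (a * (a + 1) / 2) * w ^ 2) / of_real (b ^ 2)
              + R)))"

lemma bigo_powD:
  assumes "f \<in> O(\<lambda>b::real. 1 / b ^ n)"
  obtains C B where "C \<ge> 0" "\<And>b. b \<ge> B \<Longrightarrow> \<bar>f b\<bar> \<le> C / b ^ n"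
proof -
  obtain C where C: "C > 0" "eventually (\<lambda>b. norm (f b) \<le> C * norm (1 / b ^ n)) at_top"
    using assms by (elim landau_o.bigE)
  from C(2) eventually_gt_at_top[of 0] have "eventually (\<lambda>b. \<bar>f b\<bar> \<le> C / b ^ n) at_top"
    by eventually_elim simp
  then obtain B where "\<And>b. b \<ge> B \<Longrightarrow> \<bar>f b\<bar> \<le> C / b ^ n"
    by (auto simp: eventually_at_top_linorder)
  thus thesis using C(1) by (intro that[of C B]) auto
qed

context contour
begin

text \<open>Dividing by the zeroth moment \<open>N\<close> makes the main terms rational in b and
  turns the remainder integral into b^(-7/2)/b^(-1/2) = b^(-3). Pulling out (1 -
  \<open>\<xi>\<close>)^(-a) multiplies the error by |1 - \<open>\<xi>\<close>|^a, for which
  \<open>Q\<close> is a bound near \<open>\<xi>0\<close>.\<close>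

lemma expansionA_local:
  assumes a: "a > 0" and xi0: "\<xi>0 \<in> left_region"
  shows "\<exists>U C B. open U \<and> \<xi>0 \<in> U \<and> (\<forall>b\<ge>B. \<forall>\<xi>\<in>U. expansionA a C b \<xi>)"
proof -
  obtain e K where e: "e > 0" "ball \<xi>0 e \<subseteq> left_region" and K: "K \<ge> 0"
    and n1: "\<And>\<xi>. \<xi> \<in> ball \<xi>0 e \<Longrightarrow> norm (1 - \<xi>) \<ge> e"
    and bd: "\<And>\<xi> t. \<xi> \<in> ball \<xi>0 e \<Longrightarrow> norm (branch_power a (\<gamma> t) \<xi> - (1 - \<xi>) powr (- of_real a) *
      (\<Sum>j<6. of_real (nb_coeff a j) * (\<xi> / (1 - \<xi>) * (inverse (\<gamma> t) - 1)) ^ j)) \<le> K * t ^ 6"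
    by (rule branch_power_expansion[OF a xi0]) (rule that)
  obtain c Bc where c: "c > 0" "Bc > 0" "\<And>b. b \<ge> Bc \<Longrightarrow> norm (mom b 0) \<ge> c * b powr (-1/2)"
    by (rule mom_0_lower) (rule that)
  note CR = rem_const_nonneg remainder_bound
  obtain B0 where B0: "\<And>b. b \<ge> B0 \<Longrightarrow> central_mom 0 b = 1 \<and> central_mom 1 b = 0"
    using central_mom_asymp(1) unfolding eventually_at_top_linorder by blast
  obtain C2 B2 where C2: "C2 \<ge> 0" "\<And>b. b \<ge> B2 \<Longrightarrow> \<bar>central_mom 2 b + 1 / b - 1 / b^2\<bar> \<le> C2 / b ^ 3"
    by (rule bigo_powD[OF central_mom_asymp(2)]) (rule that)
  obtain C3 B3 where C3: "C3 \<ge> 0" "\<And>b. b \<ge> B3 \<Longrightarrow> \<bar>central_mom 3 b - 4 / b^2\<bar> \<le> C3 / b ^ 3"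
    by (rule bigo_powD[OF central_mom_asymp(3)]) (rule that)
  obtain C4 B4 where C4: "C4 \<ge> 0" "\<And>b. b \<ge> B4 \<Longrightarrow> \<bar>central_mom 4 b - 3 / b^2\<bar> \<le> C4 / b ^ 3"
    by (rule bigo_powD[OF central_mom_asymp(4)]) (rule that)
  obtain C5 B5 where C5: "C5 \<ge> 0" "\<And>b. b \<ge> B5 \<Longrightarrow> \<bar>central_mom 5 b\<bar> \<le> C5 / b ^ 3"
    by (rule bigo_powD[OF central_mom_asymp(5)]) (rule that)
  define R where "R = (norm \<xi>0 + e) / e"
  have R: "R \<ge> 0" using e by (simp add: R_def)
  have p: "nb_coeff a j \<ge> 0" for j using nb_coeff_pos[OF a, of j] by simp
  define Q where "Q = (norm (1 - \<xi>0) + e) powr a"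
  define C where "C = nb_coeff a 2 * R ^ 2 * C2 + nb_coeff a 3 * R ^ 3 * C3 + nb_coeff a 4 * R ^ 4 * C4 + nb_coeff a 5 * R ^ 5 * C5 + Q * (rem_const * K / c)"
  define B where "B = max 1 (max (8 / \<theta>) (max a (max Bc (max B0 (max B2 (max B3 (max B4 B5)))))))"
  have "expansionA a C b \<xi>" if b: "b \<ge> B" and xi: "\<xi> \<in> ball \<xi>0 e" for b \<xi>
  proof -
    have bs: "b \<ge> 1" "b \<ge> 8 / \<theta>" "b \<ge> a" "b \<ge> Bc" "b \<ge> B0" "b \<ge> B2" "b \<ge> B3" "b \<ge> B4" "b \<ge> B5"
      using b unfolding B_def by (simp_all only: max.bounded_iff)
    have xiL: "\<xi> \<in> left_region" using xi e by auto
    have nz: "1 - \<xi> \<noteq> 0" using n1[OF xi] e by auto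
    define w where "w = \<xi> / (1 - \<xi>)"
    define P where "P = (1 - \<xi>) powr (- of_real a)"
    define N where "N = mom b 0"
    have "c * b powr (-1/2) > 0" using c bs by simp
    hence N: "norm N \<ge> c * b powr (-1/2)" "N \<noteq> 0" using c(3)[OF bs(4)] unfolding N_def by auto
    have P: "P \<noteq> 0" using nz by (simp add: P_def)
    have wR: "norm w \<le> R"
    proof -
      have "norm \<xi> \<le> norm \<xi>0 + e" using xi norm_triangle_ineq2[of \<xi> \<xi>0] by (simp add: dist_norm norm_minus_commute)
      thus ?thesis unfolding w_def R_def norm_divide using n1[OF xi] e by (intro frac_le) auto
    qed
    have iP: "norm (inverse P) \<le> Q"
    proof -
      have "norm (inverse P) = norm (1 - \<xi>) powr a" using nz unfolding P_def powr_minus inverse_inverse_eq by (simp add: powr_def)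
      also have "norm (1 - \<xi>) \<le> norm (1 - \<xi>0) + e"
        using xi norm_triangle_ineq[of "1 - \<xi>0" "\<xi>0 - \<xi>"] by (simp add: dist_norm)
      hence "norm (1 - \<xi>) powr a \<le> Q" unfolding Q_def using a by (intro powr_mono2) auto
      finally show ?thesis .
    qed
    define D where "D = (\<lambda>t. branch_power a (\<gamma> t) \<xi> - P * (\<Sum>j<6. of_real (nb_coeff a j) * (w * (inverse (\<gamma> t) - 1)) ^ j))"
    have contD: "continuous_on UNIV D" unfolding D_def
      by (intro continuous_intros cont_branch_power xiL cont_gamma) auto
    define Er where "Er = (LINT t|lborel. W b t * D t)"
    have Er: "norm Er \<le> rem_const * K * b powr (-7/2)"
      unfolding Er_def by (rule CR(2)[OF bs(2) contD]) (use bd[OF xi] in \<open>simp add: D_def P_def w_def\<close>)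
    define S where "S = (\<Sum>j<6. of_real (nb_coeff a j) * w ^ j * of_real (central_mom j b))"
    have FN: "hyp1F1 (of_real a) (of_real b) (of_real b * \<xi>) * N = P * S * N + Er"
    proof -
      let ?T = "\<lambda>t. \<Sum>j<6. P * (of_real (nb_coeff a j) * w ^ j) * (W b t * (inverse (\<gamma> t) - 1) ^ j)"
      have intT: "integrable lborel ?T"
        by (intro Bochner_Integration.integrable_sum integrable_mult_right integral_centered bs)
      have intT_eq: "(LINT t|lborel. ?T t) = P * S * N"
      proof -
        have "(LINT t|lborel. ?T t) = (\<Sum>j<6. LINT t|lborel. P * (of_real (nb_coeff a j) * w ^ j) * (W b t * (inverse (\<gamma> t) - 1) ^ j))"
          by (rule Bochner_Integration.integral_sum) (intro integrable_mult_right integral_centered bs)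
        also have "\<dots> = (\<Sum>j<6. P * (of_real (nb_coeff a j) * w ^ j) * (of_real (central_mom j b) * N))"
          by (intro sum.cong refl) (simp only: integral_mult_right_zero integral_centered(2)[OF bs(2)] N_def)
        also have "\<dots> = P * S * N" unfolding S_def sum_distrib_left sum_distrib_right by (intro sum.cong refl) (simp add: mult_ac)
        finally show ?thesis .
      qed
      have T_eq: "?T t = W b t * (P * (\<Sum>j<6. of_real (nb_coeff a j) * (w * (inverse (\<gamma> t) - 1)) ^ j))" for t
        unfolding sum_distrib_left by (intro sum.cong refl) (simp only: power_mult_distrib mult_ac)
      have D_eq: "W b t * D t = W b t * branch_power a (\<gamma> t) \<xi> - ?T t" for t
        unfolding D_def T_eq by (rule right_diff_distrib)
      have intD: "integrable lborel (\<lambda>t. W b t * D t)"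
      proof -
        obtain e2 where e2: "e2 > 0" "\<And>\<xi>' t. \<xi>' \<in> cball \<xi> e2 \<Longrightarrow> norm (\<gamma> t - \<xi>') \<ge> e2"
          by (rule left_region_nbhd[OF xiL]) (rule that)
        have "\<xi> \<in> cball \<xi> e2" using e2(1) by simp
        hence "norm (branch_power a (\<gamma> t) \<xi>) \<le> (1 + norm \<xi> / e2) powr a" for t
          by (intro norm_branch_power_le[OF gamma_nz e2(2) e2(1) a])
        hence "integrable lborel (\<lambda>t. W b t * branch_power a (\<gamma> t) \<xi>)"
          by (rule integrable_W_mult[OF bs(2) cont_branch_power[OF xiL]])
        from Bochner_Integration.integrable_diff[OF this intT] show ?thesis
          unfolding D_eq .
      qed
      have "W b t * branch_power a (\<gamma> t) \<xi> = ?T t + W b t * D t" for t unfolding D_eq by simp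
      hence "(LINT t|lborel. W b t * branch_power a (\<gamma> t) \<xi>) = (LINT t|lborel. ?T t + W b t * D t)"
        by (rule Bochner_Integration.integral_cong[OF refl])
      also have "\<dots> = P * S * N + Er"
        unfolding Bochner_Integration.integral_add[OF intT intD] intT_eq Er_def by (rule refl)
      finally show ?thesis unfolding hyp1F1_contour[OF bs(2,3) a xiL] N_def .
    qed
    have F: "hyp1F1 (of_real a) (of_real b) (of_real b * \<xi>) = P * (S + inverse P * (Er / N))"
    proof -
      have "hyp1F1 (of_real a) (of_real b) (of_real b * \<xi>) = (P * S * N + Er) / N"
        unfolding nonzero_eq_divide_eq[OF N(2)] by (rule FN)
      also have "\<dots> = P * (S + inverse P * (Er / N))"
        using N(2) P by (simp add: add_divide_distrib distrib_left mult.assoc[symmetric])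
      finally show ?thesis .
    qed
    define T where "T = 1 - of_real (a * (a + 1) / 2) * w ^ 2 / of_real b
              + (of_real (a * (a + 1) * (a + 2) * (a + 3) / 8) * w ^ 4
                 + of_real (2 * a * (a + 1) * (a + 2) / 3) * w ^ 3
                 + of_real (a * (a + 1) / 2) * w ^ 2) / of_real (b ^ 2)"
    define d2 where "d2 = central_mom 2 b + 1 / b - 1 / b^2"
    define d3 where "d3 = central_mom 3 b - 4 / b^2"
    define d4 where "d4 = central_mom 4 b - 3 / b^2"
    have mus: "central_mom 2 b = d2 - 1 / b + 1 / b^2" "central_mom 3 b = d3 + 4 / b^2" "central_mom 4 b = d4 + 3 / b^2"
      by (simp_all add: d2_def d3_def d4_def)
    have ps: "nb_coeff a 0 = 1" "nb_coeff a 1 = a" "nb_coeff a 2 = a * (a + 1) / 2" "nb_coeff a 3 = a * (a + 1) * (a + 2) / 6" "nb_coeff a 4 = a * (a + 1) * (a + 2) * (a + 3) / 24"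
      by (simp_all add: nb_coeff_def pochhammer_Suc fact_reduce numeral_eq_Suc)
    have S_eq: "S = of_real (nb_coeff a 0) * of_real (central_mom 0 b) + of_real (nb_coeff a 1) * w * of_real (central_mom 1 b) + of_real (nb_coeff a 2) * w ^ 2 * of_real (central_mom 2 b)
            + of_real (nb_coeff a 3) * w ^ 3 * of_real (central_mom 3 b) + of_real (nb_coeff a 4) * w ^ 4 * of_real (central_mom 4 b) + of_real (nb_coeff a 5) * w ^ 5 * of_real (central_mom 5 b)"
    proof -
      have six: "{..<6::nat} = {0, 1, 2, 3, 4, 5}" by auto
      show ?thesis unfolding S_def six by (simp add: add_ac)
    qed
    define x where "x = complex_of_real (inverse b)"
    have central_mom_eq: "of_real (central_mom 2 b) = of_real d2 - x + x ^ 2" "of_real (central_mom 3 b) = of_real d3 + 4 * x ^ 2"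
      "of_real (central_mom 4 b) = of_real d4 + 3 * x ^ 2"
      unfolding mus x_def by (simp_all add: divide_inverse power_inverse)
    \<comment> \<open>The stated coefficients are binomial coefficients times the constants of the
      moments: -1 at b^(-1) and 1 at b^(-2) for j = 2, then 4 and 3 at b^(-2) for j = 3 and j =
      4.\<close>
    have T_eq: "T = 1 - of_real (nb_coeff a 2) * w ^ 2 * x + (3 * of_real (nb_coeff a 4) * w ^ 4
        + 4 * of_real (nb_coeff a 3) * w ^ 3 + of_real (nb_coeff a 2) * w ^ 2) * x ^ 2"
    proof -
      have 1: "u / of_real b = u * x" "u / of_real (b ^ 2) = u * x ^ 2" for u
        by (simp_all add: x_def divide_inverse power_inverse)
      have 2: "a * (a + 1) / 2 = nb_coeff a 2" "a * (a + 1) * (a + 2) * (a + 3) / 8 = 3 * nb_coeff a 4"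
        "2 * a * (a + 1) * (a + 2) / 3 = 4 * nb_coeff a 3"
        unfolding ps by simp_all
      show ?thesis unfolding T_def 1 2 by simp
    qed
    have "of_real (nb_coeff a 0) * of_real (central_mom 0 b) = (1::complex)" "of_real (central_mom 1 b) = (0::complex)"
      using B0[OF bs(5)] by (simp_all add: ps)
    hence ST: "S - T = of_real (nb_coeff a 2) * w ^ 2 * of_real d2 + of_real (nb_coeff a 3) * w ^ 3 * of_real d3
        + of_real (nb_coeff a 4) * w ^ 4 * of_real d4 + of_real (nb_coeff a 5) * w ^ 5 * of_real (central_mom 5 b)"
      unfolding S_eq T_eq central_mom_eq by (simp add: algebra_simps)
    have tm: "norm (of_real (nb_coeff a j) * w ^ j * of_real d) \<le> nb_coeff a j * R ^ j * (Cj / b ^ 3)" if "\<bar>d\<bar> \<le> Cj / b ^ 3" for j d Cj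
      unfolding norm_mult norm_power norm_of_real
      using wR p[of j] that R by (intro mult_mono power_mono) auto
    have "norm (S - T) \<le> nb_coeff a 2 * R ^ 2 * (C2 / b ^ 3) + nb_coeff a 3 * R ^ 3 * (C3 / b ^ 3) + nb_coeff a 4 * R ^ 4 * (C4 / b ^ 3) + nb_coeff a 5 * R ^ 5 * (C5 / b ^ 3)"
      unfolding ST using C2(2)[OF bs(6)] C3(2)[OF bs(7)] C4(2)[OF bs(8)] C5(2)[OF bs(9)]
      by (intro order.trans[OF norm_triangle_ineq] add_mono tm) (auto simp: d2_def d3_def d4_def)
    moreover have "norm (inverse P * (Er / N)) \<le> Q * (rem_const * K / c) / b ^ 3"
    proof -
      have "norm (Er / N) \<le> rem_const * K * b powr (-7/2) / (c * b powr (-1/2))"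
        unfolding norm_divide using Er N CR K \<open>c * b powr (-1/2) > 0\<close> by (intro frac_le) auto
      also have "\<dots> = rem_const * K / c * (b powr (-7/2) / b powr (-1/2))" by simp
      also have "b powr (-7/2) / b powr (-1/2) = b powr (-3)" using bs by (simp flip: powr_diff)
      also have "\<dots> = 1 / b ^ 3" using bs by (simp add: powr_minus divide_inverse)
      finally have "norm (Er / N) \<le> rem_const * K / c * (1 / b ^ 3)" .
      hence "norm (inverse P) * norm (Er / N) \<le> Q * (rem_const * K / c * (1 / b ^ 3))"
        using iP by (intro mult_mono) (auto simp: Q_def)
      thus ?thesis unfolding norm_mult by simp
    qed
    ultimately have "norm (S - T + inverse P * (Er / N)) \<le> C / b ^ 3"
      using norm_triangle_ineq[of "S - T" "inverse P * (Er / N)"] unfolding C_def by (simp add: add_divide_distrib)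
    moreover have "hyp1F1 (of_real a) (of_real b) (of_real b * \<xi>) = P * (T + (S - T + inverse P * (Er / N)))"
      unfolding F by simp
    ultimately show ?thesis unfolding expansionA_def Let_def w_def[symmetric] P_def[symmetric] T_def[symmetric] by blast
  qed
  thus ?thesis using e by (intro exI[of _ "ball \<xi>0 e"] exI[of _ C] exI[of _ B]) auto
qed

end

section \<open>Contours adapted to a point of region A\<close>

lemma height_mono:
  assumes "1 \<le> x" "x \<le> x'"
  shows "x - 1 - ln (x\<^sup>2 + t\<^sup>2) / 2 \<le> x' - 1 - ln (x'\<^sup>2 + t\<^sup>2) / (2::real)"
proof (rule DERIV_nonneg_imp_nondecreasing[OF assms(2)])
  fix y assume "x \<le> y" "y \<le> x'"
  hence y: "y \<ge> 1" using assms by simp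
  hence pos: "y\<^sup>2 + t\<^sup>2 > 0" by (intro add_pos_nonneg) auto
  \<comment> \<open>The derivative 1 - y/(y^2 + t^2) is nonnegative because y <= y^2 for y >= 1: to
    the right of Re u = 1, moving right raises |e^u/u|.\<close>
  have "y * 1 \<le> y * y" using y by (intro mult_left_mono) auto
  hence "y \<le> y\<^sup>2 + t\<^sup>2" using zero_le_power2[of t] unfolding power2_eq_square by linarith
  hence "y / (y\<^sup>2 + t\<^sup>2) \<le> 1" using pos by simp
  moreover have "((\<lambda>x. x - 1 - ln (x\<^sup>2 + t\<^sup>2) / 2) has_real_derivative 1 - y / (y\<^sup>2 + t\<^sup>2)) (at y)"
    using pos by (auto intro!: derivative_eq_intros simp: divide_simps) (simp_all add: algebra_simps)
  ultimately show "\<exists>z. ((\<lambda>x. x - 1 - ln (x\<^sup>2 + t\<^sup>2) / 2) has_real_derivative z) (at y) \<and> z \<ge> 0"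
    by (intro exI[of _ "1 - y / (y\<^sup>2 + t\<^sup>2)"]) auto
qed

lemma contour_line: "contour (\<lambda>_. 1) (\<lambda>_. 0) 0 1 1"
  by standard auto

text \<open>The line is bulged around height \<open>y0\<close> by a bump of height \<open>L\<close>,
  narrow enough to miss the saddle. By \<open>height_mono\<close> the level on the bump is at most
  its value at abscissa 1 + L, and near \<open>y0\<close> this stays below -\<open>\<kappa>\<close>
  by continuity. Off the bump the line's own bound holds; \<open>\<theta>\<close> is lowered until
  both fit.\<close>

lemma contour_bump:
  assumes y0: "y0 \<noteq> 0" and L: "L > 0" and neg: "1 + L - 1 - ln ((1 + L)\<^sup>2 + y0\<^sup>2) / 2 < 0"
  obtains \<rho> \<rho>' M \<theta> r where "contour \<rho> \<rho>' M \<theta> r" "\<rho> y0 = 1 + L"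
proof -
  define \<phi> where "\<phi> = (\<lambda>t. 1 + L - 1 - ln ((1 + L)\<^sup>2 + t\<^sup>2) / 2)"
  have pos: "(1 + L)\<^sup>2 + t\<^sup>2 > 0" for t using L by (intro add_pos_nonneg) auto
  have cont: "isCont \<phi> y0" unfolding \<phi>_def using pos[of y0] by (intro continuous_intros) auto
  have neg': "\<phi> y0 < 0" using neg by (simp only: \<phi>_def)
  define \<kappa> where "\<kappa> = - \<phi> y0 / 2"
  have kap: "\<kappa> > 0" "\<phi> y0 < - \<kappa>" using neg' by (auto simp: \<kappa>_def)
  with cont have "eventually (\<lambda>t. \<phi> t < - \<kappa>) (nhds y0)"
    by (intro order_tendstoD(2)) (simp_all add: isCont_def tendsto_at_iff_tendsto_nhds)
  then obtain d where d: "d > 0" "\<And>t. dist t y0 < d \<Longrightarrow> \<phi> t < - \<kappa>"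
    unfolding eventually_nhds_metric by blast
  \<comment> \<open>Half of the minimum keeps the bump strictly inside the range where
    \<open>\<phi>\<close> is below -\<open>\<kappa>\<close> and strictly away from t = 0.\<close>
  define \<delta> where "\<delta> = min d \<bar>y0\<bar> / 2"
  have del: "\<delta> > 0" "\<delta> < d" "\<delta> < \<bar>y0\<bar>" using d y0 by (auto simp: \<delta>_def min_def)
  define g where "g = (\<lambda>t. 1 - ((t - y0) / \<delta>)\<^sup>2)"
  \<comment> \<open>Squaring the positive part of the parabola makes the profile continuously
    differentiable at the edges of the bump.\<close>
  define \<rho> where "\<rho> = (\<lambda>t. 1 + L * (max 0 (g t))\<^sup>2)"
  define \<rho>' where "\<rho>' = (\<lambda>t. L * (2 * max 0 (g t) * (- 2 * (t - y0) / \<delta>\<^sup>2)))"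
  have sq: "((\<lambda>z::real. (max 0 z)\<^sup>2) has_real_derivative 2 * max 0 z) (at z)" for z
  proof (cases z "0::real" rule: linorder_cases)
    case less
    have "((\<lambda>_. 0) has_real_derivative 2 * max 0 z) (at z)" using less by simp
    thus ?thesis by (rule DERIV_cong_ev[THEN iffD1, OF refl _ refl, rotated])
      (use eventually_nhds_in_open[of "{..<0}" z] less in \<open>auto elim!: eventually_mono simp: max_def\<close>)
  next
    case greater
    have "((\<lambda>z. z\<^sup>2) has_real_derivative 2 * max 0 z) (at z)" using greater by (auto intro!: derivative_eq_intros)
    thus ?thesis by (rule DERIV_cong_ev[THEN iffD1, OF refl _ refl, rotated])
      (use eventually_nhds_in_open[of "{0<..}" z] greater in \<open>auto elim!: eventually_mono simp: max_def\<close>)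
  next
    case equal
    have "((\<lambda>h. (max 0 h)\<^sup>2 / h) \<longlongrightarrow> 0) (at (0::real))"
    proof (rule Lim_null_comparison)
      show "eventually (\<lambda>h::real. norm ((max 0 h)\<^sup>2 / h) \<le> \<bar>h\<bar>) (at 0)"
        by (intro always_eventually allI) (auto simp: max_def power2_eq_square)
      show "((\<lambda>h::real. \<bar>h\<bar>) \<longlongrightarrow> 0) (at 0)" by (auto intro!: tendsto_eq_intros)
    qed
    thus ?thesis using equal by (simp add: DERIV_def)
  qed
  have outside: "g t \<le> 0" if "\<bar>t - y0\<bar> \<ge> \<delta>" for t
  proof -
    have "1 \<le> (\<bar>t - y0\<bar> / \<delta>)\<^sup>2" using that del by (intro one_le_power) auto
    thus ?thesis by (simp add: g_def power_divide)
  qed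
  have gle: "g t \<le> 1" for t by (simp add: g_def)
  define m where "m = ln (1 + (\<bar>y0\<bar> + \<delta>)\<^sup>2)"
  have m: "m > 0" unfolding m_def using del by (intro ln_gt_zero) auto
  \<comment> \<open>On the bump ln(1 + t^2) is at most \<open>m\<close>, so the required decay there
    costs at most \<open>\<theta>\<close> m/2, which is at most \<open>\<kappa>\<close>. Off the
    bump, \<open>\<theta>\<close> at most 1 is what the line provides.\<close>
  define \<theta> where "\<theta> = min 1 (2 * \<kappa> / m)"
  have th: "\<theta> > 0" "\<theta> \<le> 1" "\<theta> * m \<le> 2 * \<kappa>" using m kap by (auto simp: \<theta>_def min_def field_simps)
  have "contour \<rho> \<rho>' (L * (2 * 1 * (2 * \<delta> / \<delta>\<^sup>2))) \<theta> (\<bar>y0\<bar> - \<delta>)"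
  proof
    fix t
    have "((\<lambda>t. (max 0 (g t))\<^sup>2) has_real_derivative 2 * max 0 (g t) * (- 2 * (t - y0) / \<delta>\<^sup>2)) (at t)"
      by (rule DERIV_chain2[OF sq]) (use del(1) in \<open>auto simp: g_def power2_eq_square field_simps intro!: derivative_eq_intros\<close>)
    from DERIV_add[OF DERIV_const[of 1] DERIV_cmult[OF this, of L]]
    show "(\<rho> has_real_derivative \<rho>' t) (at t)"
      unfolding \<rho>_def \<rho>'_def by simp
    show "1 \<le> \<rho> t" using L by (simp add: \<rho>_def)
    show "\<bar>\<rho>' t\<bar> \<le> L * (2 * 1 * (2 * \<delta> / \<delta>\<^sup>2))"
    proof (cases "\<bar>t - y0\<bar> < \<delta>")
      case True
      have "\<bar>- 2 * (t - y0)\<bar> = 2 * \<bar>t - y0\<bar>" unfolding abs_mult by simp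
      hence "\<bar>\<rho>' t\<bar> = L * (2 * max 0 (g t) * (2 * \<bar>t - y0\<bar> / \<delta>\<^sup>2))"
        using L unfolding \<rho>'_def abs_mult abs_divide by simp
      also have "\<dots> \<le> L * (2 * 1 * (2 * \<delta> / \<delta>\<^sup>2))" using True L gle[of t]
        by (intro mult_left_mono mult_mono divide_right_mono) auto
      finally show ?thesis .
    qed (use outside[of t] L del in \<open>simp add: \<rho>'_def\<close>)
    show "\<rho> t - 1 - ln ((\<rho> t)\<^sup>2 + t\<^sup>2) / 2 \<le> - \<theta> / 2 * ln (1 + t\<^sup>2)"
    proof (cases "\<bar>t - y0\<bar> < \<delta>")
      case True
      have "(max 0 (g t))\<^sup>2 \<le> 1" using gle[of t] by (intro power_le_one) auto
      hence "\<rho> t \<le> 1 + L" "1 \<le> \<rho> t" using L by (auto simp: \<rho>_def)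
      hence "\<rho> t - 1 - ln ((\<rho> t)\<^sup>2 + t\<^sup>2) / 2 \<le> \<phi> t" unfolding \<phi>_def by (intro height_mono)
      also have "\<dots> \<le> - \<kappa>" using d(2)[of t] True del by (simp add: dist_real_def)
      also have "\<dots> \<le> - (\<theta> * m / 2)" using th by simp
      also have "ln (1 + t\<^sup>2) \<le> m"
      proof -
        have "\<bar>t\<bar> \<le> \<bar>y0\<bar> + \<delta>" using True by linarith
        hence "t\<^sup>2 \<le> (\<bar>y0\<bar> + \<delta>)\<^sup>2" using del unfolding abs_le_square_iff[symmetric] by simp
        thus ?thesis unfolding m_def by (intro ln_mono) (auto intro: add_pos_nonneg)
      qed
      hence "- (\<theta> * m / 2) \<le> - \<theta> / 2 * ln (1 + t\<^sup>2)" using th by (simp add: mult_left_mono)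
      finally show ?thesis .
    next
      case False
      hence "\<rho> t = 1" using outside[of t] by (simp add: \<rho>_def)
      moreover have "\<theta> * ln (1 + t\<^sup>2) \<le> 1 * ln (1 + t\<^sup>2)" using th by (intro mult_right_mono) auto
      ultimately show ?thesis by simp
    qed
  next
    fix t assume "\<bar>t\<bar> < \<bar>y0\<bar> - \<delta>"
    hence "\<bar>t - y0\<bar> \<ge> \<delta>" by linarith
    from outside[OF this] show "\<rho> t = 1" "\<rho>' t = 0" by (simp_all add: \<rho>_def \<rho>'_def)
  next
    show "continuous_on UNIV \<rho>'" unfolding \<rho>'_def g_def using del by (intro continuous_intros) auto
  qed (use del th in auto)
  moreover have "\<rho> y0 = 1 + L" by (simp add: \<rho>_def g_def)
  ultimately show thesis by (rule that)
qed

text \<open>If Re \<open>\<xi>\<close> >= 1, the sign condition excludes real \<open>\<xi>\<close>,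
  since ln x <= x - 1; a bump at height Im \<open>\<xi>\<close> can therefore avoid the saddle. The
  condition is open, so the bump may reach a little past \<open>\<xi>\<close>.\<close>

lemma regionA_local:
  assumes a: "a > 0" and xi: "\<xi> \<in> regionA"
  shows "\<exists>U C B. open U \<and> \<xi> \<in> U \<and> (\<forall>b\<ge>B. \<forall>y\<in>U. expansionA a C b y)"
proof (cases "Re \<xi> < 1")
  case True
  interpret contour "\<lambda>_. 1" "\<lambda>_. 0" 0 1 1 by (rule contour_line)
  show ?thesis by (rule expansionA_local[OF a]) (use True in \<open>simp add: left_region_def\<close>)
next
  case False
  define \<phi> where "\<phi> = (\<lambda>x. x - 1 - ln (x\<^sup>2 + (Im \<xi>)\<^sup>2) / 2)"
  have neg: "\<phi> (Re \<xi>) < 0" using xi False by (simp add: regionA_def \<phi>_def)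
  have y0: "Im \<xi> \<noteq> 0"
  proof
    assume "Im \<xi> = 0"
    hence "\<phi> (Re \<xi>) = Re \<xi> - 1 - ln (Re \<xi>)" using False by (simp add: \<phi>_def ln_realpow)
    thus False using neg ln_le_minus_one[of "Re \<xi>"] False by simp
  qed
  have "isCont \<phi> (Re \<xi>)" unfolding \<phi>_def using False
    by (intro continuous_intros) (auto simp: add_nonneg_eq_0_iff)
  hence "eventually (\<lambda>x. \<phi> x < 0) (nhds (Re \<xi>))"
    using neg by (intro order_tendstoD(2)) (simp_all add: isCont_def tendsto_at_iff_tendsto_nhds)
  then obtain d where d: "d > 0" "\<And>x. dist x (Re \<xi>) < d \<Longrightarrow> \<phi> x < 0"
    unfolding eventually_nhds_metric by blast
  \<comment> \<open>The tip 1 + L lies d/2 to the right of \<open>\<xi>\<close>: strictly past it,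
    yet still below saddle level.\<close>
  define L where "L = Re \<xi> + d / 2 - 1"
  have "\<phi> (1 + L) < 0" using d(1) by (intro d(2)) (simp add: L_def dist_real_def)
  hence neg': "1 + L - 1 - ln ((1 + L)\<^sup>2 + (Im \<xi>)\<^sup>2) / 2 < 0" by (simp only: \<phi>_def)
  have "L > 0" using False d by (simp add: L_def)
  then obtain \<rho> \<rho>' M \<theta> r where c: "contour \<rho> \<rho>' M \<theta> r" "\<rho> (Im \<xi>) = 1 + L"
    by (rule contour_bump[OF y0 _ neg']) (rule that)
  interpret contour \<rho> \<rho>' M \<theta> r by (rule c)
  show ?thesis by (rule expansionA_local[OF a]) (use c d in \<open>simp add: left_region_def L_def\<close>)
qed

section \<open>Euler's integral and its saddle point\<close>

text \<open>With c = b - a the ratio is the k-th moment of the Beta distribution, the source of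
  (a)_k/(b)_k in Euler's integral.\<close>

lemma Beta_shift:
  assumes "a > 0" "c > (0::real)"
  shows "Beta c (a + real k) = Beta c a * (pochhammer a k / pochhammer (c + a) k)"
proof -
  have ni: "a \<notin> \<int>\<^sub>\<le>\<^sub>0" "c + a \<notin> \<int>\<^sub>\<le>\<^sub>0" using assms by (auto dest: nonpos_Ints_nonpos)
  have "Gamma a > 0" "Gamma (c + a) > 0" using assms by (auto intro: Gamma_real_pos)
  hence nz: "Gamma a \<noteq> 0" "Gamma (c + a) \<noteq> 0" by linarith+
  show ?thesis
    unfolding Beta_def pochhammer_Gamma[OF ni(1)] pochhammer_Gamma[OF ni(2)]
    using nz by (simp add: add_ac)
qed

text \<open>The exponential series is integrated term by term against the Beta weight. The variable
  is 1 minus the customary one, so that after scaling by \<open>\<xi>\<close> it becomes v, while 1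
  - s becomes \<open>\<xi>\<close> - v.\<close>

lemma euler_integral:
  assumes a: "a > 0" and b: "a < b"
  shows "((\<lambda>s. exp (z * of_real (1 - s)) * of_real (s powr (b - a - 1) * (1 - s) powr (a - 1))) has_integral
     hyp1F1 (of_real a) (of_real b) z * of_real (Beta (b - a) a)) {0..1}"
proof -
  define w where "w = (\<lambda>s. s powr (b - a - 1) * (1 - s) powr (a - 1))"
  define h where "h = (\<lambda>k s. indicator {0..1} s *\<^sub>R ((z ^ k / fact k) * of_real ((1 - s) ^ k * w s)))"
  have w_nonneg: "w s \<ge> 0" for s by (simp add: w_def)
  have mult: "(1 - s) ^ k * w s = s powr (b - a - 1) * (1 - s) powr (a + real k - 1)" if "s \<in> {0..1}" for s k
  proof (cases "s = 1")
    case False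
    hence "1 - s > 0" using that by simp
    moreover have "a + real k - 1 = real k + (a - 1)" by simp
    ultimately show ?thesis by (simp only: powr_add) (simp add: w_def powr_realpow)
  qed (simp add: w_def)
  have si: "set_integrable lborel {0..1} (\<lambda>s. (1 - s) ^ k * w s)" for k
    using integrable_Beta[of "b - a" "a + real k"] a b
    by (subst set_integrable_cong[OF refl refl mult]) auto
  have val: "(LINT s:{0..1}|lborel. (1 - s) ^ k * w s) = Beta (b - a) (a + real k)" for k
  proof -
    have "((\<lambda>s. (1 - s) ^ k * w s) has_integral Beta (b - a) (a + real k)) {0..1}"
      using has_integral_Beta_real[of "b - a" "a + real k"] a b
      by (subst has_integral_cong[OF mult]) auto
    thus ?thesis using set_borel_integral_eq_integral(2)[OF si] by (simp add: integral_unique)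
  qed
  have si': "set_integrable lborel {0..1} (\<lambda>s. complex_of_real ((1 - s) ^ k * w s))" for k
    using si[of k] unfolding set_integrable_def by (simp add: scaleR_conv_of_real flip: of_real_mult)
  have h_int: "integrable lborel (h k)" for k
    unfolding h_def using set_integrable_mult_right[OF si'[of k], of "z ^ k / fact k"] by (simp only: set_integrable_def)
  have h_val: "(LINT s|lborel. h k s) = (z ^ k / fact k) * of_real (Beta (b - a) (a + real k))" for k
  proof -
    have "(LINT s|lborel. h k s) = (LINT s:{0..1}|lborel. (z ^ k / fact k) * of_real ((1 - s) ^ k * w s))"
      unfolding h_def set_lebesgue_integral_def ..
    also have "\<dots> = (z ^ k / fact k) * (LINT s:{0..1}|lborel. of_real ((1 - s) ^ k * w s))"
      unfolding set_lebesgue_integral_def mult_scaleR_right[symmetric] by (rule integral_mult_right_zero)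
    also have "(LINT s:{0..1}|lborel. complex_of_real ((1 - s) ^ k * w s)) = of_real (LINT s:{0..1}|lborel. (1 - s) ^ k * w s)"
      by (rule set_integral_complex_of_real)
    finally show ?thesis by (simp only: val)
  qed
  have h_norm: "norm (h k s) \<le> (norm z ^ k / fact k) * (indicator {0..1} s * w s)" for k s
  proof (cases "s \<in> {0..1}")
    case True
    hence "(1 - s) ^ k * w s \<le> 1 * w s" by (intro mult_right_mono power_le_one w_nonneg) auto
    hence "(norm z ^ k / fact k) * ((1 - s) ^ k * w s) \<le> (norm z ^ k / fact k) * w s" by (intro mult_left_mono) auto
    thus ?thesis using True w_nonneg[of s] unfolding h_def norm_scaleR norm_mult norm_of_real norm_divide norm_power by (simp add: abs_mult)
  qed (simp add: h_def)
  have sm: "summable (\<lambda>k. norm z ^ k / fact k)"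
    using summable_exp[of "norm z"] by (simp add: divide_inverse mult.commute)
  have iw: "integrable lborel (\<lambda>s. indicator {0..1} s * w s)"
    using si[of 0] by (simp add: set_integrable_def)
  have ssum1: "AE s in lborel. summable (\<lambda>k. norm (h k s))"
    by (intro AE_I2 summable_comparison_test'[OF summable_mult2[OF sm]]) (use h_norm in auto)
  have ssum2: "summable (\<lambda>k. LINT s|lborel. norm (h k s))"
  proof (rule summable_comparison_test'[OF summable_mult2[OF sm]])
    fix k
    have "(LINT s|lborel. norm (h k s)) \<le> (LINT s|lborel. (norm z ^ k / fact k) * (indicator {0..1} s * w s))"
      by (intro integral_mono integrable_norm integrable_mult_right h_int iw h_norm)
    thus "norm (LINT s|lborel. norm (h k s)) \<le> (norm z ^ k / fact k) * (LINT s|lborel. indicator {0..1} s * w s)" by simp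
  qed
  have sums: "(\<lambda>k. LINT s|lborel. h k s) sums (LINT s|lborel. (\<Sum>k. h k s))"
    and isum: "integrable lborel (\<lambda>s. \<Sum>k. h k s)"
    by (rule sums_integral[OF h_int ssum1 ssum2], rule integrable_suminf[OF h_int ssum1 ssum2])
  have hsum: "(\<Sum>k. h k s) = indicator {0..1} s *\<^sub>R (exp (z * of_real (1 - s)) * of_real (w s))" for s
  proof -
    have "(\<lambda>k. (z * of_real (1 - s)) ^ k /\<^sub>R fact k) sums exp (z * of_real (1 - s))" by (rule exp_converges)
    hence "(\<lambda>k. indicator {0..1} s *\<^sub>R ((z * of_real (1 - s)) ^ k /\<^sub>R fact k * of_real (w s))) sums
      (indicator {0..1} s *\<^sub>R (exp (z * of_real (1 - s)) * of_real (w s)))"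
      by (intro sums_scaleR_right sums_mult2)
    also have "(\<lambda>k. indicator {0..1} s *\<^sub>R ((z * of_real (1 - s)) ^ k /\<^sub>R fact k * of_real (w s))) = (\<lambda>k. h k s)"
      by (simp add: h_def fun_eq_iff power_mult_distrib scaleR_conv_of_real divide_inverse mult_ac)
    finally show ?thesis by (rule sums_unique[symmetric])
  qed
  have "(\<lambda>k. LINT s|lborel. h k s) = (\<lambda>k. pochhammer (of_real a) k / pochhammer (of_real b) k * z ^ k / fact k * of_real (Beta (b - a) a))"
  proof
    fix k
    have "Beta (b - a) (a + real k) = Beta (b - a) a * (pochhammer a k / pochhammer b k)"
      using Beta_shift[of a "b - a" k] a b by simp
    hence "complex_of_real (Beta (b - a) (a + real k)) =
        of_real (Beta (b - a) a) * (pochhammer (of_real a) k / pochhammer (of_real b) k)"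
      by (simp only: of_real_mult of_real_divide pochhammer_of_real)
    thus "(LINT s|lborel. h k s) = pochhammer (of_real a) k / pochhammer (of_real b) k * z ^ k / fact k * of_real (Beta (b - a) a)"
      unfolding h_val by (simp add: mult_ac)
  qed
  moreover have "(\<lambda>k. pochhammer (of_real a) k / pochhammer (of_real b) k * z ^ k / fact k * of_real (Beta (b - a) a)) sums
      (hyp1F1 (of_real a) (of_real b) z * of_real (Beta (b - a) a))"
    using a b by (intro sums_mult2 hyp1F1_sums) auto
  ultimately have "(LINT s|lborel. (\<Sum>k. h k s)) = hyp1F1 (of_real a) (of_real b) z * of_real (Beta (b - a) a)"
    using sums by (simp only: sums_unique2)
  with has_integral_integral_lborel[OF isum]
  have "((\<lambda>s. indicator {0..1} s *\<^sub>R (exp (z * of_real (1 - s)) * of_real (w s))) has_integral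
     hyp1F1 (of_real a) (of_real b) z * of_real (Beta (b - a) a)) UNIV"
    by (simp only: hsum)
  hence "((\<lambda>s. if s \<in> {0..1} then exp (z * of_real (1 - s)) * of_real (w s) else 0) has_integral
     hyp1F1 (of_real a) (of_real b) z * of_real (Beta (b - a) a)) UNIV"
    by (rule has_integral_eq[rotated]) (simp add: indicator_def)
  thus ?thesis unfolding w_def by (simp only: has_integral_restrict_UNIV)
qed

text \<open>A positive real factor leaves the principal argument unchanged. If s or
  \<open>\<xi>\<close> is 0, both sides vanish by the convention that powers of 0 are 0.\<close>

lemma powr_nonneg_mult:
  assumes "s \<ge> 0"
  shows "(of_real s * \<xi>) powr of_real c = of_real (s powr c) * (\<xi> powr of_real c :: complex)"
proof (cases "s = 0 \<or> \<xi> = 0")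
  case False
  hence "s > 0" using assms by simp
  thus ?thesis using False
    by (simp add: powr_def Ln_times_of_real exp_add distrib_left Ln_of_real flip: exp_of_real)
qed auto

lemma norm_powr_of_real: "norm ((v::complex) powr of_real c) = norm v powr c"
  by (cases "v = 0") (simp_all add: powr_def)

section \<open>Deforming the path of Euler's integral\<close>

definition euler_fun :: "real \<Rightarrow> real \<Rightarrow> complex \<Rightarrow> complex \<Rightarrow> complex" where
  "euler_fun a b \<xi> v = exp (- of_real b * v) * v powr of_real (b - a - 1) * (\<xi> - v) powr of_real (a - 1)"

text \<open>Under v = s \<open>\<xi>\<close> the powers of \<open>\<xi>\<close> add up to (b - a -
  1) + (a - 1) + 1 = b - 1, the last summand coming from dv.\<close>

lemma euler_fun_scale:
  assumes "0 \<le> s" "s \<le> 1"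
  shows "euler_fun a b \<xi> (of_real s * \<xi>) * \<xi> =
    \<xi> powr of_real (b - 1) * (exp (- of_real b * \<xi> * of_real s) * of_real (s powr (b - a - 1) * (1 - s) powr (a - 1)))"
proof (cases "\<xi> = 0")
  case False
  have "\<xi> - of_real s * \<xi> = of_real (1 - s) * \<xi>" by (simp add: algebra_simps)
  hence 1: "(\<xi> - of_real s * \<xi>) powr of_real (a - 1) = of_real ((1 - s) powr (a - 1)) * \<xi> powr of_real (a - 1)"
    using powr_nonneg_mult[of "1 - s" \<xi> "a - 1"] assms by simp
  have 2: "(of_real s * \<xi>) powr of_real (b - a - 1) = of_real (s powr (b - a - 1)) * \<xi> powr of_real (b - a - 1)"
    by (rule powr_nonneg_mult[OF assms(1)])
  have "\<xi> powr of_real (b - a - 1) * \<xi> powr of_real (a - 1) * \<xi> powr 1 = \<xi> powr (of_real (b - a - 1) + of_real (a - 1) + 1)"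
    by (simp only: powr_add)
  also have "of_real (b - a - 1) + of_real (a - 1) + 1 = complex_of_real (b - 1)" by simp
  finally have 3: "\<xi> powr of_real (b - a - 1) * \<xi> powr of_real (a - 1) * \<xi> = \<xi> powr of_real (b - 1)"
    using False by simp
  show ?thesis unfolding euler_fun_def 1 2 3[symmetric] of_real_mult by (simp only: mult_ac)
qed simp

text \<open>In the triangle every point other than 0 has real part strictly between 0 and Re
  \<open>\<xi>\<close>, so neither v nor \<open>\<xi>\<close> - v meets its cut. At the vertex 0
  continuity comes from the positive exponent b - a - 1, hence the condition b > a + 1.\<close>

lemma euler_fun_cont:
  assumes xi: "Re \<xi> > 0" and lam: "0 < l" "l < 1" and b: "b > a + 1"
  shows "continuous_on (convex hull {0, of_real (l * Re \<xi>), of_real l * \<xi>}) (euler_fun a b \<xi>)"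
    and "v \<in> interior (convex hull {0, of_real (l * Re \<xi>), of_real l * \<xi>}) - {0} \<Longrightarrow> euler_fun a b \<xi> field_differentiable at v"
proof -
  let ?H = "convex hull {0, of_real (l * Re \<xi>), of_real l * \<xi>}"
  have lt: "l * Re \<xi> < Re \<xi>" using lam xi by simp
  have H: "v = 0 \<or> 0 < Re v \<and> Re v < Re \<xi>" if v: "v \<in> ?H" for v
  proof -
    obtain p q r where pqr: "0 \<le> p" "0 \<le> q" "0 \<le> r" "p + q + r = 1"
      and v: "v = p *\<^sub>R 0 + q *\<^sub>R of_real (l * Re \<xi>) + r *\<^sub>R (of_real l * \<xi>)"
      using v unfolding convex_hull_3 by blast
    have re: "Re v = (q + r) * (l * Re \<xi>)" unfolding v by (simp add: algebra_simps)
    show ?thesis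
    proof (cases "q + r = 0")
      case True
      hence "q = 0" "r = 0" using pqr by linarith+
      thus ?thesis using v by simp
    next
      case False
      hence "q + r > 0" using pqr by linarith
      hence "(q + r) * (l * Re \<xi>) > 0" using lam xi by (intro mult_pos_pos) auto
      moreover have "(q + r) * (l * Re \<xi>) \<le> 1 * (l * Re \<xi>)" using pqr lam xi by (intro mult_right_mono) auto
      ultimately show ?thesis using lt unfolding re by linarith
    qed
  qed
  have deriv: "euler_fun a b \<xi> field_differentiable at v" if "0 < Re v" "Re v < Re \<xi>" for v
  proof -
    have "v \<notin> \<real>\<^sub>\<le>\<^sub>0" "\<xi> - v \<notin> \<real>\<^sub>\<le>\<^sub>0" using that by (auto simp: complex_nonpos_Reals_iff)
    thus ?thesis unfolding euler_fun_def[abs_def] field_differentiable_def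
      by (auto intro!: exI derivative_eq_intros)
  qed
  show "continuous_on ?H (euler_fun a b \<xi>)"
  proof (rule continuous_on_eq_continuous_within[THEN iffD2], rule ballI)
    fix v assume v: "v \<in> ?H"
    show "continuous (at v within ?H) (euler_fun a b \<xi>)"
    proof (cases "v = 0")
      case False
      thus ?thesis using H[OF v] deriv[of v] by (auto intro: continuous_at_imp_continuous_at_within field_differentiable_imp_continuous_at)
    next
      case True
      have "((\<lambda>v::complex. norm v powr (b - a - 1)) \<longlongrightarrow> 0) (at 0 within ?H)"
        by (rule tendsto_zero_powrI) (use b in \<open>auto intro!: tendsto_eq_intros\<close>)
      hence "((\<lambda>v. norm (v powr complex_of_real (b - a - 1))) \<longlongrightarrow> 0) (at 0 within ?H)" by (simp only: norm_powr_of_real)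
      hence z: "((\<lambda>v. v powr complex_of_real (b - a - 1)) \<longlongrightarrow> 0) (at 0 within ?H)" by (rule tendsto_norm_zero_cancel)
      have "\<xi> \<notin> \<real>\<^sub>\<le>\<^sub>0" using xi by (auto simp: complex_nonpos_Reals_iff)
      hence "isCont (\<lambda>v. (\<xi> - v) powr complex_of_real (a - 1)) 0"
        by (intro continuous_intros) auto
      hence "((\<lambda>v. (\<xi> - v) powr complex_of_real (a - 1)) \<longlongrightarrow> (\<xi> - 0) powr of_real (a - 1)) (at 0 within ?H)"
        unfolding isCont_def by (rule tendsto_within_subset) auto
      moreover have "((\<lambda>v. exp (- of_real b * v)) \<longlongrightarrow> exp (- of_real b * 0)) (at (0::complex) within ?H)"
        by (intro tendsto_intros)
      ultimately have "(euler_fun a b \<xi> \<longlongrightarrow> exp (- of_real b * 0) * 0 * (\<xi> - 0) powr of_real (a - 1)) (at 0 within ?H)"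
        unfolding euler_fun_def[abs_def] by (intro tendsto_mult z)
      thus ?thesis unfolding continuous_within True by (simp add: euler_fun_def)
    qed
  qed
  show "euler_fun a b \<xi> field_differentiable at v" if "v \<in> interior ?H - {0}"
    using H[of v] deriv[of v] that interior_subset by blast
qed

lemma closed_segments_hull3:
  "closed_segment p q \<subseteq> convex hull {p, q, r}" "closed_segment q r \<subseteq> convex hull {p, q, r}" "closed_segment p r \<subseteq> convex hull {p, q, r}"
  unfolding segment_convex_hull by (auto intro!: hull_mono)

lemma of_real_in_segment:
  assumes "0 \<le> v" "v \<le> P"
  shows "complex_of_real v \<in> closed_segment 0 (of_real P)"
  unfolding in_segment using assms
  by (cases "P = 0") (auto simp: scaleR_conv_of_real intro!: exI[of _ "v / P"])

text \<open>Cauchy's theorem on the triangle, with the vertex 0 as exceptional point. The side from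
  0 to l \<open>\<xi>\<close> is the part s <= l of Euler's integral; the other two sides are the
  real segment and the vertical one.\<close>

lemma shift_contour:
  assumes xi: "Re \<xi> > 0" and lam: "0 < l" "l < 1" and b: "b > a + 1"
  shows "\<xi> powr of_real (b - 1) *
     integral {0..l} (\<lambda>s. exp (- of_real b * \<xi> * of_real s) * of_real (s powr (b - a - 1) * (1 - s) powr (a - 1))) =
     integral {0..l * Re \<xi>} (\<lambda>v. euler_fun a b \<xi> (of_real v)) +
     contour_integral (linepath (of_real (l * Re \<xi>)) (of_real l * \<xi>)) (euler_fun a b \<xi>)"
    and "euler_fun a b \<xi> contour_integrable_on (linepath (of_real (l * Re \<xi>)) (of_real l * \<xi>))"
    and "continuous_on {0..l * Re \<xi>} (\<lambda>v. euler_fun a b \<xi> (of_real v))"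
proof -
  let ?H = "convex hull {0, of_real (l * Re \<xi>), of_real l * \<xi>}"
  let ?p = "complex_of_real (l * Re \<xi>)" and ?q = "of_real l * \<xi>"
  let ?f = "euler_fun a b \<xi>"
  note cont = euler_fun_cont(1)[OF xi lam b]
  have int: "?f contour_integrable_on (linepath 0 ?p)" "?f contour_integrable_on (linepath ?p ?q)" "?f contour_integrable_on (linepath 0 ?q)"
    by (intro contour_integrable_continuous_linepath continuous_on_subset[OF cont] closed_segments_hull3)+
  show "?f contour_integrable_on (linepath ?p ?q)" by (rule int)
  have p: "0 < l * Re \<xi>" using xi lam by simp
  show "continuous_on {0..l * Re \<xi>} (\<lambda>v. ?f (of_real v))"
  proof (rule continuous_on_compose2[OF cont continuous_on_of_real_id])
    have "of_real v \<in> closed_segment 0 ?p" if "v \<in> {0..l * Re \<xi>}" for v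
      using of_real_in_segment[of v "l * Re \<xi>"] that by simp
    thus "of_real ` {0..l * Re \<xi>} \<subseteq> ?H" using closed_segments_hull3(1)[of 0 ?p ?q] by blast
  qed
  have "(?f has_contour_integral 0) (linepath 0 ?p +++ linepath ?p ?q +++ linepath ?q 0)"
    by (rule Cauchy_theorem_triangle_cofinite[OF cont, of "{0}"]) (use euler_fun_cont(2)[OF xi lam b] in auto)
  hence "contour_integral (linepath 0 ?p) ?f + contour_integral (linepath ?p ?q) ?f + contour_integral (linepath ?q 0) ?f = 0"
    by (rule has_chain_integral_chain_integral3)
  moreover have "contour_integral (linepath ?q 0) ?f = - contour_integral (linepath 0 ?q) ?f"
    using contour_integral_reverse_linepath[of 0 ?q ?f] continuous_on_subset[OF cont closed_segments_hull3(3)] by simp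
  ultimately have eq: "contour_integral (linepath 0 ?q) ?f = contour_integral (linepath 0 ?p) ?f + contour_integral (linepath ?p ?q) ?f"
    by (simp add: algebra_simps add_eq_0_iff2)
  have "contour_integral (linepath 0 ?p) ?f = integral {0..l * Re \<xi>} (\<lambda>v. ?f (of_real v))"
    using contour_integral_linepath_Reals_eq[of 0 ?p ?f] p by simp
  moreover have "contour_integral (linepath 0 ?q) ?f = \<xi> powr of_real (b - 1) *
     integral {0..l} (\<lambda>s. exp (- of_real b * \<xi> * of_real s) * of_real (s powr (b - a - 1) * (1 - s) powr (a - 1)))"
    (is "_ = _ * integral _ ?g")
  proof -
    have "contour_integral (linepath 0 ?q) ?f = integral {0..1} (\<lambda>u. ?f (linepath 0 ?q u) * (?q - 0))"
      using contour_integral_integral[of "linepath 0 ?q" ?f] by simp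
    also have "\<dots> = integral {0..1} (\<lambda>u. l *\<^sub>R (\<xi> powr of_real (b - 1) * ?g (l * u)))"
    proof (rule integral_cong)
      fix u :: real assume u: "u \<in> {0..1}"
      have "0 \<le> l * u" "l * u \<le> 1" using u lam by (auto intro: mult_le_one)
      from euler_fun_scale[OF this, of a b \<xi>]
      show "?f (linepath 0 ?q u) * (?q - 0) = l *\<^sub>R (\<xi> powr of_real (b - 1) * ?g (l * u))"
        by (simp add: linepath_def scaleR_conv_of_real mult_ac)
    qed
    also have "\<dots> = \<xi> powr of_real (b - 1) * (l *\<^sub>R integral {0..1} (\<lambda>u. ?g (l * u)))"
      by simp
    also have "l *\<^sub>R integral {0..1} (\<lambda>u. ?g (l * u)) = integral {0..l} ?g"
      using integral_stretch_real[of l 0 l ?g] lam by simp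
    finally show ?thesis .
  qed
  ultimately show "\<xi> powr of_real (b - 1) * integral {0..l} ?g = integral {0..l * Re \<xi>} (\<lambda>v. ?f (of_real v)) + contour_integral (linepath ?p ?q) ?f"
    using eq by simp
qed

section \<open>The Gamma weight on the real axis\<close>

definition gweight :: "real \<Rightarrow> real \<Rightarrow> real \<Rightarrow> real" where
  "gweight a b v = indicator {0..} v * (exp (- b * v) * v powr (b - a - 1))"

text \<open>Total mass of \<open>gweight\<close>, an unnormalised Gamma density of shape b - a and
  rate b.\<close>

definition gmass :: "real \<Rightarrow> real \<Rightarrow> real" where
  "gmass a b = Gamma (b - a) * b powr (a - b)"

text \<open>Normalised moments of that density about the saddle 1, not about its mean 1 - a/b; the
  first one is therefore -a/b instead of 0.\<close>

definition gmom :: "real \<Rightarrow> nat \<Rightarrow> real \<Rightarrow> real" where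
  "gmom a j b = (\<Sum>k\<le>j. of_nat (j choose k) * (-1) ^ (j - k) * (pochhammer (b - a) k / b ^ k))"

lemma gweight_nonneg: "gweight a b v \<ge> 0"
  by (simp add: gweight_def)

lemma gweight_measurable [measurable]: "gweight a b \<in> borel_measurable borel"
  unfolding gweight_def[abs_def] by measurable

text \<open>The substitution t = b v reduces the moment to the Gamma integral at s = b - a +
  k.\<close>

lemma gweight_moment:
  assumes b: "b > 0" "a < b"
  shows "has_bochner_integral lborel (\<lambda>v. gweight a b v * v ^ k) (gmass a b * (pochhammer (b - a) k / b ^ k))"
proof -
  define s where "s = b - a + real k"
  have s: "s > 0" using b by (simp add: s_def)
  define f where "f = (\<lambda>t. indicator {0..} t * t powr (s - 1) / exp t :: real)"
  have "has_bochner_integral lborel f (Gamma s)"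
  proof (rule has_bochner_integral_nn_integral)
    show "f \<in> borel_measurable lborel" unfolding f_def by measurable
    show "(\<integral>\<^sup>+ x. ennreal (f x) \<partial>lborel) = ennreal (Gamma s)"
      unfolding f_def by (rule Gamma_conv_nn_integral_real[OF s, symmetric])
    show "0 \<le> Gamma s" using s by (intro less_imp_le Gamma_real_pos)
  qed (simp add: f_def)
  hence f: "integrable lborel f" "(LINT t|lborel. f t) = Gamma s"
    by (simp_all add: has_bochner_integral_iff)
  have eq: "gweight a b v * v ^ k = b powr (1 - s) * f (0 + b * v)" for v
  proof (cases "v > 0")
    case True
    have "v powr (b - a - 1) * v ^ k = v powr (s - 1)"
      using True by (simp add: s_def powr_add[symmetric] powr_realpow[symmetric] algebra_simps)
    moreover have "b powr (1 - s) * (b * v) powr (s - 1) = v powr (s - 1)"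
      using True b by (simp add: powr_mult powr_add[symmetric])
    ultimately show ?thesis using True b
      by (simp add: gweight_def f_def exp_minus field_simps)
  next
    case False
    thus ?thesis using b by (cases "v = 0") (auto simp: gweight_def f_def indicator_def zero_le_mult_iff)
  qed
  have "integrable lborel (\<lambda>v. f (0 + b * v))" using b by (intro lborel_integrable_real_affine f) auto
  moreover have "(LINT v|lborel. f (0 + b * v)) = Gamma s / b"
    using lborel_integral_real_affine[of b f 0] b f by (simp add: field_simps)
  ultimately have "has_bochner_integral lborel (\<lambda>v. b powr (1 - s) * f (0 + b * v)) (b powr (1 - s) * (Gamma s / b))"
    by (intro has_bochner_integral_mult_right) (simp_all add: has_bochner_integral_iff)
  also have "b powr (1 - s) * (Gamma s / b) = gmass a b * (pochhammer (b - a) k / b ^ k)"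
  proof -
    have "b - a \<notin> \<int>\<^sub>\<le>\<^sub>0" using b by (auto dest: nonpos_Ints_nonpos)
    moreover have "Gamma (b - a) > 0" using b by (intro Gamma_real_pos) auto
    hence "Gamma (b - a) \<noteq> 0" by linarith
    ultimately have "Gamma s = Gamma (b - a) * pochhammer (b - a) k"
      unfolding s_def by (subst pochhammer_Gamma) auto
    moreover have "b powr (1 - s) / b = b powr (a - b) / b ^ k"
    proof -
      have "b powr (1 - s) / b powr 1 = b powr (a - b) / b powr real k"
        unfolding powr_diff[symmetric] s_def by (simp add: algebra_simps)
      thus ?thesis using b by (simp add: powr_realpow)
    qed
    moreover have "b powr (1 - s) * (Gamma s / b) = Gamma s * (b powr (1 - s) / b)" by simp
    ultimately show ?thesis by (simp only:) (simp add: gmass_def)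
  qed
  finally show ?thesis unfolding eq .
qed

lemma gweight_central:
  assumes b: "b > 0" "a < b"
  shows "has_bochner_integral lborel (\<lambda>v. gweight a b v * (v - 1) ^ j) (gmass a b * gmom a j b)"
proof -
  have eq: "gweight a b v * (v - 1) ^ j = (\<Sum>k\<le>j. of_nat (j choose k) * (-1) ^ (j - k) * (gweight a b v * v ^ k))" for v
    using binomial_ring[of v "-1" j] by (simp add: sum_distrib_left mult_ac)
  have "has_bochner_integral lborel (\<lambda>v. \<Sum>k\<le>j. of_nat (j choose k) * (-1) ^ (j - k) * (gweight a b v * v ^ k))
     (\<Sum>k\<le>j. of_nat (j choose k) * (-1) ^ (j - k) * (gmass a b * (pochhammer (b - a) k / b ^ k)))"
    by (intro has_bochner_integral_sum has_bochner_integral_mult_right gweight_moment b)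
  also have "(\<Sum>k\<le>j. of_nat (j choose k) * (-1) ^ (j - k) * (gmass a b * (pochhammer (b - a) k / b ^ k))) = gmass a b * gmom a j b"
    unfolding gmom_def sum_distrib_left by (intro sum.cong refl) (simp add: mult_ac)
  finally show ?thesis unfolding eq .
qed

text \<open>These moments are polynomials in 1/b. Orders 0 to 2 feed the stated correction, while
  orders 3 and 4 are already O(b^(-2)), the fourth controlling the Taylor remainder.\<close>

lemma gmom_eq:
  assumes "b > 0"
  shows "gmom a 0 b = 1" "gmom a 1 b = - a / b" "gmom a 2 b = 1 / b + (a\<^sup>2 - a) / b^2"
    "gmom a 3 b = (2 - 3 * a) / b^2 + (3 * a^2 - a^3 - 2 * a) / b^3"
    "gmom a 4 b = 3 / b^2 + (6 * a^2 - 14 * a + 6) / b^3 + (a^4 - 6 * a^3 + 11 * a^2 - 6 * a) / b^4"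
proof -
  show "gmom a 0 b = 1" by (simp add: gmom_def)
  show "gmom a 1 b = - a / b" using assms by (simp add: gmom_def field_simps)
  have 3: "{..3::nat} = {0, 1, 2, 3}" and 4: "{..4::nat} = {0, 1, 2, 3, 4}" and 2: "{..2::nat} = {0, 1, 2}" by auto
  have c: "3 choose 2 = (3::nat)" "4 choose 2 = (6::nat)" "4 choose 3 = (4::nat)" by (simp_all add: eval_nat_numeral)
  have p: "pochhammer (b - a) 2 = (b - a) * (b - a + 1)" "pochhammer (b - a) 3 = (b - a) * (b - a + 1) * (b - a + 2)"
    "pochhammer (b - a) 4 = (b - a) * (b - a + 1) * (b - a + 2) * (b - a + 3)"
    by (simp_all add: numeral_eq_Suc pochhammer_Suc)
  show "gmom a 2 b = 1 / b + (a\<^sup>2 - a) / b^2"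
    using assms unfolding gmom_def 2 by (simp add: p) (simp add: field_simps power2_eq_square)
  show "gmom a 3 b = (2 - 3 * a) / b^2 + (3 * a^2 - a^3 - 2 * a) / b^3"
    using assms unfolding gmom_def 3 by (simp add: p c) (simp add: field_simps power2_eq_square power3_eq_cube)
  show "gmom a 4 b = 3 / b^2 + (6 * a^2 - 14 * a + 6) / b^3 + (a^4 - 6 * a^3 + 11 * a^2 - 6 * a) / b^4"
    using assms unfolding gmom_def 4 by (simp add: p c) (simp add: field_simps power2_eq_square power3_eq_cube power4_eq_xxxx)
qed

section \<open>Estimates along the deformed path\<close>

lemma powr_le_ends:
  fixes t :: real
  assumes "0 < p" "p \<le> t" "t \<le> q"
  shows "t powr c \<le> p powr c + q powr c"
\<comment> \<open>The exponent may have either sign, so the maximum sits at one end or the other;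
  the sum of both end values covers both cases.\<close>
proof (cases "c \<ge> 0")
  case True
  hence "t powr c \<le> q powr c" using assms by (intro powr_mono2) auto
  thus ?thesis by (simp add: add_increasing)
next
  case False
  hence "t powr c \<le> p powr c" using assms by (intro powr_mono2') auto
  thus ?thesis by (simp add: add_increasing2)
qed

text \<open>
  The path leaves the real axis at \<open>l Re \<xi>\<close>; the factor \<open>l < 1\<close> keeps it away from the
  singularity of the integrand at \<open>\<xi>\<close>.
\<close>
definition admissible :: "real \<Rightarrow> real \<Rightarrow> real \<Rightarrow> complex \<Rightarrow> bool" where
  "admissible d \<kappa> l \<xi> \<longleftrightarrow> 0 < d \<and> 0 < \<kappa> \<and> 0 < l \<and> l < 1 \<and> 1 + d \<le> l * Re \<xi> \<and> d \<le> (1 - l) * Re \<xi> \<and> norm \<xi> \<le> 1 / d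
     \<and> 1 + \<kappa> \<le> l * Re \<xi> - ln (l * norm \<xi>)"

text \<open>Bound for |x|^(a-1) when |x| lies in [d, 2/d], whichever sign a - 1 has. With 2 - a in
  place of a it bounds the reciprocal power.\<close>

definition powr_bound :: "real \<Rightarrow> real \<Rightarrow> real" where
  "powr_bound a d = d powr (a - 1) + (2 / d) powr (a - 1)"

lemma admissibleD:
  assumes "admissible d \<kappa> l \<xi>"
  shows "Re \<xi> > 0" "Re \<xi> \<ge> 1 + d" "norm (\<xi> - 1) \<ge> d" "norm (\<xi> - 1) \<le> 2 / d" "norm \<xi> \<ge> 1"
proof -
  have c: "0 < d" "0 < l" "l < 1" "1 + d \<le> l * Re \<xi>" "norm \<xi> \<le> 1 / d" using assms by (auto simp: admissible_def)
  have "l * Re \<xi> > 0" using c by linarith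
  thus pos: "Re \<xi> > 0" using c by (simp add: zero_less_mult_iff)
  have "l * Re \<xi> \<le> 1 * Re \<xi>" using c pos by (intro mult_right_mono) auto
  thus re: "Re \<xi> \<ge> 1 + d" using c by linarith
  thus "norm (\<xi> - 1) \<ge> d" using complex_Re_le_cmod[of "\<xi> - 1"] by simp
  show n1: "norm \<xi> \<ge> 1" using re c complex_Re_le_cmod[of \<xi>] by linarith
  have "norm (\<xi> - 1) \<le> norm \<xi> + 1" using norm_triangle_ineq4[of \<xi> 1] by simp
  also have "\<dots> \<le> 1 / d + 1 / d" using c n1 by linarith
  finally show "norm (\<xi> - 1) \<le> 2 / d" by simp
qed

text \<open>Setting the factor to 0 beyond l Re \<open>\<xi>\<close> extends the real segment to the
  half-line, where the moments are known. For |v - 1| <= d/2 one has \<open>\<xi>\<close> - v =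
  (\<open>\<xi>\<close> - 1)(1 - z) with both factors in the right half-plane, so that their powers
  multiply; elsewhere (v - 1)^4 is bounded below and absorbs all terms.\<close>

lemma endpoint_factor_taylor:
  assumes d: "0 < d"
  shows "\<exists>C\<ge>0. \<forall>\<kappa> l \<xi> v. admissible d \<kappa> l \<xi> \<longrightarrow> v \<ge> 0 \<longrightarrow>
    norm ((if v \<le> l * Re \<xi> then (\<xi> - of_real v) powr of_real (a - 1) else 0) -
      (\<xi> - 1) powr of_real (a - 1) * (\<Sum>j<4. of_real (nb_coeff (1 - a) j) * (of_real (v - 1) / (\<xi> - 1)) ^ j)) \<le> C * (v - 1) ^ 4"
proof -
  obtain C0 where C0: "C0 \<ge> 0" "\<forall>z::complex. norm z \<le> 1/2 \<longrightarrow>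
    norm ((1 - z) powr (- of_real (1 - a)) - (\<Sum>j<4. of_real (nb_coeff (1 - a) j) * z ^ j)) \<le> C0 * norm z ^ 4"
    using binomial_remainder[of "1 - a" 4] by (elim exE conjE)
  define S where "S = (\<lambda>z::complex. \<Sum>j<4. of_real (nb_coeff (1 - a) j) * z ^ j)"
  define Q where "Q = powr_bound a d"
  define A where "A = (\<Sum>j<4. \<bar>nb_coeff (1 - a) j\<bar> * (1 / d) ^ j * (2 / d) ^ (4 - j))"
  define C where "C = Q * C0 / d ^ 4 + (Q * (2 / d) ^ 4 + Q * A)"
  have nn: "Q \<ge> 0" "A \<ge> 0" using d by (auto simp: Q_def powr_bound_def A_def intro!: sum_nonneg mult_nonneg_nonneg)
  have "norm ((if v \<le> l * Re \<xi> then (\<xi> - of_real v) powr of_real (a - 1) else 0) -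
      (\<xi> - 1) powr of_real (a - 1) * S (of_real (v - 1) / (\<xi> - 1))) \<le> C * (v - 1) ^ 4"
    if cond: "admissible d \<kappa> l \<xi>" and v: "v \<ge> 0" for \<kappa> l \<xi> v
  proof -
    have c: "0 < l" "l < 1" "1 + d \<le> l * Re \<xi>" "d \<le> (1 - l) * Re \<xi>" "norm \<xi> \<le> 1 / d" using cond by (auto simp: admissible_def)
    note D = admissibleD[OF cond]
    have nz: "\<xi> - 1 \<noteq> 0" using D d by auto
    let ?z = "of_real (v - 1) / (\<xi> - 1)"
    have q1: "norm ((\<xi> - 1) powr of_real (a - 1)) \<le> Q"
      unfolding norm_powr_of_real Q_def powr_bound_def using D d by (intro powr_le_ends) auto
    have z: "norm ?z \<le> \<bar>v - 1\<bar> / d" unfolding norm_divide norm_of_real using D d nz by (intro divide_left_mono mult_pos_pos) auto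
    show ?thesis
    proof (cases "\<bar>v - 1\<bar> \<le> d / 2")
      case True
      have "\<bar>v - 1\<bar> / d \<le> 1 / 2" using True d by (simp add: field_simps)
      hence z2: "norm ?z \<le> 1 / 2" using z by linarith
      have vl: "v \<le> l * Re \<xi>" using True c d by linarith
      have "Re ?z \<le> 1/2" using z2 complex_Re_le_cmod[of ?z] by linarith
      hence re: "Re (1 - ?z) > 0" by simp
      have nzz: "1 - ?z \<noteq> 0" by (metis re less_irrefl zero_complex.sel(1))
      have re1: "Re (\<xi> - 1) > 0" using D d by simp
      have "Ln ((\<xi> - 1) * (1 - ?z)) = Ln (\<xi> - 1) + Ln (1 - ?z)"
      proof (rule Ln_times_simple)
        have "\<bar>Im (Ln (\<xi> - 1))\<bar> < pi/2" "\<bar>Im (Ln (1 - ?z))\<bar> < pi/2"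
          unfolding Re_Ln_pos_lt[OF nz] Re_Ln_pos_lt[OF nzz] using re re1 by blast+
        thus "- pi < Im (Ln (\<xi> - 1)) + Im (Ln (1 - ?z))" "Im (Ln (\<xi> - 1)) + Im (Ln (1 - ?z)) \<le> pi" by linarith+
      qed (use nz nzz in auto)
      moreover have "(\<xi> - 1) * ?z = of_real (v - 1)" using nz by simp
      hence prod: "(\<xi> - 1) * (1 - ?z) = \<xi> - of_real v" by (simp only: right_diff_distrib) simp
      moreover have "\<xi> - of_real v \<noteq> 0" unfolding prod[symmetric] using nz nzz by simp
      ultimately have "(\<xi> - of_real v) powr of_real (a - 1) = (\<xi> - 1) powr of_real (a - 1) * (1 - ?z) powr of_real (a - 1)"
        using nz nzz unfolding powr_def by (simp only: if_False distrib_left exp_add)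
      hence "norm ((\<xi> - of_real v) powr of_real (a - 1) - (\<xi> - 1) powr of_real (a - 1) * S ?z) =
         norm ((\<xi> - 1) powr of_real (a - 1)) * norm ((1 - ?z) powr of_real (a - 1) - S ?z)"
        unfolding norm_mult[symmetric] right_diff_distrib by simp
      also have "\<dots> \<le> Q * (C0 * norm ?z ^ 4)"
        using C0(2)[rule_format, OF z2] nn unfolding S_def by (intro mult_mono q1) (simp_all add: minus_diff_eq)
      also have "\<dots> \<le> Q * (C0 * (\<bar>v - 1\<bar> / d) ^ 4)"
        using z nn C0(1) by (intro mult_left_mono power_mono) auto
      also have "\<dots> = Q * C0 / d ^ 4 * (v - 1) ^ 4" by (simp add: power_divide)
      also have "\<dots> \<le> C * (v - 1) ^ 4" unfolding C_def using nn d by (intro mult_right_mono) auto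
      finally show ?thesis using vl by simp
    next
      case False
      define u where "u = \<bar>v - 1\<bar>"
      have u: "u \<ge> d / 2" "u \<ge> 0" using False by (auto simp: u_def)
      \<comment> \<open>Away from the saddle 2u/d >= 1, so lower powers of u are absorbed into
        u^4.\<close>
      have upow: "u ^ j \<le> (2 / d) ^ (4 - j) * u ^ 4" if "j \<le> 4" for j
      proof -
        have "1 \<le> (2 / d * u) ^ (4 - j)" using u d by (intro one_le_power) (simp add: field_simps)
        hence "u ^ j * 1 \<le> u ^ j * (2 / d * u) ^ (4 - j)" using u by (intro mult_left_mono) auto
        also have "\<dots> = (2 / d) ^ (4 - j) * (u ^ j * u ^ (4 - j))" by (simp only: power_mult_distrib mult_ac)
        also have "u ^ j * u ^ (4 - j) = u ^ 4" using that by (simp flip: power_add)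
        finally show ?thesis by simp
      qed
      have 1: "norm (if v \<le> l * Re \<xi> then (\<xi> - of_real v) powr of_real (a - 1) else 0) \<le> Q"
      proof (cases "v \<le> l * Re \<xi>")
        case True
        have "Re (\<xi> - of_real v) \<ge> d" using True c by (simp add: algebra_simps)
        hence "norm (\<xi> - of_real v) \<ge> d" using complex_Re_le_cmod[of "\<xi> - of_real v"] by linarith
        moreover have "norm (\<xi> - of_real v) \<le> 2 / d"
        proof -
          have "v \<le> 1 * Re \<xi>" using True c D by (intro order.trans[OF True] mult_right_mono) auto
          hence "v \<le> 1 / d" using c complex_Re_le_cmod[of \<xi>] by linarith
          moreover have "norm (\<xi> - of_real v) \<le> norm \<xi> + v" using norm_triangle_ineq4[of \<xi> "of_real v"] v by simp
          ultimately show ?thesis using c by simp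
        qed
        ultimately show ?thesis unfolding if_P[OF True] norm_powr_of_real Q_def powr_bound_def using d by (intro powr_le_ends)
      qed (use nn in auto)
      have 2: "norm (S ?z) \<le> A * u ^ 4"
        unfolding S_def A_def sum_distrib_right
      proof (rule sum_norm_le)
        fix j :: nat assume "j \<in> {..<4}"
        hence j: "j \<le> 4" by simp
        have "norm (of_real (nb_coeff (1 - a) j) * ?z ^ j) = \<bar>nb_coeff (1 - a) j\<bar> * norm ?z ^ j"
          by (simp only: norm_mult norm_power norm_of_real)
        also have "\<dots> \<le> \<bar>nb_coeff (1 - a) j\<bar> * (u / d) ^ j"
          using z unfolding u_def by (intro mult_left_mono power_mono) auto
        also have "\<dots> = \<bar>nb_coeff (1 - a) j\<bar> * (1 / d) ^ j * u ^ j" by (simp add: power_divide)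
        also have "\<dots> \<le> \<bar>nb_coeff (1 - a) j\<bar> * (1 / d) ^ j * ((2 / d) ^ (4 - j) * u ^ 4)"
          using upow[OF j] d by (intro mult_left_mono) auto
        finally show "norm (of_real (nb_coeff (1 - a) j) * ?z ^ j) \<le> \<bar>nb_coeff (1 - a) j\<bar> * (1 / d) ^ j * (2 / d) ^ (4 - j) * u ^ 4"
          by (simp only: mult.assoc)
      qed
      have "norm ((\<xi> - 1) powr of_real (a - 1) * S ?z) \<le> Q * (A * u ^ 4)"
        unfolding norm_mult using q1 2 nn by (intro mult_mono) auto
      moreover have "Q * 1 \<le> Q * ((2 / d) ^ 4 * u ^ 4)" using upow[of 0] nn by (intro mult_left_mono) auto
      ultimately have "norm ((if v \<le> l * Re \<xi> then (\<xi> - of_real v) powr of_real (a - 1) else 0) - (\<xi> - 1) powr of_real (a - 1) * S ?z)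
         \<le> Q * ((2 / d) ^ 4 * u ^ 4) + Q * (A * u ^ 4)"
        using 1 by (intro order.trans[OF norm_triangle_ineq4] add_mono) auto
      also have "\<dots> = (Q * (2 / d) ^ 4 + Q * A) * u ^ 4" by (simp add: algebra_simps)
      also have "\<dots> \<le> C * u ^ 4" unfolding C_def using nn C0(1) d u by (intro mult_right_mono) auto
      also have "u ^ 4 = (v - 1) ^ 4" by (simp add: u_def)
      finally show ?thesis .
    qed
  qed
  moreover have "C \<ge> 0" using nn C0(1) d by (simp add: C_def)
  ultimately show ?thesis unfolding S_def by (intro exI[of _ C]) simp
qed

text \<open>Integrated against the weight, the pointwise error C (v - 1)^4 becomes the fourth
  moment. Besides a, the constant depends only on \<open>d\<close>, hence is common to all
  admissible points with that \<open>d\<close>.\<close>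

lemma segment_estimate:
  assumes d: "0 < d"
  shows "\<exists>C\<ge>0. \<forall>\<kappa> l \<xi> b. admissible d \<kappa> l \<xi> \<longrightarrow> b > 0 \<longrightarrow> b > a + 1 \<longrightarrow>
    norm (integral {0..l * Re \<xi>} (\<lambda>v. euler_fun a b \<xi> (of_real v)) -
      of_real (gmass a b) * ((\<xi> - 1) powr of_real (a - 1) *
        (\<Sum>j<4. of_real (nb_coeff (1 - a) j) * (1 / (\<xi> - 1)) ^ j * of_real (gmom a j b)))) \<le> C * (gmass a b * gmom a 4 b)"
proof -
  obtain C where C: "C \<ge> 0" "\<forall>\<kappa> l \<xi> v. admissible d \<kappa> l \<xi> \<longrightarrow> v \<ge> 0 \<longrightarrow>
    norm ((if v \<le> l * Re \<xi> then (\<xi> - of_real v) powr of_real (a - 1) else 0) -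
      (\<xi> - 1) powr of_real (a - 1) * (\<Sum>j<4. of_real (nb_coeff (1 - a) j) * (of_real (v - 1) / (\<xi> - 1)) ^ j)) \<le> C * (v - 1) ^ 4"
    using endpoint_factor_taylor[OF d, of a] by (elim exE conjE)
  have "norm (integral {0..l * Re \<xi>} (\<lambda>v. euler_fun a b \<xi> (of_real v)) -
      of_real (gmass a b) * ((\<xi> - 1) powr of_real (a - 1) *
        (\<Sum>j<4. of_real (nb_coeff (1 - a) j) * (1 / (\<xi> - 1)) ^ j * of_real (gmom a j b)))) \<le> C * (gmass a b * gmom a 4 b)"
    if cond: "admissible d \<kappa> l \<xi>" and b: "b > 0" "b > a + 1" for \<kappa> l \<xi> b
  proof -
    have c: "0 < l" "l < 1" using cond by (auto simp: admissible_def)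
    note D = admissibleD[OF cond]
    define P where "P = (\<xi> - 1) powr of_real (a - 1)"
    define F where "F = (\<lambda>v. indicator {0..l * Re \<xi>} v *\<^sub>R euler_fun a b \<xi> (of_real v))"
    define T where "T = (\<lambda>v. \<Sum>j<4. P * (of_real (nb_coeff (1 - a) j) * (1 / (\<xi> - 1)) ^ j) * of_real (gweight a b v * (v - 1) ^ j))"
    have ab: "a < b" using b by simp
    have set: "set_integrable lborel {0..l * Re \<xi>} (\<lambda>v. euler_fun a b \<xi> (of_real v))"
      by (intro borel_integrable_atLeastAtMost' shift_contour(3)[OF D(1) c b(2)])
    have F_int: "integrable lborel F" using set by (simp add: F_def set_integrable_def)
    have F_val: "(LINT v|lborel. F v) = integral {0..l * Re \<xi>} (\<lambda>v. euler_fun a b \<xi> (of_real v))"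
      using set_borel_integral_eq_integral(2)[OF set] by (simp add: F_def set_lebesgue_integral_def)
    note cen = gweight_central[OF b(1) ab]
    have cen': "has_bochner_integral lborel (\<lambda>v. complex_of_real (gweight a b v * (v - 1) ^ j)) (of_real (gmass a b * gmom a j b))" for j
      by (rule has_bochner_integral_bounded_linear[OF bounded_linear_of_real cen])
    have T_hbi: "has_bochner_integral lborel T (\<Sum>j<4. P * (of_real (nb_coeff (1 - a) j) * (1 / (\<xi> - 1)) ^ j) * of_real (gmass a b * gmom a j b))"
      unfolding T_def by (intro has_bochner_integral_sum has_bochner_integral_mult_right cen')
    have T_sum: "(\<Sum>j<4. P * (of_real (nb_coeff (1 - a) j) * (1 / (\<xi> - 1)) ^ j) * of_real (gmass a b * gmom a j b)) =
       of_real (gmass a b) * (P * (\<Sum>j<4. of_real (nb_coeff (1 - a) j) * (1 / (\<xi> - 1)) ^ j * of_real (gmom a j b)))"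
      unfolding sum_distrib_left of_real_mult by (intro sum.cong refl) (simp only: mult_ac)
    have T_int: "integrable lborel T" and T_val: "(LINT v|lborel. T v) = of_real (gmass a b) * (P * (\<Sum>j<4. of_real (nb_coeff (1 - a) j) * (1 / (\<xi> - 1)) ^ j * of_real (gmom a j b)))"
      using T_hbi unfolding T_sum by (simp_all only: has_bochner_integral_iff)
    have w4: "integrable lborel (\<lambda>v. C * (gweight a b v * (v - 1) ^ 4))" "(LINT v|lborel. C * (gweight a b v * (v - 1) ^ 4)) = C * (gmass a b * gmom a 4 b)"
      using has_bochner_integral_mult_right[OF cen[of 4], of C] by (simp_all only: has_bochner_integral_iff)
    have le: "norm (F v - T v) \<le> C * (gweight a b v * (v - 1) ^ 4)" for v
    proof (cases "v \<ge> 0")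
      case True
      let ?h = "if v \<le> l * Re \<xi> then (\<xi> - of_real v) powr of_real (a - 1) else 0"
      have "complex_of_real v powr of_real (b - a - 1) = of_real (v powr (b - a - 1))"
        using True powr_of_real[of v "b - a - 1"] by simp
      hence "F v = of_real (gweight a b v) * ?h"
        using True by (simp add: F_def gweight_def euler_fun_def exp_of_real[symmetric] indicator_def del: of_real_diff)
      moreover have "T v = of_real (gweight a b v) * (P * (\<Sum>j<4. of_real (nb_coeff (1 - a) j) * (of_real (v - 1) / (\<xi> - 1)) ^ j))"
        unfolding T_def sum_distrib_left of_real_mult of_real_power
        by (intro sum.cong refl) (simp only: power_divide power_one mult_ac times_divide_eq_right times_divide_eq_left mult_1)
      ultimately have "norm (F v - T v) = gweight a b v * norm (?h - P * (\<Sum>j<4. of_real (nb_coeff (1 - a) j) * (of_real (v - 1) / (\<xi> - 1)) ^ j))"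
        using gweight_nonneg[of a b v] by (simp only: right_diff_distrib[symmetric] norm_mult norm_of_real abs_of_nonneg)
      also have "\<dots> \<le> gweight a b v * (C * (v - 1) ^ 4)"
        unfolding P_def by (intro mult_left_mono C(2)[rule_format, OF cond True] gweight_nonneg)
      finally show ?thesis by (simp only: mult_ac)
    next
      case False
      hence "F v = 0" "gweight a b v = 0" by (auto simp: F_def gweight_def)
      thus ?thesis by (simp add: T_def)
    qed
    have "norm ((LINT v|lborel. F v) - (LINT v|lborel. T v)) = norm (LINT v|lborel. F v - T v)"
      using F_int T_int by (subst Bochner_Integration.integral_diff) auto
    also have "\<dots> \<le> (LINT v|lborel. C * (gweight a b v * (v - 1) ^ 4))"
      by (intro Bochner_Integration.integral_norm_bound_integral Bochner_Integration.integrable_diff F_int T_int w4(1) le)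
    finally show ?thesis unfolding F_val T_val w4(2) P_def .
  qed
  thus ?thesis using C(1) by (intro exI[of _ C]) simp
qed

text \<open>Exponentiated form of the last condition in \<open>admissible\<close>. The weight at the
  saddle is e^(-b), so \<open>\<kappa>\<close> measures the exponential gain.\<close>

lemma height_power:
  fixes l n \<kappa> lx b :: real
  assumes "0 < l" "0 < n" "1 + \<kappa> \<le> lx - ln (l * n)" "b \<ge> 0"
  shows "exp (- b * lx) * (l * n) powr b \<le> exp (- b * (1 + \<kappa>))"
proof -
  have "b * (1 + \<kappa>) \<le> b * (lx - ln (l * n))" using assms by (intro mult_left_mono) auto
  hence "- b * lx + b * ln (l * n) \<le> - b * (1 + \<kappa>)" by (simp add: algebra_simps)
  thus ?thesis using assms by (simp add: powr_def flip: exp_add)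
qed

text \<open>On the vertical segment |e^(-bv)| is constant and |v| is largest at l
  \<open>\<xi>\<close>, the point that \<open>admissible\<close> controls. Since |v| >= 1, the
  exponent b - a - 1 may be raised to b; the distance to \<open>\<xi>\<close> stays in
  [d, 2/d].\<close>

lemma vertical_bound:
  assumes cond: "admissible d \<kappa> l \<xi>" and b: "b > 0" "b > a + 1" and a: "a > 0"
  shows "norm (contour_integral (linepath (of_real (l * Re \<xi>)) (of_real l * \<xi>)) (euler_fun a b \<xi>)) \<le> powr_bound a d * exp (- b * (1 + \<kappa>)) * (1 / d)"
proof -
  have c: "0 < d" "0 < \<kappa>" "0 < l" "l < 1" "1 + d \<le> l * Re \<xi>" "d \<le> (1 - l) * Re \<xi>" "norm \<xi> \<le> 1 / d"
    "1 + \<kappa> \<le> l * Re \<xi> - ln (l * norm \<xi>)" using cond by (auto simp: admissible_def)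
  note D = admissibleD[OF cond]
  let ?p = "complex_of_real (l * Re \<xi>)" and ?q = "of_real l * \<xi>"
  define B where "B = powr_bound a d * exp (- b * (1 + \<kappa>))"
  have B0: "B \<ge> 0" using c by (simp add: B_def powr_bound_def)
  have bd: "norm (euler_fun a b \<xi> v) \<le> B" if v: "v \<in> closed_segment ?p ?q" for v
  proof -
    obtain u where u: "0 \<le> u" "u \<le> 1" "v = (1 - u) *\<^sub>R ?p + u *\<^sub>R ?q" using v by (auto simp: in_segment)
    have re: "Re v = l * Re \<xi>" unfolding u(3) by (simp add: algebra_simps)
    have im: "Im v = u * (l * Im \<xi>)" unfolding u(3) by simp
    have "\<bar>Im v\<bar> \<le> \<bar>l * Im \<xi>\<bar>" unfolding im abs_mult[of u] using u by (intro mult_left_le_one_le) auto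
    hence "(Im v)\<^sup>2 \<le> (l * Im \<xi>)\<^sup>2" by (simp only: abs_le_square_iff)
    hence "norm v \<le> norm ?q" unfolding cmod_def re by (intro real_sqrt_le_mono) simp
    hence n: "norm v \<le> l * norm \<xi>" using c by (simp add: norm_mult)
    have n1: "norm v \<ge> 1" using complex_Re_le_cmod[of v] re c by linarith
    have "l * norm \<xi> \<le> 1 * norm \<xi>" using c by (intro mult_right_mono) auto
    hence n2: "norm v \<le> 1 / d" using n c by linarith
    have "Re (\<xi> - v) \<ge> d" using re c by (simp add: algebra_simps)
    hence m1: "norm (\<xi> - v) \<ge> d" using complex_Re_le_cmod[of "\<xi> - v"] by linarith
    have "norm (\<xi> - v) \<le> 1 / d + 1 / d" using norm_triangle_ineq4[of \<xi> v] n2 c by linarith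
    hence h: "norm (\<xi> - v) powr (a - 1) \<le> powr_bound a d" unfolding powr_bound_def using m1 c by (intro powr_le_ends) auto
    have "norm v powr (b - a - 1) \<le> norm v powr b" using n1 a by (intro powr_mono) auto
    also have "\<dots> \<le> (l * norm \<xi>) powr b" using n n1 b by (intro powr_mono2) auto
    finally have "exp (- b * (l * Re \<xi>)) * norm v powr (b - a - 1) \<le> exp (- b * (l * Re \<xi>)) * (l * norm \<xi>) powr b"
      by (intro mult_left_mono) auto
    also have "\<dots> \<le> exp (- b * (1 + \<kappa>))"
      using c D b by (intro height_power) auto
    finally have e: "exp (- b * (l * Re \<xi>)) * norm v powr (b - a - 1) \<le> exp (- b * (1 + \<kappa>))" .
    have "norm (euler_fun a b \<xi> v) = exp (- b * (l * Re \<xi>)) * norm v powr (b - a - 1) * norm (\<xi> - v) powr (a - 1)"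
      unfolding euler_fun_def norm_mult norm_powr_of_real norm_exp_eq_Re by (simp add: re)
    also have "\<dots> \<le> exp (- b * (1 + \<kappa>)) * powr_bound a d" by (intro mult_mono e h) auto
    finally show ?thesis by (simp only: B_def mult_ac)
  qed
  have "norm (contour_integral (linepath ?p ?q) (euler_fun a b \<xi>)) \<le> B * norm (?q - ?p)"
    by (rule has_contour_integral_bound_linepath[OF has_contour_integral_integral[OF shift_contour(2)[OF D(1) c(3,4) b(2)]] B0 bd])
  also have "norm (?q - ?p) \<le> 1 / d"
  proof -
    have "?q - ?p = of_real l * (\<i> * of_real (Im \<xi>))" by (simp add: complex_eq_iff)
    hence "norm (?q - ?p) = l * \<bar>Im \<xi>\<bar>" using c by (simp only: norm_mult norm_of_real norm_ii mult_1 abs_of_pos)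
    also have "\<dots> \<le> 1 * norm \<xi>" using c abs_Im_le_cmod[of \<xi>] by (intro mult_mono) auto
    finally show ?thesis using c by simp
  qed
  hence "B * norm (?q - ?p) \<le> B * (1 / d)" using B0 by (intro mult_left_mono)
  finally show ?thesis by (simp only: B_def)
qed

text \<open>Along the ray, s Re \<open>\<xi>\<close> - ln(s |\<open>\<xi>\<close>|) increases for s
  >= l because l Re \<open>\<xi>\<close> >= 1, so the bound at s = l persists up to the endpoint.
  The possible singularity (1 - s)^(a-1) is kept inside a Beta integral.\<close>

lemma tail_bound:
  assumes cond: "admissible d \<kappa> l \<xi>" and b: "b > 0" "b > a + 1" and a: "a > 0"
    and int: "(\<lambda>s. exp (- of_real b * \<xi> * of_real s) * of_real (s powr (b - a - 1) * (1 - s) powr (a - 1))) integrable_on {l..1}"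
  shows "norm (\<xi> powr of_real (b - 1) *
     integral {l..1} (\<lambda>s. exp (- of_real b * \<xi> * of_real s) * of_real (s powr (b - a - 1) * (1 - s) powr (a - 1))))
     \<le> l powr (- a - 2) * Beta 2 a * exp (- b * (1 + \<kappa>))"
proof -
  have c: "0 < d" "0 < \<kappa>" "0 < l" "l < 1" "1 + d \<le> l * Re \<xi>" "d \<le> (1 - l) * Re \<xi>" "norm \<xi> \<le> 1 / d"
    "1 + \<kappa> \<le> l * Re \<xi> - ln (l * norm \<xi>)" using cond by (auto simp: admissible_def)
  note D = admissibleD[OF cond]
  let ?g = "\<lambda>s. exp (- of_real b * \<xi> * of_real s) * complex_of_real (s powr (b - a - 1) * (1 - s) powr (a - 1))"
  let ?\<beta> = "\<lambda>s. s powr (2 - 1) * (1 - s) powr (a - 1)"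
  define A where "A = l powr (- a - 2) * exp (- b * (1 + \<kappa>))"
  have A0: "A \<ge> 0" by (simp add: A_def)
  have beta: "(?\<beta> has_integral Beta 2 a) {0..1}" using a by (intro has_integral_Beta_real) auto
  have beta_l: "?\<beta> integrable_on {l..1}" using c by (intro integrable_on_subinterval[OF has_integral_integrable[OF beta]]) auto
  have le: "norm (\<xi> powr of_real (b - 1) * ?g s) \<le> A * ?\<beta> s" if s: "s \<in> {l..1}" for s
  proof -
    have s0: "s > 0" "l \<le> s" "s \<le> 1" using s c by auto
    have "ln (s / l) \<le> s / l - 1" using s0 c by (intro ln_le_minus_one) auto
    moreover have "(s / l - 1) * 1 \<le> (s / l - 1) * (l * Re \<xi>)" using s0 c by (intro mult_left_mono) auto
    moreover have "(s / l - 1) * (l * Re \<xi>) = s * Re \<xi> - l * Re \<xi>" using c by (simp add: field_simps)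
    ultimately have "ln (s / l) \<le> s * Re \<xi> - l * Re \<xi>" by simp
    moreover have "\<xi> \<noteq> 0" using D(5) by force
    hence "ln (s / l) = ln (s * norm \<xi>) - ln (l * norm \<xi>)"
      using s0 c by (simp add: ln_div ln_mult)
    ultimately have "1 + \<kappa> \<le> s * Re \<xi> - ln (s * norm \<xi>)" using c(8) by linarith
    moreover have "norm \<xi> > 0" using D by linarith
    ultimately have h: "exp (- b * (s * Re \<xi>)) * (s * norm \<xi>) powr b \<le> exp (- b * (1 + \<kappa>))"
      using s0 b by (intro height_power) auto
    have n1: "norm \<xi> powr (b - 1) \<le> norm \<xi> powr b" using D by (intro powr_mono) auto
    \<comment> \<open>One factor s is held back, so that what remains is the Beta integrand with
      parameters 2 and a; s^(-a-2) is bounded by its value at l.\<close>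
    have "s powr (b - a - 1) = s powr b * s powr (- a - 2) * s powr 1"
      unfolding powr_add[symmetric] by simp
    also have "\<dots> \<le> s powr b * l powr (- a - 2) * s powr 1"
      using s0 c a by (intro mult_right_mono mult_left_mono powr_mono2') auto
    finally have p: "s powr (b - a - 1) \<le> s powr b * l powr (- a - 2) * s powr 1" .
    have "norm (\<xi> powr of_real (b - 1) * ?g s) = norm \<xi> powr (b - 1) * (exp (- b * (s * Re \<xi>)) * (s powr (b - a - 1) * (1 - s) powr (a - 1)))"
      unfolding norm_mult norm_powr_of_real norm_exp_eq_Re norm_of_real by (simp add: mult_ac)
    also have "\<dots> \<le> norm \<xi> powr b * (exp (- b * (s * Re \<xi>)) * ((s powr b * l powr (- a - 2) * s powr 1) * (1 - s) powr (a - 1)))"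
      by (intro mult_mono n1 p mult_nonneg_nonneg) auto
    also have "\<dots> = (exp (- b * (s * Re \<xi>)) * (s * norm \<xi>) powr b) * (l powr (- a - 2) * ?\<beta> s)"
      using s0 by (simp add: powr_mult)
    also have "\<dots> \<le> exp (- b * (1 + \<kappa>)) * (l powr (- a - 2) * ?\<beta> s)"
      by (intro mult_right_mono h) auto
    finally show ?thesis by (simp only: A_def mult_ac)
  qed
  have "norm (integral {l..1} (\<lambda>s. \<xi> powr of_real (b - 1) * ?g s)) \<le> integral {l..1} (\<lambda>s. A * ?\<beta> s)"
    by (rule Henstock_Kurzweil_Integration.integral_norm_bound_integral[OF integrable_on_mult_right[OF int] integrable_on_mult_right[OF beta_l] le])
  also have "integral {l..1} (\<lambda>s. A * ?\<beta> s) = A * integral {l..1} ?\<beta>"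
    by (rule Henstock_Kurzweil_Integration.integral_mult_right)
  also have "\<dots> \<le> A * Beta 2 a"
  proof (intro mult_left_mono A0)
    have "integral {l..1} ?\<beta> \<le> integral {0..1} ?\<beta>"
      using c beta_l has_integral_integrable[OF beta] by (intro integral_subset_le) auto
    thus "integral {l..1} ?\<beta> \<le> Beta 2 a" using beta by (simp only: integral_unique)
  qed
  finally show ?thesis
    unfolding Henstock_Kurzweil_Integration.integral_mult_right A_def by (simp only: mult_ac)
qed

text \<open>The window from 1 to 1 + \<open>\<rho>\<close> alone yields this bound, since v^(b-a-1)
  >= 1 there. It calibrates exponentially small terms against the mass.\<close>

lemma gmass_lower:
  assumes b: "b > 0" "b > a + 1" and rho: "\<rho> > 0"
  shows "\<rho> * exp (- b * (1 + \<rho>)) \<le> gmass a b"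
proof -
  have w: "integrable lborel (gweight a b)" "(LINT v|lborel. gweight a b v) = gmass a b"
    using gweight_moment[of b a 0] b by (simp_all add: has_bochner_integral_iff)
  have i: "integrable lborel (\<lambda>v. exp (- b * (1 + \<rho>)) * indicator {1..1 + \<rho>} v :: real)"
  proof (intro integrable_mult_right integrable_real_indicator)
    show "emeasure lborel {1..1 + \<rho>} < \<infinity>" using rho by (subst emeasure_lborel_Icc) auto
  qed simp
  have "(LINT v|lborel. exp (- b * (1 + \<rho>)) * indicator {1..1 + \<rho>} v) \<le> (LINT v|lborel. gweight a b v)"
  proof (intro integral_mono i w)
    fix v :: real
    show "exp (- b * (1 + \<rho>)) * indicator {1..1 + \<rho>} v \<le> gweight a b v"
    proof (cases "v \<in> {1..1 + \<rho>}")
      case True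
      have "exp (- b * (1 + \<rho>)) * 1 \<le> exp (- b * v) * v powr (b - a - 1)"
        using True b by (intro mult_mono ge_one_powr_ge_zero) auto
      thus ?thesis using True by (simp add: gweight_def)
    qed (simp add: gweight_nonneg)
  qed
  thus ?thesis using rho w by (simp add: mult.commute)
qed

section \<open>Admissible neighbourhoods and the expansion in region B\<close>

definition expansionB :: "real \<Rightarrow> real \<Rightarrow> real \<Rightarrow> complex \<Rightarrow> bool" where
  "expansionB a C b \<xi> \<longleftrightarrow> (\<exists>R::complex. norm R \<le> C / b ^ 2 \<and>
         hyp1F1 (of_real a) (of_real b) (of_real b * \<xi>) =
           exp (of_real b * (\<xi> - 1 - Ln \<xi>)) * of_real (b powr (a - 1 / 2))
           * of_real (sqrt (2 * pi) / Gamma a) * \<xi> * (\<xi> - 1) powr (of_real a - 1)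
           * (1 + (1 / (12 * of_real b)) *
                 (1 + of_real (12 * a * (a - 1)) / (\<xi> - 1)
                    + of_real (6 * (a - 1) * (a - 2)) / (\<xi> - 1) ^ 2)
              + R))"

text \<open>At l = 1 the height condition with \<open>\<kappa>\<close> = 0 holds strictly by the
  definition of region B, and continuity lets l drop below 1. The slack left in each inequality is
  shared between \<open>d\<close> or \<open>\<kappa>\<close> and a neighbourhood of
  \<open>\<xi>0\<close>.\<close>

lemma admissible_exists:
  assumes "\<xi>0 \<in> regionB"
  shows "\<exists>d \<kappa> l U. open U \<and> \<xi>0 \<in> U \<and> (\<forall>\<xi>\<in>U. admissible d \<kappa> l \<xi>)"
proof -
  have x: "Re \<xi>0 > 1" using assms by (simp add: regionB_def)
  hence nz: "\<xi>0 \<noteq> 0" by force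
  have "(Re \<xi>0)\<^sup>2 + (Im \<xi>0)\<^sup>2 > 0" using x by (intro add_pos_nonneg) auto
  hence "ln (norm \<xi>0) = ln ((Re \<xi>0)\<^sup>2 + (Im \<xi>0)\<^sup>2) / 2" by (simp add: cmod_def ln_sqrt)
  hence neg: "1 < 1 * Re \<xi>0 - ln (1 * norm \<xi>0)" using assms by (simp add: regionB_def)
  have "isCont (\<lambda>l. l * Re \<xi>0 - ln (l * norm \<xi>0)) 1"
    using nz by (intro continuous_intros) auto
  hence "((\<lambda>l. l * Re \<xi>0 - ln (l * norm \<xi>0)) \<longlongrightarrow> 1 * Re \<xi>0 - ln (1 * norm \<xi>0)) (at_left 1)"
    unfolding isCont_def by (rule tendsto_within_subset) auto
  hence "eventually (\<lambda>l. 1 < l * Re \<xi>0 - ln (l * norm \<xi>0)) (at_left 1)" using neg by (rule order_tendstoD)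
  moreover have "((\<lambda>l. l * Re \<xi>0) \<longlongrightarrow> 1 * Re \<xi>0) (at_left 1)" by (intro tendsto_intros)
  hence "eventually (\<lambda>l. 1 < l * Re \<xi>0) (at_left 1)" using x by (intro order_tendstoD(1)) simp_all
  moreover have "eventually (\<lambda>l. l \<in> {0<..<1}) (at_left (1::real))" by (rule eventually_at_left_real) simp
  ultimately have "eventually (\<lambda>l. 1 < l * Re \<xi>0 - ln (l * norm \<xi>0) \<and> 1 < l * Re \<xi>0 \<and> l \<in> {0<..<1}) (at_left (1::real))"
    by eventually_elim simp
  hence "\<exists>l. 1 < l * Re \<xi>0 - ln (l * norm \<xi>0) \<and> 1 < l * Re \<xi>0 \<and> l \<in> {0<..<1}"
    by (rule eventually_happens'[OF trivial_limit_at_left_real])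
  then obtain l where l: "1 < l * Re \<xi>0 - ln (l * norm \<xi>0)" "1 < l * Re \<xi>0" "0 < l" "l < 1" by auto
  define h0 where "h0 = l * Re \<xi>0 - ln (l * norm \<xi>0)"
  define \<kappa> where "\<kappa> = (h0 - 1) / 2"
  have "h0 > 1" using l(1) by (simp only: h0_def)
  hence kap0: "\<kappa> > 0" and "1 + \<kappa> < h0" by (simp_all add: \<kappa>_def field_simps)
  hence kap: "1 + \<kappa> < l * Re \<xi>0 - ln (l * norm \<xi>0)" by (simp only: h0_def)
  define A1 where "A1 = (l * Re \<xi>0 - 1) / 2"
  define A2 where "A2 = (1 - l) * Re \<xi>0 / 2"
  \<comment> \<open>The added 1 makes |\<open>\<xi>0\<close>| < 1/d strict, so that the bound
    survives in a neighbourhood.\<close>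
  define A3 where "A3 = 1 / (norm \<xi>0 + 1)"
  define d where "d = min A1 (min A2 A3)"
  have np: "norm \<xi>0 + 1 > 0" using norm_ge_zero[of \<xi>0] by linarith
  have "A1 > 0" using l by (simp add: A1_def)
  moreover have A2: "A2 > 0" using l x by (simp add: A2_def)
  moreover have "A3 > 0" using np by (simp add: A3_def)
  ultimately have d1: "d > 0" by (simp add: d_def)
  have "d \<le> A1" "d \<le> A2" "d \<le> A3" by (auto simp: d_def)
  define X where "X = l * Re \<xi>0"
  have "d \<le> (X - 1) / 2" "1 < X" using \<open>d \<le> A1\<close> l(2) by (simp_all only: A1_def X_def)
  hence "1 + d < X" by (simp add: field_simps)
  hence d2: "1 + d < l * Re \<xi>0" by (simp only: X_def)
  have "d < 2 * A2" using \<open>d \<le> A2\<close> A2 by linarith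
  hence d3: "d < (1 - l) * Re \<xi>0" by (simp add: A2_def)
  have "d * (norm \<xi>0 + 1) \<le> 1" using \<open>d \<le> A3\<close> unfolding A3_def pos_le_divide_eq[OF np] .
  hence "norm \<xi>0 + 1 \<le> 1 / d" unfolding pos_le_divide_eq[OF d1] by (simp only: mult.commute)
  hence n: "norm \<xi>0 < 1 / d" by linarith
  have c1: "((\<lambda>\<xi>. l * Re \<xi>) \<longlongrightarrow> l * Re \<xi>0) (nhds \<xi>0)" "((\<lambda>\<xi>. (1 - l) * Re \<xi>) \<longlongrightarrow> (1 - l) * Re \<xi>0) (nhds \<xi>0)"
    "((\<lambda>\<xi>. norm \<xi>) \<longlongrightarrow> norm \<xi>0) (nhds \<xi>0)"
    by (intro tendsto_intros filterlim_ident)+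
  have c2: "((\<lambda>\<xi>. l * Re \<xi> - ln (l * norm \<xi>)) \<longlongrightarrow> l * Re \<xi>0 - ln (l * norm \<xi>0)) (nhds \<xi>0)"
    using nz l by (intro tendsto_intros filterlim_ident) auto
  have "eventually (\<lambda>\<xi>. admissible d \<kappa> l \<xi>) (nhds \<xi>0)"
    using order_tendstoD(1)[OF c1(1) d2] order_tendstoD(1)[OF c1(2) d3] order_tendstoD(2)[OF c1(3) n] order_tendstoD(1)[OF c2 kap]
    by eventually_elim (use l kap0 d1 in \<open>simp add: admissible_def\<close>)
  then obtain U where "open U" "\<xi>0 \<in> U" "\<forall>\<xi>\<in>U. admissible d \<kappa> l \<xi>" unfolding eventually_nhds by (elim exE conjE)
  thus ?thesis by (intro exI[of _ d] exI[of _ \<kappa>] exI[of _ l] exI[of _ U]) simp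
qed

lemma exp_decay:
  assumes "\<kappa> > 0" "b > (0::real)"
  shows "exp (- (b * \<kappa> / 2)) \<le> (8 / \<kappa>^2) / b^2"
proof -
  define t where "t = b * \<kappa> / 2"
  have t: "t > 0" using assms by (simp add: t_def)
  have "t^2 / 2 \<le> exp t" using exp_lower_Taylor_quadratic[of t] t by simp
  hence "exp (- t) \<le> inverse (t^2 / 2)" unfolding exp_minus using t by (intro le_imp_inverse_le) auto
  also have "\<dots> = (8 / \<kappa>^2) / b^2" using assms by (simp add: t_def field_simps power2_eq_square)
  finally show ?thesis by (simp add: t_def)
qed

text \<open>Splitting Euler's integral at s = l leaves three pieces: the real segment carries the
  main term, and the vertical segment and the tail are exponentially smaller than the mass. The
  error is therefore stated relative to \<open>gmass\<close>.\<close>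

lemma laplace_estimate:
  assumes a: "a > 0" and d: "d > 0" and kap: "\<kappa> > 0" and l: "0 < l" "l < 1"
  shows "\<exists>C\<ge>0. \<forall>\<xi> b. admissible d \<kappa> l \<xi> \<longrightarrow> b \<ge> 1 \<longrightarrow> b > a + 1 \<longrightarrow>
    (\<exists>E. norm E \<le> C / b^2 \<and>
      \<xi> powr of_real (b - 1) * exp (- of_real b * \<xi>) * (hyp1F1 (of_real a) (of_real b) (of_real b * \<xi>) * of_real (Beta (b - a) a)) =
      of_real (gmass a b) * ((\<xi> - 1) powr of_real (a - 1) *
        (\<Sum>j<4. of_real (nb_coeff (1 - a) j) * (1 / (\<xi> - 1)) ^ j * of_real (gmom a j b)) + E))"
proof -
  obtain C1 where C1: "C1 \<ge> 0" "\<forall>\<kappa> l \<xi> b. admissible d \<kappa> l \<xi> \<longrightarrow> b > 0 \<longrightarrow> b > a + 1 \<longrightarrow>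
    norm (integral {0..l * Re \<xi>} (\<lambda>v. euler_fun a b \<xi> (of_real v)) -
      of_real (gmass a b) * ((\<xi> - 1) powr of_real (a - 1) *
        (\<Sum>j<4. of_real (nb_coeff (1 - a) j) * (1 / (\<xi> - 1)) ^ j * of_real (gmom a j b)))) \<le> C1 * (gmass a b * gmom a 4 b)"
    using segment_estimate[OF d, of a] by (elim exE conjE)
  define N4 where "N4 = 3 + \<bar>6 * a^2 - 14 * a + 6\<bar> + \<bar>a^4 - 6 * a^3 + 11 * a^2 - 6 * a\<bar>"
  define D where "D = powr_bound a d * (1 / d) + l powr (- a - 2) * Beta 2 a"
  have D0: "D \<ge> 0"
  proof -
    have "Beta 2 a \<ge> 0" unfolding Beta_def using a by (intro divide_nonneg_nonneg mult_nonneg_nonneg less_imp_le[OF Gamma_real_pos]) auto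
    thus ?thesis using d by (simp add: D_def powr_bound_def)
  qed
  define C where "C = C1 * N4 + D * (2 / \<kappa>) * (8 / \<kappa>^2)"
  have "\<exists>E. norm E \<le> C / b^2 \<and>
      \<xi> powr of_real (b - 1) * exp (- of_real b * \<xi>) * (hyp1F1 (of_real a) (of_real b) (of_real b * \<xi>) * of_real (Beta (b - a) a)) =
      of_real (gmass a b) * ((\<xi> - 1) powr of_real (a - 1) *
        (\<Sum>j<4. of_real (nb_coeff (1 - a) j) * (1 / (\<xi> - 1)) ^ j * of_real (gmom a j b)) + E)"
    if cond: "admissible d \<kappa> l \<xi>" and b: "b \<ge> 1" "b > a + 1" for \<xi> b
  proof -
    have b0: "b > 0" "a < b" using b by auto
    define H where "H = hyp1F1 (of_real a) (of_real b) (of_real b * \<xi>) * of_real (Beta (b - a) a)"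
    define M where "M = gmass a b"
    define X where "X = (\<xi> - 1) powr of_real (a - 1) * (\<Sum>j<4. of_real (nb_coeff (1 - a) j) * (1 / (\<xi> - 1)) ^ j * of_real (gmom a j b))"
    define P where "P = \<xi> powr of_real (b - 1)"
    let ?g = "\<lambda>s. exp (- of_real b * \<xi> * of_real s) * complex_of_real (s powr (b - a - 1) * (1 - s) powr (a - 1))"
    have "((\<lambda>s. exp (- of_real b * \<xi>) * (exp (of_real b * \<xi> * of_real (1 - s)) * complex_of_real (s powr (b - a - 1) * (1 - s) powr (a - 1)))) has_integral
       exp (- of_real b * \<xi>) * H) {0..1}"
      unfolding H_def by (intro has_integral_mult_right euler_integral a b0)
    moreover have "exp (- of_real b * \<xi>) * (exp (of_real b * \<xi> * of_real (1 - s)) * complex_of_real (s powr (b - a - 1) * (1 - s) powr (a - 1))) = ?g s" for s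
    proof -
      have "exp (- of_real b * \<xi>) * exp (of_real b * \<xi> * of_real (1 - s)) = exp (- of_real b * \<xi> * of_real s)"
        unfolding exp_add[symmetric] by (simp add: algebra_simps)
      thus ?thesis by (simp only: mult.assoc[symmetric])
    qed
    ultimately have gi: "(?g has_integral exp (- of_real b * \<xi>) * H) {0..1}" by (simp only:)
    have "integral {0..l} ?g + integral {l..1} ?g = integral {0..1} ?g"
      using l has_integral_integrable[OF gi] by (intro Henstock_Kurzweil_Integration.integral_combine) auto
    also have "\<dots> = exp (- of_real b * \<xi>) * H" using gi by (rule integral_unique)
    finally have split: "exp (- of_real b * \<xi>) * H = integral {0..l} ?g + integral {l..1} ?g" ..
    define R where "R = integral {0..l * Re \<xi>} (\<lambda>v. euler_fun a b \<xi> (of_real v))"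
    define V where "V = contour_integral (linepath (of_real (l * Re \<xi>)) (of_real l * \<xi>)) (euler_fun a b \<xi>)"
    define T where "T = P * integral {l..1} ?g"
    have "P * exp (- of_real b * \<xi>) * H = P * (exp (- of_real b * \<xi>) * H)" by (rule mult.assoc)
    also have "\<dots> = P * integral {0..l} ?g + T" unfolding split T_def by (rule distrib_left)
    also have "P * integral {0..l} ?g = R + V"
      unfolding P_def R_def V_def by (rule shift_contour(1)[OF admissibleD(1)[OF cond] l b(2)])
    finally have eq: "P * exp (- of_real b * \<xi>) * H = R + V + T" .
    have nV: "norm V \<le> powr_bound a d * exp (- b * (1 + \<kappa>)) * (1 / d)"
      unfolding V_def by (rule vertical_bound[OF cond b0(1) b(2) a])
    have nT: "norm T \<le> l powr (- a - 2) * Beta 2 a * exp (- b * (1 + \<kappa>))"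
    proof -
      have "?g integrable_on {l..1}"
        by (rule integrable_on_subinterval[OF has_integral_integrable[OF gi]]) (use l in auto)
      from tail_bound[OF cond b0(1) b(2) a this] show ?thesis unfolding T_def P_def .
    qed
    have nR: "norm (R - of_real M * X) \<le> C1 * (M * gmom a 4 b)"
      unfolding R_def M_def X_def by (rule C1(2)[rule_format, OF cond b0(1) b(2)])
    have M: "\<kappa> / 2 * exp (- b * (1 + \<kappa> / 2)) \<le> M" unfolding M_def using b b0 kap by (intro gmass_lower) auto
    have "0 < \<kappa> / 2 * exp (- b * (1 + \<kappa> / 2))" using kap by simp
    hence M0: "M > 0" using M by linarith
    \<comment> \<open>The exponent 1 + \<open>\<kappa>\<close> is split as (1 +
      \<open>\<kappa>\<close>/2) + \<open>\<kappa>\<close>/2: the first part is measured against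
      \<open>gmass_lower\<close> with window length \<open>\<kappa>\<close>/2, the second provides
      the decay.\<close>
    have ex: "exp (- b * (1 + \<kappa>)) \<le> M * ((2 / \<kappa>) * ((8 / \<kappa>^2) / b^2))"
    proof -
      have "exp (- b * (1 + \<kappa>)) = (\<kappa> / 2 * exp (- b * (1 + \<kappa> / 2))) * ((2 / \<kappa>) * exp (- (b * \<kappa> / 2)))"
        using kap by (simp add: exp_add[symmetric] algebra_simps)
      also have "\<dots> \<le> M * ((2 / \<kappa>) * ((8 / \<kappa>^2) / b^2))"
        using M M0 kap b0 by (intro mult_mono mult_left_mono exp_decay) auto
      finally show ?thesis .
    qed
    have n4: "gmom a 4 b \<le> N4 / b^2"
    proof -
      have "1 / b^3 \<le> 1 / b^2" "1 / b^4 \<le> 1 / b^2" using b by (auto intro!: divide_left_mono power_increasing)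
      hence "\<bar>6 * a^2 - 14 * a + 6\<bar> * (1 / b^3) \<le> \<bar>6 * a^2 - 14 * a + 6\<bar> * (1 / b^2)"
        "\<bar>a^4 - 6 * a^3 + 11 * a^2 - 6 * a\<bar> * (1 / b^4) \<le> \<bar>a^4 - 6 * a^3 + 11 * a^2 - 6 * a\<bar> * (1 / b^2)"
        by (intro mult_left_mono; simp)+
      moreover have "(6 * a^2 - 14 * a + 6) / b^3 \<le> \<bar>6 * a^2 - 14 * a + 6\<bar> * (1 / b^3)"
        "(a^4 - 6 * a^3 + 11 * a^2 - 6 * a) / b^4 \<le> \<bar>a^4 - 6 * a^3 + 11 * a^2 - 6 * a\<bar> * (1 / b^4)"
        using b0 by (simp_all add: divide_right_mono)
      moreover have "N4 / b^2 = 3 / b^2 + \<bar>6 * a^2 - 14 * a + 6\<bar> * (1 / b^2) + \<bar>a^4 - 6 * a^3 + 11 * a^2 - 6 * a\<bar> * (1 / b^2)"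
        by (simp add: N4_def add_divide_distrib)
      ultimately show ?thesis unfolding gmom_eq(5)[OF b0(1)] by linarith
    qed
    define E where "E = ((R - of_real M * X) + V + T) / of_real M"
    have "norm ((R - of_real M * X) + V + T) \<le> M * (C / b^2)"
    proof -
      have "norm ((R - of_real M * X) + V + T) \<le> C1 * (M * gmom a 4 b) + D * exp (- b * (1 + \<kappa>))"
        using nR nV nT norm_triangle_ineq[of "R - of_real M * X + V" T] norm_triangle_ineq[of "R - of_real M * X" V]
        unfolding D_def by (simp add: algebra_simps)
      also have "\<dots> \<le> C1 * (M * (N4 / b^2)) + D * (M * ((2 / \<kappa>) * ((8 / \<kappa>^2) / b^2)))"
        using n4 ex C1(1) D0 M0 by (intro add_mono mult_left_mono) auto
      also have "\<dots> = M * (C / b^2)" by (simp add: C_def add_divide_distrib algebra_simps)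
      finally show ?thesis .
    qed
    hence "norm E \<le> C / b^2" using M0 by (simp add: E_def norm_divide field_simps)
    moreover have "P * exp (- of_real b * \<xi>) * H = of_real M * (X + E)"
      unfolding eq E_def using M0 by (simp add: field_simps)
    ultimately show ?thesis unfolding P_def H_def M_def X_def by (intro exI[of _ E]) simp
  qed
  moreover have "C \<ge> 0" using C1(1) D0 kap by (simp add: C_def N4_def)
  ultimately show ?thesis by (intro exI[of _ C]) simp
qed

text \<open>When the Stirling factor meets the saddle-point factor, the two first-order terms
  multiply to \<open>\<alpha>\<close>/(12 b^2), and every other discarded term carries
  \<open>E\<close> or \<open>e\<close>.\<close>

lemma product_remainder:
  fixes \<alpha> E :: complex and e b :: real
  assumes b: "b \<ge> 1" and \<alpha>: "norm \<alpha> \<le> A" and E: "norm E \<le> C / b^2" and e: "\<bar>e\<bar> \<le> D / b^2"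
  shows "norm (of_real (1 + 1 / (12 * b) + e) * (1 + \<alpha> / of_real b + E) - (1 + of_real (1 / (12 * b)) + \<alpha> / of_real b))
    \<le> (A + 2 * C + D * (1 + A + C)) / b^2"
proof -
  have A0: "A \<ge> 0" using \<alpha> norm_ge_zero[of \<alpha>] by linarith
  have "0 \<le> C / b^2" using E norm_ge_zero[of E] by linarith
  hence C0: "C \<ge> 0" using b by (simp add: zero_le_divide_iff)
  have "0 \<le> D / b^2" using e abs_ge_zero[of e] by linarith
  hence D0: "D \<ge> 0" using b by (simp add: zero_le_divide_iff)
  define t where "t = 1 / b"
  have t: "0 < t" "t \<le> 1" using b by (simp_all add: t_def)
  have E': "norm E \<le> C * t^2" and e': "\<bar>e\<bar> \<le> D * t^2"
    using E e by (simp_all add: t_def power_divide)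
  have tt: "t^2 \<le> 1" using t by (intro power_le_one) auto
  have "C * t^2 \<le> C * 1" using tt C0 by (intro mult_left_mono)
  hence E1: "norm E \<le> C" using E' by linarith
  have n\<alpha>: "norm (of_real t * \<alpha>) \<le> 1 * A"
    unfolding norm_mult norm_of_real using t \<alpha> by (intro mult_mono) auto
  have T1: "norm (of_real (t / 12) * (of_real t * \<alpha>)) \<le> A * t^2"
  proof -
    have "norm (of_real (t / 12) * (of_real t * \<alpha>)) = t / 12 * (t * norm \<alpha>)"
      unfolding norm_mult norm_of_real using t by simp
    also have "\<dots> = (t^2 / 12) * norm \<alpha>" by (simp add: power2_eq_square)
    also have "\<dots> \<le> t^2 * A" using \<alpha> by (intro mult_mono) auto
    finally show ?thesis by (simp only: mult.commute)
  qed
  have T2: "norm (of_real (t / 12) * E) \<le> C * t^2"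
  proof -
    have "norm (of_real (t / 12) * E) \<le> 1 * norm E"
      unfolding norm_mult norm_of_real using t by (intro mult_right_mono) auto
    thus ?thesis using E' by linarith
  qed
  have T3: "norm (of_real e * (1 + of_real t * \<alpha> + E)) \<le> D * t^2 * (1 + A + C)"
  proof -
    have "norm (1 + of_real t * \<alpha> + E) \<le> 1 + A + C"
      using norm_triangle_ineq[of "1 + of_real t * \<alpha>" E] norm_triangle_ineq[of 1 "of_real t * \<alpha>"] n\<alpha> E1 by simp
    thus ?thesis unfolding norm_mult norm_of_real using e' D0 by (intro mult_mono) auto
  qed
  have "of_real (1 + 1 / (12 * b) + e) * (1 + \<alpha> / of_real b + E) - (1 + of_real (1 / (12 * b)) + \<alpha> / of_real b)
     = of_real (t / 12) * (of_real t * \<alpha>) + of_real (t / 12) * E + E + of_real e * (1 + of_real t * \<alpha> + E)"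
  proof -
    have 1: "1 / (12 * b) = t / 12" and 2: "\<alpha> / of_real b = of_real t * \<alpha>" by (simp_all add: t_def)
    show ?thesis unfolding 1 2 of_real_add of_real_1 by (simp only: algebra_simps mult_1 mult_1_right)
  qed
  also have "norm \<dots> \<le> A * t^2 + C * t^2 + C * t^2 + D * t^2 * (1 + A + C)"
    by (intro order.trans[OF norm_triangle_ineq] add_mono T1 T2 T3 E')
  also have "\<dots> = (A + 2 * C + D * (1 + A + C)) * t^2" by (simp only: algebra_simps)
  also have "\<dots> = (A + 2 * C + D * (1 + A + C)) / b^2" by (simp add: t_def power_divide)
  finally show ?thesis .
qed

lemma gmom_3_bound:
  assumes "b \<ge> 1"
  shows "\<bar>gmom a 3 b\<bar> \<le> (\<bar>2 - 3 * a\<bar> + \<bar>3 * a^2 - a^3 - 2 * a\<bar>) / b^2"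
proof -
  have b: "b > 0" using assms by simp
  define K where "K = 3 * a^2 - a^3 - 2 * a"
  have "\<bar>gmom a 3 b\<bar> \<le> \<bar>(2 - 3 * a) / b^2\<bar> + \<bar>K / b^3\<bar>" unfolding gmom_eq(4)[OF b] K_def by (rule abs_triangle_ineq)
  also have "\<bar>(2 - 3 * a) / b^2\<bar> = \<bar>2 - 3 * a\<bar> / b^2" by (simp add: abs_divide)
  also have "\<bar>K / b^3\<bar> \<le> \<bar>K\<bar> / b^2"
    unfolding abs_divide using assms by (intro divide_left_mono) (auto intro: power_increasing)
  finally show ?thesis by (simp add: K_def add_divide_distrib)
qed

text \<open>Mass divided by Beta value is Gamma(b) b^(a-b)/Gamma(a): the factor Gamma(b - a)
  cancels, so Stirling's correction enters once. The number \<open>\<alpha>\<close> collects the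
  contributions of order 1/b, from the first coefficient times the mean shift -a/b and from the
  second times the leading part 1/b of the second moment.\<close>

lemma expansionB_local:
  assumes a: "a > 0" and xi0: "\<xi>0 \<in> regionB"
  shows "\<exists>U C B. open U \<and> \<xi>0 \<in> U \<and> (\<forall>b\<ge>B. \<forall>\<xi>\<in>U. expansionB a C b \<xi>)"
proof -
  obtain d \<kappa> l U where U: "open U" "\<xi>0 \<in> U" and cond: "\<forall>\<xi>\<in>U. admissible d \<kappa> l \<xi>"
    using admissible_exists[OF xi0] by (elim exE conjE)
  have "admissible d \<kappa> l \<xi>0" using cond U by simp
  hence d: "d > 0" "\<kappa> > 0" "0 < l" "l < 1" by (simp_all add: admissible_def)
  obtain CL where CL: "CL \<ge> 0" "\<forall>\<xi> b. admissible d \<kappa> l \<xi> \<longrightarrow> b \<ge> 1 \<longrightarrow> b > a + 1 \<longrightarrow>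
    (\<exists>E. norm E \<le> CL / b^2 \<and>
      \<xi> powr of_real (b - 1) * exp (- of_real b * \<xi>) * (hyp1F1 (of_real a) (of_real b) (of_real b * \<xi>) * of_real (Beta (b - a) a)) =
      of_real (gmass a b) * ((\<xi> - 1) powr of_real (a - 1) *
        (\<Sum>j<4. of_real (nb_coeff (1 - a) j) * (1 / (\<xi> - 1)) ^ j * of_real (gmom a j b)) + E))"
    using laplace_estimate[OF a d] by (elim exE conjE)
  obtain CG BG where CG: "\<forall>b\<ge>BG. BG > 0 \<and> (\<exists>e. \<bar>e\<bar> \<le> CG / b^2 \<and>
     Gamma b = sqrt (2 * pi) * b powr (b - 1/2) * exp (-b) * (1 + 1 / (12 * b) + e))"
    using Gamma_asymp by (elim exE)
  define A where "A = \<bar>a * (a - 1)\<bar> * (1 / d) + \<bar>(a - 1) * (a - 2) / 2\<bar> * (1 / d)^2"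
  define N3 where "N3 = \<bar>2 - 3 * a\<bar> + \<bar>3 * a^2 - a^3 - 2 * a\<bar>"
  define C3 where "C3 = \<bar>nb_coeff (1 - a) 2\<bar> * (1 / d)^2 * \<bar>a\<^sup>2 - a\<bar> + \<bar>nb_coeff (1 - a) 3\<bar> * (1 / d)^3 * N3"
  define C4 where "C4 = C3 + CL * powr_bound (2 - a) d"
  define C where "C = A + 2 * C4 + CG * (1 + A + C4)"
  have "expansionB a C b \<xi>" if b: "b \<ge> max (max 1 (a + 2)) BG" and xi: "\<xi> \<in> U" for b \<xi>
  proof -
    have bs: "b \<ge> 1" "b > a + 1" "b \<ge> BG" "b > 0" "a < b" using b by auto
    have c: "admissible d \<kappa> l \<xi>" using cond xi by simp
    note D = admissibleD[OF c]
    have nz: "\<xi> - 1 \<noteq> 0" "\<xi> \<noteq> 0" using D d by auto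
    obtain E where E: "norm E \<le> CL / b^2"
      "\<xi> powr of_real (b - 1) * exp (- of_real b * \<xi>) * (hyp1F1 (of_real a) (of_real b) (of_real b * \<xi>) * of_real (Beta (b - a) a)) =
      of_real (gmass a b) * ((\<xi> - 1) powr of_real (a - 1) *
        (\<Sum>j<4. of_real (nb_coeff (1 - a) j) * (1 / (\<xi> - 1)) ^ j * of_real (gmom a j b)) + E)"
      using CL(2)[rule_format, OF c bs(1,2)] by (elim exE conjE)
    obtain e where e: "\<bar>e\<bar> \<le> CG / b^2" "Gamma b = sqrt (2 * pi) * b powr (b - 1/2) * exp (-b) * (1 + 1 / (12 * b) + e)"
      using CG[rule_format, OF bs(3)] by (elim exE conjE)
    define H where "H = hyp1F1 (of_real a) (of_real b) (of_real b * \<xi>)"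
    define P where "P = (\<xi> - 1) powr of_real (a - 1)"
    define w where "w = 1 / (\<xi> - 1)"
    define S where "S = (\<Sum>j<4. of_real (nb_coeff (1 - a) j) * w ^ j * of_real (gmom a j b))"
    have P0: "P \<noteq> 0" using nz by (simp add: P_def)
    have nw: "norm w \<le> 1 / d" unfolding w_def norm_divide norm_one using D d nz by (intro divide_left_mono mult_pos_pos) auto
    define \<alpha> where "\<alpha> = of_real (a * (a - 1)) * w + of_real ((a - 1) * (a - 2) / 2) * w^2"
    have "norm (of_real p * w) \<le> \<bar>p\<bar> * (1 / d)" "norm (of_real p * w^2) \<le> \<bar>p\<bar> * (1 / d)^2" for p
      unfolding norm_mult norm_power norm_of_real by (intro mult_left_mono power_mono nw; simp)+
    hence n\<alpha>: "norm \<alpha> \<le> A"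
      unfolding \<alpha>_def A_def by (intro order.trans[OF norm_triangle_ineq] add_mono)
    define E1 where "E1 = S - 1 - \<alpha> / of_real b"
    have E1: "E1 = of_real (nb_coeff (1 - a) 2) * w^2 * of_real ((a\<^sup>2 - a) / b^2) + of_real (nb_coeff (1 - a) 3) * w^3 * of_real (gmom a 3 b)"
    proof -
      have four: "{..<4::nat} = {0, 1, 2, 3}" by auto
      have cs: "nb_coeff (1 - a) 0 = 1" "nb_coeff (1 - a) 1 = 1 - a" "nb_coeff (1 - a) 2 = (a - 1) * (a - 2) / 2"
        by (simp_all add: nb_coeff_def pochhammer_Suc numeral_eq_Suc algebra_simps)
      have "S = of_real (nb_coeff (1 - a) 0 * gmom a 0 b) + w * of_real (nb_coeff (1 - a) 1 * gmom a 1 b)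
           + w^2 * of_real (nb_coeff (1 - a) 2 * gmom a 2 b) + of_real (nb_coeff (1 - a) 3) * w^3 * of_real (gmom a 3 b)"
        unfolding S_def four by (simp add: mult_ac)
      also have "nb_coeff (1 - a) 0 * gmom a 0 b = 1" by (simp only: cs gmom_eq(1)[OF bs(4)] mult_1)
      also have "nb_coeff (1 - a) 1 * gmom a 1 b = a * (a - 1) / b" unfolding cs gmom_eq(2)[OF bs(4)] by (simp add: algebra_simps diff_divide_distrib)
      also have "nb_coeff (1 - a) 2 * gmom a 2 b = (a - 1) * (a - 2) / 2 / b + nb_coeff (1 - a) 2 * ((a\<^sup>2 - a) / b^2)"
        unfolding gmom_eq(3)[OF bs(4)] distrib_left unfolding cs(3) by simp
      finally have S: "S = 1 + w * of_real (a * (a - 1) / b) + w^2 * of_real ((a - 1) * (a - 2) / 2 / b + nb_coeff (1 - a) 2 * ((a\<^sup>2 - a) / b^2))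
          + of_real (nb_coeff (1 - a) 3) * w^3 * of_real (gmom a 3 b)" by simp
      have "\<alpha> / of_real b = w * of_real (a * (a - 1) / b) + w^2 * of_real ((a - 1) * (a - 2) / 2 / b)"
        unfolding \<alpha>_def add_divide_distrib of_real_divide by (simp add: mult_ac)
      thus ?thesis unfolding E1_def S of_real_add of_real_mult[of "nb_coeff (1 - a) 2"] by (simp only: algebra_simps)
    qed
    have nE1: "norm E1 \<le> C3 / b^2"
    proof -
      have "norm E1 \<le> \<bar>nb_coeff (1 - a) 2\<bar> * (1 / d)^2 * (\<bar>a\<^sup>2 - a\<bar> / b^2) + \<bar>nb_coeff (1 - a) 3\<bar> * (1 / d)^3 * (N3 / b^2)"
        unfolding E1
      proof (intro order.trans[OF norm_triangle_ineq] add_mono)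
        show "norm (of_real (nb_coeff (1 - a) 2) * w^2 * of_real ((a\<^sup>2 - a) / b^2)) \<le> \<bar>nb_coeff (1 - a) 2\<bar> * (1 / d)^2 * (\<bar>a\<^sup>2 - a\<bar> / b^2)"
          unfolding norm_mult norm_power norm_of_real abs_divide using d by (intro mult_mono power_mono nw) auto
        show "norm (of_real (nb_coeff (1 - a) 3) * w^3 * of_real (gmom a 3 b)) \<le> \<bar>nb_coeff (1 - a) 3\<bar> * (1 / d)^3 * (N3 / b^2)"
          unfolding norm_mult norm_power norm_of_real using d gmom_3_bound[OF bs(1), of a]
          by (intro mult_mono power_mono nw) (auto simp: N3_def)
      qed
      thus ?thesis by (simp add: C3_def add_divide_distrib)
    qed
    define E2 where "E2 = E1 + E * inverse P"
    have nE2: "norm E2 \<le> C4 / b^2"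
    proof -
      \<comment> \<open>The exponent 1 - a is (2 - a) - 1, hence the bound
        \<open>powr_bound (2 - a) d\<close>.\<close>
      have "inverse P = (\<xi> - 1) powr of_real (1 - a)"
        unfolding P_def powr_minus[symmetric] by simp
      hence "norm (inverse P) = norm (\<xi> - 1) powr (1 - a)" by (simp only: norm_powr_of_real)
      also have "\<dots> \<le> powr_bound (2 - a) d"
        using powr_le_ends[OF d(1) D(3) D(4), of "1 - a"] by (simp add: powr_bound_def)
      finally have "norm (E * inverse P) \<le> CL / b^2 * powr_bound (2 - a) d"
        unfolding norm_mult using E(1) CL(1) by (intro mult_mono) auto
      thus ?thesis using nE1 norm_triangle_ineq[of E1 "E * inverse P"] unfolding E2_def C4_def by (simp add: add_divide_distrib)
    qed
    have SE: "P * S + E = P * (1 + \<alpha> / of_real b + E2)"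
    proof -
      have "S = 1 + \<alpha> / of_real b + E1" by (simp add: E1_def)
      moreover have "P * (E * inverse P) = E" using P0 by simp
      ultimately show ?thesis unfolding E2_def by (simp only: distrib_left add.assoc)
    qed
    define R where "R = of_real (1 + 1 / (12 * b) + e) * (1 + \<alpha> / of_real b + E2) - (1 + of_real (1 / (12 * b)) + \<alpha> / of_real b)"
    have nR: "norm R \<le> C / b^2"
      unfolding R_def C_def by (rule product_remainder[OF bs(1) n\<alpha> nE2 e(1)])
    define L where "L = Ln \<xi>"
    have G: "Gamma (b - a) > 0" "Gamma a > 0" "Gamma b > 0" using a bs by (auto intro: Gamma_real_pos)
    have be: "Beta (b - a) a = Gamma (b - a) * Gamma a / Gamma b" by (simp add: Beta_def)
    have be0: "Beta (b - a) a \<noteq> 0" unfolding be using G by (simp add: less_imp_neq)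
    have K: "\<xi> powr of_real (b - 1) = exp (of_real (b - 1) * L)" using nz by (simp add: powr_def L_def)
    have "H * of_real (Beta (b - a) a) = exp (of_real b * \<xi> - of_real (b - 1) * L) * (of_real (gmass a b) * (P * S + E))"
    proof -
      have "exp (of_real b * \<xi> - of_real (b - 1) * L) * (exp (of_real (b - 1) * L) * exp (- of_real b * \<xi>)) = 1"
        unfolding exp_add[symmetric] by simp
      hence "exp (of_real b * \<xi> - of_real (b - 1) * L) * (exp (of_real (b - 1) * L) * exp (- of_real b * \<xi>) * (H * of_real (Beta (b - a) a))) = H * of_real (Beta (b - a) a)"
        by (simp only: mult.assoc[symmetric] mult_1)
      moreover have "exp (of_real (b - 1) * L) * exp (- of_real b * \<xi>) * (H * of_real (Beta (b - a) a)) = of_real (gmass a b) * (P * S + E)"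
        using E(2) unfolding K H_def P_def w_def S_def .
      ultimately show ?thesis by (simp only:)
    qed
    hence "H = exp (of_real b * \<xi> - of_real (b - 1) * L) * of_real (gmass a b / Beta (b - a) a) * (P * S + E)"
      using be0 by (simp add: field_simps)
    also have "gmass a b / Beta (b - a) a = (sqrt (2 * pi) / Gamma a) * b powr (a - 1/2) * exp (-b) * (1 + 1 / (12 * b) + e)"
    proof -
      have "gmass a b / Beta (b - a) a = Gamma b * b powr (a - b) / Gamma a"
        unfolding be gmass_def using G by simp
      also have "\<dots> = (sqrt (2 * pi) / Gamma a) * (b powr (b - 1/2) * b powr (a - b)) * exp (-b) * (1 + 1 / (12 * b) + e)"
        unfolding e(2) by simp
      also have "b powr (b - 1/2) * b powr (a - b) = b powr (a - 1/2)" unfolding powr_add[symmetric] by simp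
      finally show ?thesis .
    qed
    also have "exp (of_real b * \<xi> - of_real (b - 1) * L) = exp (of_real b * (\<xi> - 1 - L)) * exp (of_real b) * \<xi>"
    proof -
      have "exp (of_real b * (\<xi> - 1 - L)) * exp (of_real b) * exp L = exp (of_real b * \<xi> - of_real (b - 1) * L)"
        unfolding exp_add[symmetric] by (simp add: algebra_simps)
      thus ?thesis using nz by (simp add: L_def)
    qed
    also have "P * S + E = P * (1 + \<alpha> / of_real b + E2)" by (rule SE)
    finally have "H = exp (of_real b * (\<xi> - 1 - L)) * exp (of_real b) * \<xi> *
       of_real ((sqrt (2 * pi) / Gamma a) * b powr (a - 1/2) * exp (-b) * (1 + 1 / (12 * b) + e)) * (P * (1 + \<alpha> / of_real b + E2))" .
    also have "\<dots> = exp (of_real b * (\<xi> - 1 - L)) * of_real (b powr (a - 1/2)) * of_real (sqrt (2 * pi) / Gamma a) * \<xi> * P *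
        ((exp (of_real b) * of_real (exp (-b))) * (of_real (1 + 1 / (12 * b) + e) * (1 + \<alpha> / of_real b + E2)))"
      unfolding of_real_mult[of _ "1 + 1 / (12 * b) + e"] of_real_mult[of _ "exp (-b)"] of_real_mult[of "sqrt (2 * pi) / Gamma a"]
      by (simp only: mult_ac)
    also have "exp (of_real b) * complex_of_real (exp (-b)) = 1"
      unfolding exp_of_real[symmetric] exp_add[symmetric] by simp
    also have "1 * (of_real (1 + 1 / (12 * b) + e) * (1 + \<alpha> / of_real b + E2)) = 1 + of_real (1 / (12 * b)) + \<alpha> / of_real b + R"
      by (simp add: R_def)
    also have "1 + of_real (1 / (12 * b)) + \<alpha> / of_real b =
       1 + (1 / (12 * of_real b)) * (1 + of_real (12 * a * (a - 1)) / (\<xi> - 1) + of_real (6 * (a - 1) * (a - 2)) / (\<xi> - 1) ^ 2)"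
    proof -
      have 1: "of_real (12 * a * (a - 1)) / (\<xi> - 1) = 12 * (of_real (a * (a - 1)) * w)" by (simp add: w_def)
      have 2: "of_real (6 * (a - 1) * (a - 2)) / (\<xi> - 1) ^ 2 = 12 * (of_real ((a - 1) * (a - 2) / 2) * w^2)" by (simp add: w_def power_divide)
      have "1 + of_real (12 * a * (a - 1)) / (\<xi> - 1) + of_real (6 * (a - 1) * (a - 2)) / (\<xi> - 1) ^ 2 = 1 + 12 * \<alpha>"
        unfolding 1 2 \<alpha>_def by (simp only: distrib_left add.assoc)
      moreover have "1 / (12 * of_real b) * (1 + 12 * \<alpha>) = of_real (1 / (12 * b)) + \<alpha> / of_real b"
        using bs by (simp add: field_simps)
      ultimately show ?thesis by (simp only: add.assoc)
    qed
    finally show ?thesis using nR unfolding expansionB_def H_def L_def P_def of_real_diff of_real_1 by (intro exI[of _ R]) simp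
  qed
  thus ?thesis using U by (intro exI[of _ U] exI[of _ C] exI[of _ "max (max 1 (a + 2)) BG"]) simp
qed

lemma expansionA_mono:
  assumes "expansionA a C b \<xi>" "C \<le> C'" "b \<ge> 1"
  shows "expansionA a C' b \<xi>"
proof -
  have "C / b ^ 3 \<le> C' / b ^ 3" using assms by (intro divide_right_mono) auto
  with assms(1) show ?thesis
    unfolding expansionA_def by (elim exE conjE, intro exI conjI) (rule order.trans, assumption+)
qed

lemma expansionB_mono:
  assumes "expansionB a C b \<xi>" "C \<le> C'" "b \<ge> 1"
  shows "expansionB a C' b \<xi>"
proof -
  have "C / b ^ 2 \<le> C' / b ^ 2" using assms by (intro divide_right_mono) auto
  with assms(1) show ?thesis
    unfolding expansionB_def by (elim exE conjE, intro exI conjI) (rule order.trans, assumption+)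
qed

section \<open>The uniform expansions\<close>

theorem theoremB1:
  fixes a :: real
  assumes "a > 0"
  shows
   "(\<forall>K. compact K \<and> K \<subseteq> regionA \<longrightarrow>
      (\<exists>C B0. \<forall>b::real. b \<ge> B0 \<longrightarrow> (\<forall>\<xi>\<in>K. \<exists>R::complex. norm R \<le> C / b ^ 3 \<and>
        (let w = \<xi> / (1 - \<xi>) in
         hyp1F1 (of_real a) (of_real b) (of_real b * \<xi>) =
           (1 - \<xi>) powr (- of_real a) *
           (1 - of_real (a * (a + 1) / 2) * w ^ 2 / of_real b
              + (of_real (a * (a + 1) * (a + 2) * (a + 3) / 8) * w ^ 4
                 + of_real (2 * a * (a + 1) * (a + 2) / 3) * w ^ 3
                 + of_real (a * (a + 1) / 2) * w ^ 2) / of_real (b ^ 2)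
              + R)))))
    \<and>
    (\<forall>K. compact K \<and> K \<subseteq> regionB \<longrightarrow>
      (\<exists>C B0. \<forall>b::real. b \<ge> B0 \<longrightarrow> (\<forall>\<xi>\<in>K. \<exists>R::complex. norm R \<le> C / b ^ 2 \<and>
         hyp1F1 (of_real a) (of_real b) (of_real b * \<xi>) =
           exp (of_real b * (\<xi> - 1 - Ln \<xi>)) * of_real (b powr (a - 1 / 2))
           * of_real (sqrt (2 * pi) / Gamma a) * \<xi> * (\<xi> - 1) powr (of_real a - 1)
           * (1 + (1 / (12 * of_real b)) *
                 (1 + of_real (12 * a * (a - 1)) / (\<xi> - 1)
                    + of_real (6 * (a - 1) * (a - 2)) / (\<xi> - 1) ^ 2)
              + R))))"
proof (intro conjI allI impI, goal_cases)
  case (1 K)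
  have "\<exists>C B. \<forall>b\<ge>B. \<forall>\<xi>\<in>K. expansionA a C b \<xi>"
  proof (rule compact_uniform)
    show "compact K" using 1 by simp
    show "\<exists>U C B. open U \<and> \<xi> \<in> U \<and> (\<forall>b\<ge>B. \<forall>y\<in>U. expansionA a C b y)" if "\<xi> \<in> K" for \<xi>
      using 1 that by (intro regionA_local assms) auto
  qed (rule expansionA_mono)
  thus ?case unfolding expansionA_def .
next
  case (2 K)
  have "\<exists>C B. \<forall>b\<ge>B. \<forall>\<xi>\<in>K. expansionB a C b \<xi>"
  proof (rule compact_uniform)
    show "compact K" using 2 by simp
    show "\<exists>U C B. open U \<and> \<xi> \<in> U \<and> (\<forall>b\<ge>B. \<forall>y\<in>U. expansionB a C b y)" if "\<xi> \<in> K" for \<xi>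
      using 2 that by (intro expansionB_local assms) auto
  qed (rule expansionB_mono)
  thus ?case unfolding expansionB_def .
qed

end
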